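(* For all constants $C_{\mathrm{reg}},C_{\mathrm{gr}}\geq 0$ there exists $\sigma_0\geq 0$ depending only on $C_{\mathrm{reg}},C_{\mathrm{gr}}$ such that the following holds. Let $\omega=\sum_{k\geq1}\omega_k$, where $\omega_k\in C_c^\infty(\mathbb R^2;(-\infty,0])$, $k\geq 1$, satisfy (i) $\omega_k=0$ for all $k$ large enough; (ii) $\operatorname{supp}\omega_k\subset\{\mathbf x\in\mathbb R^2:2^{k-1}\leq|\mathbf x|\leq2^{k+1}\}$ for all $k\geq1$; (iii) $\|\omega_k\|_{S^1_3}\leq C_{\mathrm{reg}}$ for all $k\geq1$; (iv) $\sum_{k=1}^\infty q_k\leq C_{\mathrm{gr}}$, where $q_k:=-\inf_{\theta\in\mathbb S^1}T(|\mathbf x|^{-2}\omega_k)(0,\theta)$. Then there exists $\widetilde\omega\in C_c^\infty(\mathbb R^2)$ (real-valued) such that $\widetilde\omega\leq\omega$ everywhere on $\mathbb R^2$ and, for every $\sigma\geq\sigma_0$, the function $$\widetilde u(\mathbf x+i\mathbf y):=E\widetilde\omega(\mathbf x+i\mathbf y)+\sigma|\mathbf y|,\qquad \mathbf x,\mathbf y\in\mathbb R^2,$$ is plurisubharmonic on $\mathbb C^2$.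
   Context: Kohn--Nirenberg norm: for $\psi\in C_c^\infty(\mathbb R^2)$, with $\langle\mathbf x\rangle:=\sqrt{1+|\mathbf x|^2}$, $$\|\psi\|_{S^1_3}:=\max_{|\gamma|\leq 3}\sup_{\mathbf x\in\mathbb R^2}\big|\langle\mathbf x\rangle^{|\gamma|-1}\partial^\gamma_{\mathbf x}\psi(\mathbf x)\big|,$$ where $\gamma$ ranges over multiindices. X-ray transform: for $\psi\in C_c^\infty(\mathbb R^2)$, $s\in\mathbb R$, $\theta\in\mathbb S^1=\mathbb R/2\pi\mathbb Z$, $$T\psi(s,\theta):=\int_{\mathbb R}\psi(t\cos\theta-s\sin\theta,\,t\sin\theta+s\cos\theta)\,dt.$$ Here $|\mathbf x|^{-2}\omega_k$ denotes the function $\mathbf x\mapsto|\mathbf x|^{-2}\omega_k(\mathbf x)$, which is in $C_c^\infty(\mathbb R^2)$ since $\omega_k$ vanishes near $0$. Extension operator: $E:C_c^\infty(\mathbb R^2)\to C^0(\mathbb C^2)$ is defined by $$E\omega(\mathbf x+i\mathbf y):=\frac1\pi\int_{\mathbb R}\frac{\omega(\mathbf x+t\mathbf y)}{1+t^2}\,dt,\qquad\mathbf x,\mathbf y\in\mathbb R^2.$$ Plurisubharmonicity: an upper semicontinuous function $u:\mathbb C^2\to[-\infty,\infty)$, not identically $-\infty$, is plurisubharmonic if $u(\mathbf z)\leq\frac1{2\pi}\int_{\mathbb S^1}u(\mathbf z+e^{i\theta}\mathbf v)\,d\theta$ for all $\mathbf z,\mathbf v\in\mathbb C^2$. *)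

theory Defs
  imports "HOL-Analysis.Analysis"
begin

definition partial_deriv :: "2 \<Rightarrow> (real^2 \<Rightarrow> real) \<Rightarrow> real^2 \<Rightarrow> real" where
  "partial_deriv i f x = frechet_derivative f (at x) (axis i 1)"

primrec C_k :: "nat \<Rightarrow> (real^2 \<Rightarrow> real) \<Rightarrow> bool" where
  "C_k 0 f \<longleftrightarrow> continuous_on UNIV f"
| "C_k (Suc k) f \<longleftrightarrow> f differentiable_on UNIV \<and> (\<forall>i. C_k k (partial_deriv i f))"

definition supp :: "(real^2 \<Rightarrow> real) \<Rightarrow> (real^2) set" where
  "supp f = closure {x. f x \<noteq> 0}"

definition Cc_smooth :: "(real^2 \<Rightarrow> real) set" where
  "Cc_smooth = {f. (\<forall>k. C_k k f) \<and> compact (supp f)}"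

text \<open>Multiindices are pairs \<open>\<gamma> = (a, b)\<close>, with \<open>a\<close> derivatives in the first
  and \<open>b\<close> derivatives in the second coordinate.\<close>

definition multi_deriv :: "nat \<times> nat \<Rightarrow> (real^2 \<Rightarrow> real) \<Rightarrow> real^2 \<Rightarrow> real" where
  "multi_deriv \<gamma> f = (partial_deriv 1 ^^ fst \<gamma>) ((partial_deriv 2 ^^ snd \<gamma>) f)"

definition multi_order :: "nat \<times> nat \<Rightarrow> nat" where
  "multi_order \<gamma> = fst \<gamma> + snd \<gamma>"

definition japanese_bracket :: "real^2 \<Rightarrow> real" where
  "japanese_bracket x = sqrt (1 + (norm x)\<^sup>2)"

text \<open>For functions in \<^term>\<open>Cc_smooth\<close> the suprema below are over bounded sets, so the real
  supremum is the true one.\<close>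

definition S13_norm :: "(real^2 \<Rightarrow> real) \<Rightarrow> real" where
  "S13_norm \<psi> = (MAX \<gamma>\<in>{\<gamma>. multi_order \<gamma> \<le> 3}.
     SUP x. \<bar>japanese_bracket x powi (int (multi_order \<gamma>) - 1) * multi_deriv \<gamma> \<psi> x\<bar>)"

text \<open>The angle \<open>\<theta>\<close> is represented by a real number; the transform is \<open>2\<pi>\<close>-periodic in it.\<close>

definition xray :: "(real^2 \<Rightarrow> real) \<Rightarrow> real \<Rightarrow> real \<Rightarrow> real" where
  "xray \<psi> s \<theta> =
     (LINT t|lborel. \<psi> (vector [t * cos \<theta> - s * sin \<theta>, t * sin \<theta> + s * cos \<theta>]))"

definition re_vec :: "complex^2 \<Rightarrow> real^2" where
  "re_vec z = (\<chi> i. Re (z $ i))"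

definition im_vec :: "complex^2 \<Rightarrow> real^2" where
  "im_vec z = (\<chi> i. Im (z $ i))"

definition extension :: "(real^2 \<Rightarrow> real) \<Rightarrow> complex^2 \<Rightarrow> real" where
  "extension \<omega> z =
     1 / pi * (LINT t|lborel. \<omega> (re_vec z + t *\<^sub>R im_vec z) / (1 + t\<^sup>2))"

text \<open>Lebesgue integral over \<open>[0, 2\<pi>]\<close> of an extended real function, as the integral of the
  positive part minus that of the negative part (\<^const>\<open>e2ennreal\<close> sends negative numbers
  to \<open>0\<close>). It is used only for functions that are bounded above, so that no
  \<open>\<infinity> - \<infinity>\<close> occurs.\<close>

definition circle_integral :: "(real \<Rightarrow> ereal) \<Rightarrow> ereal" where
  "circle_integral f =
     enn2ereal (\<integral>\<^sup>+\<theta>\<in>{0..2 * pi}. e2ennreal (f \<theta>) \<partial>lborel) -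
     enn2ereal (\<integral>\<^sup>+\<theta>\<in>{0..2 * pi}. e2ennreal (- f \<theta>) \<partial>lborel)"

definition upper_semicontinuous :: "(complex^2 \<Rightarrow> ereal) \<Rightarrow> bool" where
  "upper_semicontinuous u \<longleftrightarrow> (\<forall>c. open {z. u z < c})"

definition plurisubharmonic :: "(complex^2 \<Rightarrow> ereal) \<Rightarrow> bool" where
  "plurisubharmonic u \<longleftrightarrow>
     upper_semicontinuous u \<and> (\<forall>z. u z \<noteq> \<infinity>) \<and> (\<exists>z. u z \<noteq> -\<infinity>) \<and>
     (\<forall>z v. u z \<le> ereal (1 / (2 * pi)) * circle_integral (\<lambda>\<theta>. u (z + cis \<theta> *s v)))"

end

theory Submission
  imports Defs "HOL-Probability.Sinc_Integral"
begin

text \<open>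
  For \<open>y \<noteq> 0\<close> the complex Hessian of \<open>E\<omega>\<close> at \<open>x + iy\<close> is \<open>1/(4\<pi>)\<close> times
  the matrix \<open>\<integral> \<partial>\<^sub>j\<partial>\<^sub>k\<omega>(x + ty) dt\<close>.  It annihilates the direction \<open>y\<close>, and on the unit
  normal \<open>n\<close> of \<open>y\<close> it is the integral of \<open>\<partial>\<^sub>n\<^sup>2\<omega>\<close> along the line \<open>x + \<real>y\<close>.  The Hessian of
  \<open>\<sigma>|y|\<close> also annihilates \<open>y\<close> and is positive on \<open>n\<close>.  So if all line integrals of
  second normal derivatives of \<open>\<omega>\<close> along lines are at least \<open>-C\<close>, then
  \<open>E\<omega> + \<sigma>|y|\<close> has nonnegative Levi form off \<open>y = 0\<close> whenever \<open>\<sigma> \<ge> C\<close>.  The real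
  plane \<open>y = 0\<close> does no harm: a generic complex line meets it in a single point, near which
  the function is Lipschitz.  This is \<open>extension_plurisubharmonic\<close>.  It is proved by cutting the
  defining integral off at \<open>|t| \<le> R\<close>, replacing \<open>|y|\<close> by \<open>sqrt(|y|\<^sup>2 + \<eta>\<^sup>2)\<close> and adding a
  small multiple of \<open>log(|\<zeta> - \<zeta>\<^sub>0|\<^sup>2 + \<epsilon>\<^sup>2)\<close>, which pays for the missing part of the
  integral near the singular point \<open>\<zeta>\<^sub>0\<close>; the result is a \<open>C\<^sup>2\<close> subharmonic function
  (\<open>submean_independent\<close>).

  It remains to find a minorant of \<open>\<omega>\<close> whose line integrals are bounded below by
  constants that depend only on \<open>C_reg\<close> and \<open>C_gr\<close>.  Write \<open>I\<^sub>k(s)\<close> for the integral of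
  \<open>\<partial>\<^sub>n\<^sup>2\<omega>\<^sub>k\<close> along the line at offset \<open>s\<close>.  By the bound on third derivatives, \<open>I\<^sub>k\<close> has Lipschitz
  constant \<open>O(2^(-k))\<close>, and it vanishes for \<open>|s| > 2^(k+1)\<close>, but the values \<open>I\<^sub>k(0)\<close> need not be summable in \<open>k\<close>.
  Subtract the dilation average \<open>Q\<^sub>k(x) = \<integral>_1^2 \<omega>\<^sub>k(\<tau>x) d\<tau>/\<tau>\<close>.  Its line integral is
  \<open>\<integral>_1^2 I\<^sub>k(\<tau>s) d\<tau>\<close> (\<open>slice_dilation_mean\<close>), so the difference is \<open>O(|s| 2^(-k))\<close>,
  and the sum over \<open>2^(k+1) \<ge> |s|\<close> is bounded (\<open>slice_dilation_defect\<close>, \<open>geometric_sum_bound\<close>).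
  Since \<open>Q\<^sub>k \<le> 0\<close>, subtracting it is the wrong way round for a minorant; but \<open>Q\<^sub>k(x)\<close> is a radial
  average of \<open>\<omega>\<^sub>k\<close>, hence \<open>Q\<^sub>k \<ge> -16\<cdot>2\<^sup>k q\<^sub>k\<close> (\<open>dilation_mean_lower_bound\<close>).  Subtracting also
  a fixed bump, rescaled to \<open>16\<cdot>2\<^sup>k q\<^sub>k \<beta>(x/2\<^sup>k)\<close> restores the inequality and costs \<open>O(q\<^sub>k)\<close> in each line integral,
  which is summable by the growth condition.  The minorant is
  \<open>\<Sum>\<^sub>k (\<omega>\<^sub>k - Q\<^sub>k - 16\<cdot>2\<^sup>k q\<^sub>k \<beta>(\<cdot>/2\<^sup>k))\<close>.
\<close>

section \<open>Smooth functions on the plane\<close>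

text \<open>Smoothness on the whole plane: all iterated partial derivatives exist and are continuous.\<close>
definition smooth :: "(real^2 \<Rightarrow> real) \<Rightarrow> bool" where
  "smooth f \<longleftrightarrow> (\<forall>k. C_k k f)"

text \<open>The derivative of \<open>f\<close> at \<open>x\<close> in the direction \<open>a\<close>, not normalised, written through the partial
  derivatives so that it is linear in \<open>a\<close> by definition.\<close>
definition dirderiv :: "real^2 \<Rightarrow> (real^2 \<Rightarrow> real) \<Rightarrow> real^2 \<Rightarrow> real" where
  "dirderiv a f x = a$1 * partial_deriv 1 f x + a$2 * partial_deriv 2 f x"

lemma partial_deriv_eq:
  assumes "(f has_derivative D) (at x)"
  shows "partial_deriv i f x = D (axis i 1)"
  using frechet_derivative_at[OF assms] by (simp add: partial_deriv_def)

lemma vec2_decomp: "(h::real^2) = h$1 *\<^sub>R axis 1 1 + h$2 *\<^sub>R axis 2 1"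
  by (simp add: vec_eq_iff forall_2 axis_def)

lemma differentiable_has_derivative_dirderiv:
  assumes "f differentiable (at x)"
  shows "(f has_derivative (\<lambda>h. dirderiv h f x)) (at x)"
proof -
  obtain D where D: "(f has_derivative D) (at x)"
    using assms by (auto simp: differentiable_def)
  then have lin: "linear D" by (simp add: has_derivative_linear)
  have "D h = dirderiv h f x" for h
  proof -
    have "D h = D (h$1 *\<^sub>R axis 1 1 + h$2 *\<^sub>R axis 2 1)" using vec2_decomp by metis
    also have "\<dots> = h$1 * D (axis 1 1) + h$2 * D (axis 2 1)"
      by (simp add: linear_add[OF lin] linear_cmul[OF lin])
    finally show ?thesis by (simp add: dirderiv_def partial_deriv_eq[OF D])
  qed
  then have "D = (\<lambda>h. dirderiv h f x)" by auto
  with D show ?thesis by simp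
qed

lemma dirderiv_eq:
  assumes "(f has_derivative D) (at x)"
  shows "dirderiv h f x = D h"
proof -
  have "f differentiable (at x)" using assms by (auto simp: differentiable_def)
  from differentiable_has_derivative_dirderiv[OF this] assms
  have "(\<lambda>h. dirderiv h f x) = D" by (rule has_derivative_unique)
  then show ?thesis by metis
qed

text \<open>Coinduction: a class of differentiable functions that is closed under partial derivatives consists of
  smooth functions.\<close>
lemma smooth_coinduct:
  assumes "P f"
    and step: "\<And>g. P g \<Longrightarrow> (\<forall>x. g differentiable (at x)) \<and> (\<forall>i. P (partial_deriv i g))"
  shows "smooth f"
proof -
  have "\<forall>g. P g \<longrightarrow> C_k k g" for k
  proof (induction k)
    case 0
    then show ?case
      using step by (auto intro!: continuous_at_imp_continuous_on differentiable_imp_continuous_within)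
  next
    case (Suc k)
    then show ?case using step by (auto simp: differentiable_on_def)
  qed
  then show ?thesis using assms(1) by (auto simp: smooth_def)
qed

lemma smooth_differentiable: "smooth f \<Longrightarrow> f differentiable (at x)"
  unfolding smooth_def by (metis C_k.simps(2) UNIV_I differentiable_on_def)

lemma smooth_partial_deriv: "smooth f \<Longrightarrow> smooth (partial_deriv i f)"
  unfolding smooth_def by (metis C_k.simps(2))

lemma smooth_has_derivative:
  "smooth f \<Longrightarrow> (f has_derivative (\<lambda>h. dirderiv h f x)) (at x)"
  by (rule differentiable_has_derivative_dirderiv[OF smooth_differentiable])

lemma smooth_continuous: "smooth f \<Longrightarrow> continuous_on S f"
  using continuous_on_subset[of UNIV f S] unfolding smooth_def by (metis C_k.simps(1) subset_UNIV)

lemma C_k_add: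
  "C_k k f \<Longrightarrow> C_k k g \<Longrightarrow> C_k k (\<lambda>x. f x + g x)"
proof (induction k arbitrary: f g)
  case 0
  then show ?case by (auto intro: continuous_intros)
next
  case (Suc k)
  have d: "f differentiable (at x)" "g differentiable (at x)" for x
    using Suc.prems by (auto simp: differentiable_on_def)
  have "partial_deriv i (\<lambda>x. f x + g x) = (\<lambda>x. partial_deriv i f x + partial_deriv i g x)" for i
  proof
    fix x
    have "((\<lambda>x. f x + g x) has_derivative (\<lambda>h. dirderiv h f x + dirderiv h g x)) (at x)"
      by (intro has_derivative_add differentiable_has_derivative_dirderiv d)
    from partial_deriv_eq[OF this]
    show "partial_deriv i (\<lambda>x. f x + g x) x = partial_deriv i f x + partial_deriv i g x"
      by (simp add: partial_deriv_eq[OF differentiable_has_derivative_dirderiv[OF d(1)]]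
          partial_deriv_eq[OF differentiable_has_derivative_dirderiv[OF d(2)]])
  qed
  then show ?case using Suc d by (auto simp: differentiable_on_def intro!: derivative_intros)
qed

lemma smooth_add: "smooth f \<Longrightarrow> smooth g \<Longrightarrow> smooth (\<lambda>x. f x + g x)"
  by (simp add: smooth_def C_k_add)

lemma C_k_SucD: "C_k (Suc k) f \<Longrightarrow> C_k k f"
proof (induction k arbitrary: f)
  case 0
  then show ?case by (auto intro: differentiable_imp_continuous_on)
qed auto

lemma C_k_mult:
  "C_k k f \<Longrightarrow> C_k k g \<Longrightarrow> C_k k (\<lambda>x. f x * g x)"
proof (induction k arbitrary: f g)
  case 0
  then show ?case by (auto intro: continuous_intros)
next
  case (Suc k)
  have d: "f differentiable (at x)" "g differentiable (at x)" for x
    using Suc.prems by (auto simp: differentiable_on_def)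
  have "partial_deriv i (\<lambda>x. f x * g x) = (\<lambda>x. f x * partial_deriv i g x + partial_deriv i f x * g x)" for i
  proof
    fix x
    note d' = d[of x, THEN differentiable_has_derivative_dirderiv]
    from partial_deriv_eq[OF has_derivative_mult[OF d']]
    show "partial_deriv i (\<lambda>x. f x * g x) x = f x * partial_deriv i g x + partial_deriv i f x * g x"
      by (simp add: partial_deriv_eq[OF d'(1)] partial_deriv_eq[OF d'(2)])
  qed
  moreover have "C_k k f" "C_k k g" using Suc.prems by (auto intro: C_k_SucD)
  ultimately show ?case
    using Suc d by (auto simp: differentiable_on_def intro!: C_k_add differentiable_mult)
qed

lemma smooth_mult: "smooth f \<Longrightarrow> smooth g \<Longrightarrow> smooth (\<lambda>x. f x * g x)"
  by (simp add: smooth_def C_k_mult)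

lemma smooth_const: "smooth (\<lambda>x. c)"
proof (rule smooth_coinduct[where P="\<lambda>f. \<exists>c. f = (\<lambda>x. c)"])
  fix g :: "real^2 \<Rightarrow> real" assume "\<exists>c. g = (\<lambda>x. c)"
  then obtain c where g: "g = (\<lambda>x. c)" by auto
  have "partial_deriv i g = (\<lambda>x. 0)" for i
    using partial_deriv_eq[OF has_derivative_const] by (auto simp: g)
  then show "(\<forall>x. g differentiable at x) \<and> (\<forall>i. \<exists>c. partial_deriv i g = (\<lambda>x. c))"
    by (auto simp: g)
qed auto

lemma smooth_cmult: "smooth f \<Longrightarrow> smooth (\<lambda>x. c * f x)"
  by (intro smooth_mult smooth_const)

lemma smooth_diff: 
  assumes "smooth f" "smooth g" shows "smooth (\<lambda>x. f x - g x)"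
  using smooth_add[OF assms(1) smooth_cmult[OF assms(2), of "-1"]] by simp

lemma smooth_sum:
  "(\<And>k. k \<in> A \<Longrightarrow> smooth (f k)) \<Longrightarrow> smooth (\<lambda>x. \<Sum>k\<in>A. f k x)"
  by (induction A rule: infinite_finite_induct) (auto intro: smooth_const smooth_add)

lemma smooth_component: "smooth (\<lambda>x. x $ i)"
proof (rule smooth_coinduct[where P="\<lambda>f. f = (\<lambda>x. x $ i) \<or> smooth f"])
  fix g :: "real^2 \<Rightarrow> real" assume g: "g = (\<lambda>x. x $ i) \<or> smooth g"
  have d: "((\<lambda>x. x $ i) has_derivative (\<lambda>h. h $ i)) (at x)" for x :: "real^2"
    by (intro bounded_linear_imp_has_derivative bounded_linear_vec_nth)
  have "partial_deriv j (\<lambda>x. x $ i) = (\<lambda>x. axis j 1 $ i)" for j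
    using partial_deriv_eq[OF d] by auto
  then show "(\<forall>x. g differentiable at x) \<and>
      (\<forall>j. partial_deriv j g = (\<lambda>x. x $ i) \<or> smooth (partial_deriv j g))"
    using g d smooth_const smooth_differentiable smooth_partial_deriv
    by (metis differentiable_def)
qed auto

lemma smooth_dirderiv: "smooth f \<Longrightarrow> smooth (dirderiv a f)"
  unfolding dirderiv_def[abs_def]
  by (intro smooth_add smooth_cmult smooth_partial_deriv)

lemma smooth_scale:
  assumes "smooth f" shows "smooth (\<lambda>x. f (c *\<^sub>R x))"
proof (rule smooth_coinduct[where P="\<lambda>h. \<exists>g b. smooth g \<and> h = (\<lambda>x. b * g (c *\<^sub>R x))"])
  show "\<exists>g b. smooth g \<and> (\<lambda>x. f (c *\<^sub>R x)) = (\<lambda>x. b * g (c *\<^sub>R x))"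
    using assms by (intro exI[of _ f] exI[of _ 1]) auto
next
  fix h assume "\<exists>g b. smooth g \<and> h = (\<lambda>x. b * g (c *\<^sub>R x))"
  then obtain g b where g: "smooth g" "h = (\<lambda>x. b * g (c *\<^sub>R x))" by auto
  have d: "((\<lambda>x. b * g (c *\<^sub>R x)) has_derivative (\<lambda>v. b * dirderiv (c *\<^sub>R v) g (c *\<^sub>R x))) (at x)" for x
    by (intro has_derivative_mult_right has_derivative_compose[OF _ smooth_has_derivative[OF g(1)]])
      (auto intro!: derivative_eq_intros)
  have "partial_deriv i h = (\<lambda>x. b * c * partial_deriv i g (c *\<^sub>R x))" for i
    using partial_deriv_eq[OF d, of i]
      partial_deriv_eq[OF smooth_has_derivative[OF g(1)], of i]
    by (auto simp: g(2) dirderiv_def algebra_simps)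
  then show "(\<forall>x. h differentiable at x) \<and>
      (\<forall>i. \<exists>g b. smooth g \<and> partial_deriv i h = (\<lambda>x. b * g (c *\<^sub>R x)))"
    using d g smooth_partial_deriv by (metis differentiable_def)
qed

lemma dirderiv_vec_add: "dirderiv (a + b) f x = dirderiv a f x + dirderiv b f x"
  and dirderiv_vec_scale: "dirderiv (c *\<^sub>R a) f x = c * dirderiv a f x"
  by (simp_all add: dirderiv_def algebra_simps)

lemma dirderiv_add:
  assumes "smooth f" "smooth g"
  shows "dirderiv a (\<lambda>x. f x + g x) = (\<lambda>x. dirderiv a f x + dirderiv a g x)"
  using dirderiv_eq[OF has_derivative_add[OF smooth_has_derivative smooth_has_derivative]] assms by blast

lemma dirderiv_cmult:
  assumes "smooth f"
  shows "dirderiv a (\<lambda>x. c * f x) = (\<lambda>x. c * dirderiv a f x)"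
  using dirderiv_eq[OF has_derivative_mult_right[OF smooth_has_derivative]] assms by blast

lemma dirderiv_diff:
  assumes "smooth f" "smooth g"
  shows "dirderiv a (\<lambda>x. f x - g x) = (\<lambda>x. dirderiv a f x - dirderiv a g x)"
  using dirderiv_eq[OF has_derivative_diff[OF smooth_has_derivative smooth_has_derivative]] assms by blast

lemma dirderiv_sum:
  assumes "\<And>k. k \<in> A \<Longrightarrow> smooth (f k)"
  shows "dirderiv a (\<lambda>x. \<Sum>k\<in>A. f k x) = (\<lambda>x. \<Sum>k\<in>A. dirderiv a (f k) x)"
proof
  fix x
  show "dirderiv a (\<lambda>x. \<Sum>k\<in>A. f k x) x = (\<Sum>k\<in>A. dirderiv a (f k) x)"
    by (rule dirderiv_eq[OF has_derivative_sum]) (use assms smooth_has_derivative in auto)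
qed

lemma dirderiv_scale:
  assumes "smooth f"
  shows "dirderiv a (\<lambda>x. f (c *\<^sub>R x)) = (\<lambda>x. c * dirderiv a f (c *\<^sub>R x))"
proof
  fix x
  have "((\<lambda>x. f (c *\<^sub>R x)) has_derivative (\<lambda>v. dirderiv (c *\<^sub>R v) f (c *\<^sub>R x))) (at x)"
    by (intro has_derivative_compose[OF _ smooth_has_derivative[OF assms]])
      (auto intro!: derivative_eq_intros)
  from dirderiv_eq[OF this] show "dirderiv a (\<lambda>x. f (c *\<^sub>R x)) x = c * dirderiv a f (c *\<^sub>R x)"
    by (simp add: dirderiv_vec_scale)
qed

lemma has_derivative_affine_line:
  assumes "smooth f"
  shows "((\<lambda>t. f (p + t *\<^sub>R v)) has_real_derivative dirderiv v f (p + t *\<^sub>R v)) (at t)"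
proof -
  have "((\<lambda>t. f (p + t *\<^sub>R v)) has_derivative (\<lambda>h. dirderiv (h *\<^sub>R v) f (p + t *\<^sub>R v))) (at t)"
    by (rule has_derivative_compose[OF _ smooth_has_derivative[OF assms]])
      (auto intro!: derivative_eq_intros)
  then show ?thesis
    by (simp add: has_field_derivative_def dirderiv_vec_scale mult_commute_abs)
qed

lemma continuous_on_smooth_compose:
  assumes "smooth f" "continuous_on S g"
  shows "continuous_on S (\<lambda>x. f (g x))"
  using continuous_on_compose2[OF smooth_continuous[OF assms(1), of UNIV] assms(2)] by simp

text \<open>Symmetry of second derivatives.  With \<open>F(s, h) = f(x + sa + hb)\<close>, differentiating
  \<open>F(s, h) - F(-1, h) = \<integral> \<partial>\<^sub>sF\<close> in \<open>h\<close> under the integral and then in \<open>s\<close> gives both orders of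
  differentiation.  The base point \<open>-1\<close> makes \<open>s = 0\<close> an interior point.\<close>
lemma dirderiv_commute:
  assumes f: "smooth f"
  shows "dirderiv a (dirderiv b f) x = dirderiv b (dirderiv a f) x"
proof -
  let ?p = "\<lambda>s h. x + s *\<^sub>R a + h *\<^sub>R b"
  note sm = smooth_dirderiv[OF f] 
  note sm2 = smooth_dirderiv[OF sm]
  have FTC: "integral {-1..s} (\<lambda>u. dirderiv a f (?p u h)) = f (?p s h) - f (?p (-1) h)"
    if "s \<ge> -1" for s h
  proof (rule integral_unique, rule fundamental_theorem_of_calculus[OF that])
    fix u
    show "((\<lambda>s. f (?p s h)) has_vector_derivative dirderiv a f (?p u h)) (at u within {-1..s})"
      using has_derivative_affine_line[OF f, of "x + h *\<^sub>R b" a u]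
      by (simp add: has_real_derivative_iff_has_vector_derivative algebra_simps
          has_vector_derivative_at_within)
  qed
  have diff: "((\<lambda>h. integral {-1..s} (\<lambda>u. dirderiv a f (?p u h))) has_real_derivative
      integral {-1..s} (\<lambda>u. dirderiv b (dirderiv a f) (?p u 0))) (at 0)" for s
    unfolding cbox_interval[symmetric]
    by (rule leibniz_rule_field_derivative[where U=UNIV])
      (auto intro!: has_derivative_affine_line sm sm2 integrable_continuous_interval continuous_intros
         continuous_on_smooth_compose[OF sm] continuous_on_smooth_compose[OF sm2] simp: split_beta)
  have eq: "dirderiv b f (?p s 0) - dirderiv b f (?p (-1) 0) =
      integral {-1..s} (\<lambda>u. dirderiv b (dirderiv a f) (?p u 0))" if "s \<ge> -1" for s
  proof -
    have "((\<lambda>h. f (?p s h) - f (?p (-1) h)) has_real_derivative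
       dirderiv b f (?p s 0) - dirderiv b f (?p (-1) 0)) (at 0)"
      by (intro derivative_intros has_derivative_affine_line f)
    with diff[of s] show ?thesis
      unfolding FTC[OF that] by (rule DERIV_unique[symmetric])
  qed
  have "((\<lambda>s. integral {-1..s} (\<lambda>u. dirderiv b (dirderiv a f) (?p u 0))) has_real_derivative
      dirderiv b (dirderiv a f) (?p 0 0)) (at 0 within {-1..1})"
    by (rule integral_has_real_derivative) (auto intro!: continuous_intros continuous_on_smooth_compose[OF sm2])
  then have 1: "((\<lambda>s. integral {-1..s} (\<lambda>u. dirderiv b (dirderiv a f) (?p u 0))) has_real_derivative
      dirderiv b (dirderiv a f) (?p 0 0)) (at 0)"
    by (simp add: at_within_Icc_at)
  have 2: "((\<lambda>s. dirderiv b f (?p s 0) - dirderiv b f (?p (-1) 0)) has_real_derivative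
      dirderiv a (dirderiv b f) (?p 0 0) - 0) (at 0)"
    using has_derivative_affine_line[OF sm, of b x a 0] 
    by (intro derivative_intros) auto
  have "((\<lambda>s. integral {-1..s} (\<lambda>u. dirderiv b (dirderiv a f) (?p u 0))) has_real_derivative
      dirderiv a (dirderiv b f) (?p 0 0) - 0) (at 0)"
    by (rule has_field_derivative_transform_within_open[OF 2, of "{-1<..<1}"])
     (use eq in auto)
  from DERIV_unique[OF 1 this] show ?thesis by simp
qed

lemma dirderiv_eq_0_open:
  assumes "open S" "x \<in> S" "\<And>y. y \<in> S \<Longrightarrow> f y = 0"
  shows "dirderiv a f x = 0"
proof (rule dirderiv_eq)
  show "(f has_derivative (\<lambda>h. 0)) (at x)"
    by (rule has_derivative_transform_within_open[of "\<lambda>x. 0" _ _ _ S]) (use assms in auto)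
qed

section \<open>A submean inequality for families of twice differentiable functions\<close>

text \<open>A family \<open>g \<zeta> t\<close> of functions of \<open>\<zeta>\<close> with parameter \<open>t\<close>, twice differentiable in \<open>\<zeta>\<close>, such that the function and
  its derivatives are jointly continuous in \<open>\<zeta>\<close> and \<open>t\<close>.
  The derivative of \<open>g\<close> in the real direction \<open>u\<close> is \<open>g1 \<zeta> t u\<close>; the derivative of that in the direction \<open>v\<close> is
  \<open>g2 \<zeta> t u v\<close>.  The Laplacian in \<open>\<zeta>\<close> is \<open>g2 \<zeta> t 1 1 + g2 \<zeta> t \<i> \<i>\<close>.\<close>
definition C2_family ::
  "(complex \<Rightarrow> real \<Rightarrow> real) \<Rightarrow> (complex \<Rightarrow> real \<Rightarrow> complex \<Rightarrow> real) \<Rightarrow>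
   (complex \<Rightarrow> real \<Rightarrow> complex \<Rightarrow> complex \<Rightarrow> real) \<Rightarrow> bool" where
  "C2_family g g1 g2 \<longleftrightarrow>
     (\<forall>\<zeta> t. ((\<lambda>\<zeta>. g \<zeta> t) has_derivative g1 \<zeta> t) (at \<zeta>)) \<and>
     (\<forall>\<zeta> t u. ((\<lambda>\<zeta>. g1 \<zeta> t u) has_derivative g2 \<zeta> t u) (at \<zeta>)) \<and>
     continuous_on UNIV (\<lambda>(\<zeta>, t). g \<zeta> t) \<and>
     (\<forall>u. continuous_on UNIV (\<lambda>(\<zeta>, t). g1 \<zeta> t u)) \<and>
     (\<forall>u v. continuous_on UNIV (\<lambda>(\<zeta>, t). g2 \<zeta> t u v))"

lemma linear_complex_decomp:
  assumes "linear (D :: complex \<Rightarrow> real)"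
  shows "D z = Re z * D 1 + Im z * D \<i>"
proof -
  have "z = Re z *\<^sub>R 1 + Im z *\<^sub>R \<i>" by (simp add: complex_eq_iff)
  then have "D z = D (Re z *\<^sub>R 1 + Im z *\<^sub>R \<i>)" by simp
  then show ?thesis by (simp only: linear_add[OF assms] linear_cmul[OF assms]) simp
qed

text \<open>If the Laplacian of \<open>\<integral> g \<zeta> t dt\<close> is nonnegative on the unit disc, then the value at \<open>0\<close> is at most the
  mean over the unit circle.  Keeping \<open>t\<close> as a parameter avoids differentiating the inner integral separately.\<close>
lemma C2_family_submean:
  assumes g: "C2_family g g1 g2"
    and lap: "\<And>\<zeta>. norm \<zeta> \<le> 1 \<Longrightarrow> 0 \<le> integral {-R..R} (\<lambda>t. g2 \<zeta> t 1 1 + g2 \<zeta> t \<i> \<i>)"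
  shows "2 * pi * integral {-R..R} (g 0) \<le>
    integral {0..2*pi} (\<lambda>\<phi>. integral {-R..R} (g (cis \<phi>)))"
proof -
  define Z where "Z r \<phi> = complex_of_real r * cis \<phi>" for r \<phi>
  have d0: "((\<lambda>\<zeta>. g \<zeta> t) has_derivative g1 \<zeta> t) (at \<zeta>)"
    and d1: "((\<lambda>\<zeta>. g1 \<zeta> t u) has_derivative g2 \<zeta> t u) (at \<zeta>)" for \<zeta> t u
    using g by (auto simp: C2_family_def)
  have c0: "continuous_on S (\<lambda>x. g (p x) (q x))"
    and c1: "continuous_on S (\<lambda>x. g1 (p x) (q x) u)"
    and c2: "continuous_on S (\<lambda>x. g2 (p x) (q x) u v)"
    if "continuous_on S p" "continuous_on S q" for S :: "'x::t2_space set" and p q u v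
  proof -
    have pq: "continuous_on S (\<lambda>x. (p x, q x))" using that by (intro continuous_intros)
    have "continuous_on UNIV (\<lambda>(\<zeta>, t). g \<zeta> t)" "continuous_on UNIV (\<lambda>(\<zeta>, t). g1 \<zeta> t u)"
      "continuous_on UNIV (\<lambda>(\<zeta>, t). g2 \<zeta> t u v)"
      using g by (auto simp: C2_family_def)
    from this[THEN continuous_on_compose2, OF pq] show
      "continuous_on S (\<lambda>x. g (p x) (q x))" "continuous_on S (\<lambda>x. g1 (p x) (q x) u)"
      "continuous_on S (\<lambda>x. g2 (p x) (q x) u v)" by auto
  qed
  have cZ: "continuous_on S (\<lambda>x. Z (p x) (q x))"
    if "continuous_on S p" "continuous_on S q" for S :: "'x::t2_space set" and p q
    unfolding Z_def using that by (intro continuous_intros)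
  note cont = c0 c1 c2 cZ
  have Zr: "((\<lambda>r. Z r \<phi>) has_derivative (\<lambda>h. h *\<^sub>R cis \<phi>)) (at r)" for r \<phi>
    unfolding Z_def by (auto intro!: derivative_eq_intros simp: scaleR_conv_of_real)
  have Z\<phi>: "((\<lambda>\<phi>. Z r \<phi>) has_derivative (\<lambda>h. h *\<^sub>R (r *\<^sub>R (\<i> * cis \<phi>)))) (at \<phi>)" for r \<phi>
    unfolding Z_def
    by (auto intro!: derivative_eq_intros simp: scaleR_conv_of_real algebra_simps)
  have lin: "linear (g1 \<zeta> t)" "linear (g2 \<zeta> t u)" for \<zeta> t u
    using d0 d1 has_derivative_linear by blast+
  note dec = linear_complex_decomp[OF lin(1), of _ _ "cis _"]
     linear_complex_decomp[OF lin(1), of _ _ "\<i> * cis _"]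
     linear_complex_decomp[OF lin(2), of _ _ _ "cis _"]
     linear_complex_decomp[OF lin(2), of _ _ _ "\<i> * cis _"]
  define Fr where "Fr r \<phi> t = cos \<phi> * g1 (Z r \<phi>) t 1 + sin \<phi> * g1 (Z r \<phi>) t \<i>" for r \<phi> t
  define Frr where "Frr r \<phi> t =
     cos \<phi> * (cos \<phi> * g2 (Z r \<phi>) t 1 1 + sin \<phi> * g2 (Z r \<phi>) t 1 \<i>)
     + sin \<phi> * (cos \<phi> * g2 (Z r \<phi>) t \<i> 1 + sin \<phi> * g2 (Z r \<phi>) t \<i> \<i>)" for r \<phi> t
  define Fp where "Fp r \<phi> t = r * (- sin \<phi> * g1 (Z r \<phi>) t 1 + cos \<phi> * g1 (Z r \<phi>) t \<i>)" for r \<phi> t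
  define Fpp where "Fpp r \<phi> t = r\<^sup>2 * (- sin \<phi> * (- sin \<phi> * g2 (Z r \<phi>) t 1 1 + cos \<phi> * g2 (Z r \<phi>) t 1 \<i>)
     + cos \<phi> * (- sin \<phi> * g2 (Z r \<phi>) t \<i> 1 + cos \<phi> * g2 (Z r \<phi>) t \<i> \<i>)) - r * Fr r \<phi> t" for r \<phi> t
  have Fr: "((\<lambda>r. g (Z r \<phi>) t) has_real_derivative Fr r \<phi> t) (at r)" for r \<phi> t
    using has_derivative_compose[OF Zr d0]
    by (simp add: has_field_derivative_def linear_cmul[OF lin(1)] dec Fr_def mult_commute_abs)
  have g1r: "((\<lambda>r. g1 (Z r \<phi>) t u) has_real_derivative
      cos \<phi> * g2 (Z r \<phi>) t u 1 + sin \<phi> * g2 (Z r \<phi>) t u \<i>) (at r)" for r \<phi> t u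
    using has_derivative_compose[OF Zr d1]
    by (simp add: has_field_derivative_def linear_cmul[OF lin(2)] dec mult_commute_abs)
  have g1p: "((\<lambda>\<phi>. g1 (Z r \<phi>) t u) has_real_derivative
      r * (- sin \<phi> * g2 (Z r \<phi>) t u 1 + cos \<phi> * g2 (Z r \<phi>) t u \<i>)) (at \<phi>)" for r \<phi> t u
    unfolding has_field_derivative_def
    by (rule has_derivative_eq_rhs[OF has_derivative_compose[OF Z\<phi> d1]])
      (simp add: fun_eq_iff linear_cmul[OF lin(2)] dec)
  have Frr: "((\<lambda>r. Fr r \<phi> t) has_real_derivative Frr r \<phi> t) (at r)" for r \<phi> t
    unfolding Fr_def Frr_def by (auto intro!: derivative_eq_intros g1r)
  have Fpp: "((\<lambda>\<phi>. Fp r \<phi> t) has_real_derivative Fpp r \<phi> t) (at \<phi>)" for r \<phi> t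
    unfolding Fp_def Fpp_def Fr_def
    by (auto intro!: derivative_eq_intros g1p simp: algebra_simps power2_eq_square)
  have cFr: "continuous_on S (\<lambda>x. Fr (p x) (q x) (s x))"
    and cFrr: "continuous_on S (\<lambda>x. Frr (p x) (q x) (s x))"
    and cFpp: "continuous_on S (\<lambda>x. Fpp (p x) (q x) (s x))"
    if "continuous_on S p" "continuous_on S q" "continuous_on S s"
    for S :: "'x::t2_space set" and p q s
    using that unfolding Fpp_def Frr_def Fr_def
    by (auto intro!: continuous_intros cont)
  define B where "B = cbox (0::real, -R) (2*pi, R)"
  \<comment> \<open>\<open>M r\<close> is \<open>2\<pi>\<close> times the circular mean of radius \<open>r\<close>; the aim is \<open>(r M')' \<ge> 0\<close>.\<close>
  define M where "M r = integral B (\<lambda>(\<phi>, t). g (Z r \<phi>) t)" for r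
  define M1 where "M1 r = integral B (\<lambda>(\<phi>, t). Fr r \<phi> t)" for r
  define M2 where "M2 r = integral B (\<lambda>(\<phi>, t). Frr r \<phi> t)" for r
  have M1: "(M has_real_derivative M1 r) (at r)" for r
    unfolding M_def[abs_def] M1_def B_def
    by (rule leibniz_rule_field_derivative[where U=UNIV])
      (auto intro!: Fr integrable_continuous cont cFr continuous_intros simp: split_beta)
  have M2: "(M1 has_real_derivative M2 r) (at r)" for r
    unfolding M1_def[abs_def] M2_def B_def
    by (rule leibniz_rule_field_derivative[where U=UNIV])
      (auto intro!: Frr integrable_continuous cFr cFrr continuous_intros simp: split_beta)
  have Fpp0: "integral B (\<lambda>(\<phi>, t). Fpp r \<phi> t) = 0" for r
  proof -
    have "integral B (\<lambda>(\<phi>, t). Fpp r \<phi> t) =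
       integral (cbox (-R) R) (\<lambda>t. integral (cbox 0 (2*pi)) (\<lambda>\<phi>. Fpp r \<phi> t))"
    proof -
      have c: "continuous_on (cbox (0, -R) (2*pi, R)) (\<lambda>(\<phi>, t). Fpp r \<phi> t)"
        by (auto intro!: cFpp continuous_intros simp: split_beta)
      show ?thesis
        unfolding B_def integral_prod_continuous[OF c] prod.case
        by (rule integral_swap_continuous[OF c])
    qed
    also have "\<dots> = integral (cbox (-R) R) (\<lambda>t. Fp r (2*pi) t - Fp r 0 t)"
      by (intro integral_cong integral_unique)
        (auto intro!: fundamental_theorem_of_calculus Fpp[THEN DERIV_subset]
           simp: has_real_derivative_iff_has_vector_derivative[symmetric])
    also have "\<dots> = 0" by (simp add: Fp_def Z_def)
    finally show ?thesis .
  qed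
  \<comment> \<open>\<open>r\<^sup>2 F\<^sub>r\<^sub>r + r F\<^sub>r + F\<^sub>\<phi>\<^sub>\<phi>\<close> is \<open>r\<^sup>2\<close> times the Laplacian, and \<open>F\<^sub>\<phi>\<^sub>\<phi>\<close> integrates to \<open>0\<close> by periodicity.\<close>
  have J: "0 \<le> r * (M1 r + r * M2 r)" if r: "0 \<le> r" "r \<le> 1" for r
  proof -
    have [simp]: "(\<lambda>(\<phi>, t). Fr r \<phi> t) integrable_on B" "(\<lambda>(\<phi>, t). Frr r \<phi> t) integrable_on B"
      "(\<lambda>(\<phi>, t). Fpp r \<phi> t) integrable_on B"
      unfolding B_def
      by (auto intro!: integrable_continuous cFr cFrr cFpp continuous_intros simp: split_beta)
    have "r * (M1 r + r * M2 r) = r * M1 r + r\<^sup>2 * M2 r + integral B (\<lambda>(\<phi>, t). Fpp r \<phi> t)"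
      by (simp add: Fpp0 algebra_simps power2_eq_square)
    also have "\<dots> = integral B (\<lambda>x. r * (case x of (\<phi>, t) \<Rightarrow> Fr r \<phi> t)
        + r\<^sup>2 * (case x of (\<phi>, t) \<Rightarrow> Frr r \<phi> t) + (case x of (\<phi>, t) \<Rightarrow> Fpp r \<phi> t))"
      unfolding M1_def M2_def
      by (simp add: integral_add integrable_add integrable_on_mult_right)
    also have "\<dots> = integral B (\<lambda>(\<phi>, t). r\<^sup>2 * (g2 (Z r \<phi>) t 1 1 + g2 (Z r \<phi>) t \<i> \<i>))"
    proof (intro integral_cong, clarsimp)
      fix \<phi> t
      have "r * Fr r \<phi> t + r\<^sup>2 * Frr r \<phi> t + Fpp r \<phi> t =
         r\<^sup>2 * (((sin \<phi>)\<^sup>2 + (cos \<phi>)\<^sup>2) * (g2 (Z r \<phi>) t 1 1 + g2 (Z r \<phi>) t \<i> \<i>))"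
        by (simp only: Frr_def Fpp_def) algebra
      then show "r * Fr r \<phi> t + r\<^sup>2 * Frr r \<phi> t + Fpp r \<phi> t =
         r\<^sup>2 * (g2 (Z r \<phi>) t 1 1 + g2 (Z r \<phi>) t \<i> \<i>)" by simp
    qed
    also have "\<dots> = integral {0..2*pi} (\<lambda>\<phi>. r\<^sup>2 * integral {-R..R} (\<lambda>t. g2 (Z r \<phi>) t 1 1 + g2 (Z r \<phi>) t \<i> \<i>))"
      unfolding B_def
      by (subst integral_prod_continuous) (auto intro!: continuous_intros cont simp: split_beta)
    also have "\<dots> \<ge> 0"
    proof (rule integral_nonneg)
      show "(\<lambda>\<phi>. r\<^sup>2 * integral {-R..R} (\<lambda>t. g2 (Z r \<phi>) t 1 1 + g2 (Z r \<phi>) t \<i> \<i>)) integrable_on {0..2*pi}"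
      proof -
        have "continuous_on ({0..2*pi} \<times> cbox (-R) R)
            (\<lambda>(\<phi>, t). g2 (Z r \<phi>) t 1 1 + g2 (Z r \<phi>) t \<i> \<i>)"
          unfolding split_beta by (intro continuous_intros cont)
        from integral_continuous_on_param[OF this] show ?thesis
          by (auto intro!: integrable_continuous_interval continuous_intros)
      qed
    qed (use r in \<open>auto intro!: mult_nonneg_nonneg lap simp: Z_def norm_mult\<close>)
    finally show ?thesis by simp
  qed
  have K: "0 \<le> r * M1 r" if "0 \<le> r" "r \<le> 1" for r
  proof -
    have "0 * M1 0 \<le> r * M1 r"
    proof (rule DERIV_nonneg_imp_nondecreasing[OF that(1), where f="\<lambda>r. r * M1 r"])
      fix x assume x: "0 \<le> x" "x \<le> r"
      have "((\<lambda>r. r * M1 r) has_real_derivative M1 x + x * M2 x) (at x)"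
        by (auto intro!: derivative_eq_intros M2)
      moreover have "0 \<le> M1 x + x * M2 x"
      proof (cases "x = 0")
        case True
        \<comment> \<open>Division by \<open>r\<close> is impossible at \<open>r = 0\<close>; there the radial derivative has mean zero.\<close>
        have "integral {0..2*pi} (\<lambda>\<phi>. integral {-R..R} (\<lambda>t. cos \<phi> * g1 0 t 1 + sin \<phi> * g1 0 t \<i>)) = 
           integral {-R..R} (\<lambda>t. integral {0..2*pi} (\<lambda>\<phi>. cos \<phi> * g1 0 t 1 + sin \<phi> * g1 0 t \<i>))"
        proof -
          have "continuous_on (cbox (0, -R) (2*pi, R)) (\<lambda>(\<phi>, t). cos \<phi> * g1 0 t 1 + sin \<phi> * g1 0 t \<i>)"
            unfolding split_beta by (intro continuous_intros c1)
          from integral_swap_continuous[OF this] show ?thesis by simp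
        qed
        also have "\<dots> = integral {-R..R} (\<lambda>t. 0)"
        proof (intro integral_cong integral_unique)
          fix t
          have "((\<lambda>\<phi>. cos \<phi> * g1 0 t 1 + sin \<phi> * g1 0 t \<i>) has_integral
             (sin (2*pi) * g1 0 t 1 - cos (2*pi) * g1 0 t \<i>) - (sin 0 * g1 0 t 1 - cos 0 * g1 0 t \<i>)) {0..2*pi}"
            by (rule fundamental_theorem_of_calculus)
              (auto intro!: derivative_eq_intros simp: has_real_derivative_iff_has_vector_derivative[symmetric])
          then show "((\<lambda>\<phi>. cos \<phi> * g1 0 t 1 + sin \<phi> * g1 0 t \<i>) has_integral 0) {0..2*pi}"
            by simp
        qed
        finally have "M1 0 = 0"
          unfolding M1_def B_def
          by (subst integral_prod_continuous)
            (auto intro!: continuous_intros cont simp: split_beta Fr_def Z_def)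
        then show ?thesis using True by simp
      next
        case False
        then show ?thesis using J[of x] x that by (auto simp: zero_le_mult_iff)
      qed
      ultimately show "\<exists>y. ((\<lambda>r. r * M1 r) has_real_derivative y) (at x) \<and> 0 \<le> y" by blast
    qed
    then show ?thesis by simp
  qed
  have "M 0 \<le> M 1"
  proof (rule DERIV_nonneg_imp_increasing_open[of 0 1 M])
    fix x :: real assume x: "0 < x" "x < 1"
    have "0 \<le> M1 x" using K[of x] x by (auto simp: zero_le_mult_iff)
    then show "\<exists>y. (M has_real_derivative y) (at x) \<and> 0 \<le> y" using M1 by blast
  next
    show "continuous_on {0..1} M"
      using M1 by (meson DERIV_isCont continuous_at_imp_continuous_on)
  qed simp
  moreover have "M r = integral {0..2*pi} (\<lambda>\<phi>. integral {-R..R} (g (Z r \<phi>)))" for r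
    unfolding M_def B_def
    by (subst integral_prod_continuous) (auto intro!: continuous_intros cont simp: split_beta)
  ultimately show ?thesis by (simp add: Z_def)
qed

lemma C2_family_add:
  assumes "C2_family f f1 f2" "C2_family g g1 g2"
  shows "C2_family (\<lambda>\<zeta> t. f \<zeta> t + g \<zeta> t) (\<lambda>\<zeta> t u. f1 \<zeta> t u + g1 \<zeta> t u)
     (\<lambda>\<zeta> t u v. f2 \<zeta> t u v + g2 \<zeta> t u v)"
  using assms unfolding C2_family_def split_beta
  by (auto intro!: has_derivative_add continuous_on_add)

lemma C2_family_scale:
  assumes "C2_family f f1 f2" "continuous_on UNIV c"
  shows "C2_family (\<lambda>\<zeta> t. c t * f \<zeta> t) (\<lambda>\<zeta> t u. c t * f1 \<zeta> t u)
     (\<lambda>\<zeta> t u v. c t * f2 \<zeta> t u v)"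
proof -
  have "continuous_on UNIV (\<lambda>x::complex \<times> real. c (snd x))"
    using assms(2) by (rule continuous_on_compose2) (auto intro: continuous_intros)
  then show ?thesis
  using assms(1) unfolding C2_family_def split_beta
  by (auto intro!: has_derivative_mult_right continuous_on_mult)
qed

section \<open>Line integrals of second derivatives\<close>

lemma LINT_compact_support:
  fixes g :: "real \<Rightarrow> real"
  assumes "continuous_on UNIV g" "\<And>t. R < \<bar>t\<bar> \<Longrightarrow> g t = 0"
  shows "integrable lborel g" "(LINT t|lborel. g t) = integral {-R..R} g"
proof -
  have "g t = g t * indicator {-R..R} t" for t
    using assms(2)[of t] by (cases "R < \<bar>t\<bar>") (auto simp: indicator_def)
  then have eq: "g = (\<lambda>t. g t * indicator {-R..R} t)" by blast
  have "integrable lborel (\<lambda>t. g t * indicator {-R..R} t)"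
    using assms(1) by (intro borel_integrable_atLeastAtMost) (simp add: continuous_on_eq_continuous_at)
  then show int: "integrable lborel g" using eq by simp
  have "(g has_integral (LINT t|lborel. g t)) UNIV"
    by (rule has_integral_integral_real[OF int])
  moreover have "(\<lambda>t. if t \<in> {-R..R} then g t else 0) = g"
    using eq by (auto simp: fun_eq_iff indicator_def)
  ultimately have "(g has_integral (LINT t|lborel. g t)) {-R..R}"
    using has_integral_restrict_UNIV[of "{-R..R}" g] by simp
  then show "(LINT t|lborel. g t) = integral {-R..R} g" by (simp add: integral_unique)
qed

lemma line_outside:
  fixes x d :: "real^2"
  assumes "norm x + \<rho> \<le> R * norm d" "d \<noteq> 0" "R < \<bar>t\<bar>"
  shows "\<rho> < norm (x + t *\<^sub>R d)"
proof -
  have "R * norm d < \<bar>t\<bar> * norm d" using assms by simp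
  moreover have "\<bar>t\<bar> * norm d - norm x \<le> norm (x + t *\<^sub>R d)"
    using norm_triangle_ineq2[of "t *\<^sub>R d" "- x"] by (simp add: add.commute)
  ultimately show ?thesis using assms(1) by linarith
qed

lemma LINT_line:
  fixes f :: "real^2 \<Rightarrow> real"
  assumes "continuous_on UNIV f" "\<And>x. \<rho> < norm x \<Longrightarrow> f x = 0" 
    "norm x + \<rho> \<le> R * norm d" "d \<noteq> 0"
  shows "integrable lborel (\<lambda>t. f (x + t *\<^sub>R d))"
    "(LINT t|lborel. f (x + t *\<^sub>R d)) = integral {-R..R} (\<lambda>t. f (x + t *\<^sub>R d))"
proof -
  have "continuous_on UNIV (\<lambda>t. f (x + t *\<^sub>R d))"
    by (rule continuous_on_compose2[OF assms(1)]) (auto intro!: continuous_intros)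
  moreover have "f (x + t *\<^sub>R d) = 0" if "R < \<bar>t\<bar>" for t
    using assms(2) line_outside[OF assms(3,4) that] by blast
  ultimately show "integrable lborel (\<lambda>t. f (x + t *\<^sub>R d))"
    "(LINT t|lborel. f (x + t *\<^sub>R d)) = integral {-R..R} (\<lambda>t. f (x + t *\<^sub>R d))"
    by (rule LINT_compact_support; blast)+
qed

lemma integrable_line:
  fixes f :: "real^2 \<Rightarrow> real"
  assumes "continuous_on UNIV f" "\<And>x. \<rho> < norm x \<Longrightarrow> f x = 0" "d \<noteq> 0"
  shows "integrable lborel (\<lambda>t. f (x + t *\<^sub>R d))"
  by (rule LINT_line(1)[OF assms(1,2), where R="(norm x + \<rho>) / norm d"]) (use assms(3) in auto)

lemma dirderiv_vanish:
  assumes "\<And>x. \<rho> < norm x \<Longrightarrow> f x = 0" "\<rho> < norm x"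
  shows "dirderiv a f x = 0"
  by (rule dirderiv_eq_0_open[where S="{x. \<rho> < norm x}"])
    (use assms in \<open>auto intro!: open_Collect_less continuous_intros\<close>)

lemma LINT_dirderiv_along:
  assumes "smooth f" "\<And>x. \<rho> < norm x \<Longrightarrow> f x = 0" "d \<noteq> 0"
  shows "(LINT t|lborel. dirderiv d f (x + t *\<^sub>R d)) = 0"
proof -
  define R where "R = (norm x + \<bar>\<rho>\<bar> + 1) / norm d"
  have R: "norm x + \<rho> \<le> R * norm d" "R > 0" "norm x + \<rho> < R * norm d"
    using assms(3) by (auto simp: R_def intro!: divide_pos_pos add_nonneg_pos)
  have out: "f (x + t *\<^sub>R d) = 0" if "\<bar>t\<bar> = R" for t
  proof -
    have "norm x + \<rho> \<le> ((norm x + \<rho>) / norm d) * norm d" using assms(3) by simp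
    moreover have "(norm x + \<rho>) / norm d < \<bar>t\<bar>" using R(3) assms(3) that by (simp add: field_simps)
    ultimately show ?thesis using assms line_outside by blast
  qed
  have "(LINT t|lborel. dirderiv d f (x + t *\<^sub>R d)) = integral {-R..R} (\<lambda>t. dirderiv d f (x + t *\<^sub>R d))"
    by (rule LINT_line(2)[OF smooth_continuous[OF smooth_dirderiv[OF assms(1)]] dirderiv_vanish[OF assms(2)] R(1) assms(3)])
  also have "\<dots> = f (x + R *\<^sub>R d) - f (x + (-R) *\<^sub>R d)"
    by (intro integral_unique fundamental_theorem_of_calculus)
      (use R in \<open>auto simp: has_real_derivative_iff_has_vector_derivative[symmetric]
         intro!: has_derivative_affine_line[OF assms(1), THEN DERIV_subset]\<close>)
  also have "\<dots> = 0" using out[of R] out[of "-R"] R by simp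
  finally show ?thesis .
qed

text \<open>For \<open>x + iY\<close> the right-hand side is \<open>4\<pi>\<close> times the Levi form of the extension of \<open>f\<close> in the real direction \<open>a\<close>.
  The velocity \<open>Y\<close> of the line need not be a unit vector.  Splitting \<open>a\<close> into
  its components along \<open>Y\<close> and along the normal, every term with a derivative along the line integrates to \<open>0\<close>, and
  the factor \<open>1/|Y|\<^sup>3\<close> comes from normalising the normal component and the speed.\<close>
lemma levi_lower_bound:
  fixes x Y a :: "real^2"
  assumes f: "smooth f" and van: "\<And>x. \<rho> < norm x \<Longrightarrow> f x = 0"
    and line: "\<And>x d n. norm d = 1 \<Longrightarrow> norm n = 1 \<Longrightarrow> d \<bullet> n = 0 \<Longrightarrow>
      - C \<le> (LINT t|lborel. dirderiv n (dirderiv n f) (x + t *\<^sub>R d))"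
    and Y: "Y \<noteq> 0"
  shows "- C * (((norm a)\<^sup>2 * (norm Y)\<^sup>2 - (a \<bullet> Y)\<^sup>2) / norm Y ^ 3)
     \<le> (LINT t|lborel. dirderiv a (dirderiv a f) (x + t *\<^sub>R Y))"
proof -
  define d where "d = Y /\<^sub>R norm Y"
  define n :: "real^2" where "n = vector [- d$2, d$1]"
  have d: "norm d = 1" "d \<noteq> 0" using Y by (auto simp: d_def)
  have dd: "d$1 * d$1 + d$2 * d$2 = 1"
    using d(1) by (simp add: norm_eq_1 inner_vec_def sum_2)
  have n: "norm n = 1" "d \<bullet> n = 0"
    using dd by (auto simp: norm_eq_1 n_def inner_vec_def sum_2)
  define \<alpha> \<beta> where "\<alpha> = a \<bullet> d" and "\<beta> = a \<bullet> n"
  have a: "a = \<alpha> *\<^sub>R d + \<beta> *\<^sub>R n"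
  proof -
    have "a $ 1 * 1 = \<alpha> * d$1 - \<beta> * d$2" "a $ 2 * 1 = \<alpha> * d$2 + \<beta> * d$1"
      unfolding dd[symmetric] by (simp_all add: \<alpha>_def \<beta>_def n_def inner_vec_def sum_2 algebra_simps)
    then show ?thesis by (simp add: vec_eq_iff forall_2 n_def)
  qed
  have \<beta>: "\<beta>\<^sup>2 = (norm a)\<^sup>2 - (a \<bullet> d)\<^sup>2"
  proof -
    have "(norm a)\<^sup>2 = a \<bullet> a" by (simp add: power2_norm_eq_inner)
    also have "\<dots> = \<alpha>\<^sup>2 + \<beta>\<^sup>2"
      using d n by (subst (1 2) a)
        (simp add: inner_add_left inner_add_right power2_eq_square norm_eq_1 inner_commute)
    finally show ?thesis by (simp add: \<alpha>_def)
  qed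
  note sm = smooth_dirderiv[OF f]
  note sm2 = smooth_dirderiv[OF sm]
  note vn = dirderiv_vanish[OF van]
  note vn2 = dirderiv_vanish[OF vn]
  have exp: "dirderiv a (dirderiv a f) x = \<alpha> * dirderiv d (dirderiv a f) x
      + \<beta> * \<alpha> * dirderiv d (dirderiv n f) x + \<beta>\<^sup>2 * dirderiv n (dirderiv n f) x" for x
  proof -
    have "dirderiv a f = (\<lambda>x. \<alpha> * dirderiv d f x + \<beta> * dirderiv n f x)"
      by (subst a) (simp add: fun_eq_iff dirderiv_vec_add dirderiv_vec_scale)
    then have "dirderiv n (dirderiv a f) x = \<alpha> * dirderiv n (dirderiv d f) x + \<beta> * dirderiv n (dirderiv n f) x"
      by (simp add: dirderiv_add dirderiv_cmult smooth_cmult sm)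
    moreover have "dirderiv a (dirderiv a f) x = \<alpha> * dirderiv d (dirderiv a f) x + \<beta> * dirderiv n (dirderiv a f) x"
      by (subst (1) a) (simp only: dirderiv_vec_add dirderiv_vec_scale)
    ultimately show ?thesis
      by (simp add: dirderiv_commute[OF f, of n d] algebra_simps power2_eq_square)
  qed
  note int = integrable_line[OF smooth_continuous[OF sm2] vn2 d(2)]
  have "(LINT t|lborel. dirderiv a (dirderiv a f) (x + t *\<^sub>R d)) =
     \<alpha> * (LINT t|lborel. dirderiv d (dirderiv a f) (x + t *\<^sub>R d)) +
     \<beta> * \<alpha> * (LINT t|lborel. dirderiv d (dirderiv n f) (x + t *\<^sub>R d)) +
     \<beta>\<^sup>2 * (LINT t|lborel. dirderiv n (dirderiv n f) (x + t *\<^sub>R d))"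
    unfolding exp by (simp add: int)
  also have "\<dots> = \<beta>\<^sup>2 * (LINT t|lborel. dirderiv n (dirderiv n f) (x + t *\<^sub>R d))"
    by (simp add: LINT_dirderiv_along[OF sm vn d(2)])
  also have "\<dots> \<ge> \<beta>\<^sup>2 * (- C)"
    by (intro mult_left_mono line d n) simp
  finally have 1: "- C * \<beta>\<^sup>2 \<le> (LINT t|lborel. dirderiv a (dirderiv a f) (x + t *\<^sub>R d))"
    by (simp add: mult.commute)
  have "(LINT t|lborel. dirderiv a (dirderiv a f) (x + t *\<^sub>R d)) =
     norm Y * (LINT t|lborel. dirderiv a (dirderiv a f) (x + t *\<^sub>R Y))"
  proof -
    have "(norm Y * t) *\<^sub>R d = t *\<^sub>R Y" for t using Y by (simp add: d_def)
    then show ?thesis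
      using Y by (subst lborel_integral_real_affine[where c="norm Y" and t=0]) auto
  qed
  with 1 have "- C * \<beta>\<^sup>2 / norm Y \<le> (LINT t|lborel. dirderiv a (dirderiv a f) (x + t *\<^sub>R Y))"
    using Y by (simp add: field_simps)
  moreover have "\<beta>\<^sup>2 / norm Y = ((norm a)\<^sup>2 * (norm Y)\<^sup>2 - (a \<bullet> Y)\<^sup>2) / norm Y ^ 3"
    unfolding \<beta> using Y by (simp add: d_def field_simps power2_eq_square power3_eq_cube)
  ultimately show ?thesis by (metis times_divide_eq_right)
qed

section \<open>Restrictions to complex lines\<close>

lemma dirderiv2_expand:
  assumes "smooth f"
  shows "dirderiv v (dirderiv u f) x =
    v$1 * u$1 * partial_deriv 1 (partial_deriv 1 f) x + v$1 * u$2 * partial_deriv 1 (partial_deriv 2 f) x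
    + v$2 * u$1 * partial_deriv 2 (partial_deriv 1 f) x + v$2 * u$2 * partial_deriv 2 (partial_deriv 2 f) x"
proof -
  have e: "partial_deriv 1 f = dirderiv (axis 1 1) f" "partial_deriv 2 f = dirderiv (axis 2 1) f" for f
    by (simp_all add: fun_eq_iff dirderiv_def axis_def)
  have "dirderiv u f = (\<lambda>x. u$1 * partial_deriv 1 f x + u$2 * partial_deriv 2 f x)"
    by (simp add: fun_eq_iff dirderiv_def)
  then have "dirderiv v (dirderiv u f) x = u$1 * dirderiv v (partial_deriv 1 f) x + u$2 * dirderiv v (partial_deriv 2 f) x"
    by (simp add: dirderiv_add dirderiv_cmult smooth_cmult smooth_partial_deriv assms)
  then show ?thesis by (simp add: dirderiv_def algebra_simps)
qed

text \<open>The three families below are the restrictions to a complex line of the integrand of \<open>E f\<close>, of the regularised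
  \<open>|y|\<close>, and of a regularised logarithm.\<close>
lemma C2_family_affine:
  fixes P A B :: "real \<Rightarrow> real^2"
  assumes f: "smooth f" and c: "continuous_on UNIV P" "continuous_on UNIV A" "continuous_on UNIV B"
  shows "C2_family (\<lambda>\<zeta> t. f (P t + Re \<zeta> *\<^sub>R A t + Im \<zeta> *\<^sub>R B t))
     (\<lambda>\<zeta> t u. dirderiv (Re u *\<^sub>R A t + Im u *\<^sub>R B t) f (P t + Re \<zeta> *\<^sub>R A t + Im \<zeta> *\<^sub>R B t))
     (\<lambda>\<zeta> t u v. dirderiv (Re v *\<^sub>R A t + Im v *\<^sub>R B t) (dirderiv (Re u *\<^sub>R A t + Im u *\<^sub>R B t) f)
        (P t + Re \<zeta> *\<^sub>R A t + Im \<zeta> *\<^sub>R B t))"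
proof -
  have cc: "continuous_on UNIV (\<lambda>x::complex \<times> real. P (snd x))" "continuous_on UNIV (\<lambda>x::complex \<times> real. A (snd x))"
    "continuous_on UNIV (\<lambda>x::complex \<times> real. B (snd x))"
    by (rule continuous_on_compose2[OF c(1)] continuous_on_compose2[OF c(2)] continuous_on_compose2[OF c(3)];
        auto intro!: continuous_intros)+
  then have cq: "continuous_on UNIV (\<lambda>x::complex \<times> real. P (snd x) + Re (fst x) *\<^sub>R A (snd x) + Im (fst x) *\<^sub>R B (snd x))"
    by (intro continuous_intros)
  have cf: "continuous_on UNIV (\<lambda>x::complex \<times> real. h (P (snd x) + Re (fst x) *\<^sub>R A (snd x) + Im (fst x) *\<^sub>R B (snd x)))"
    if "smooth h" for h
    by (rule continuous_on_smooth_compose[OF that cq])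
  have comp: "continuous_on UNIV (\<lambda>x::complex \<times> real. A (snd x) $ i)" "continuous_on UNIV (\<lambda>x::complex \<times> real. B (snd x) $ i)" for i
    using cc by (auto intro!: continuous_intros)
  have der: "((\<lambda>\<zeta>. h (P t + Re \<zeta> *\<^sub>R A t + Im \<zeta> *\<^sub>R B t)) has_derivative
     (\<lambda>u. dirderiv (Re u *\<^sub>R A t + Im u *\<^sub>R B t) h (P t + Re \<zeta> *\<^sub>R A t + Im \<zeta> *\<^sub>R B t))) (at \<zeta>)"
    if "smooth h" for h \<zeta> t
    by (rule has_derivative_compose[OF _ smooth_has_derivative[OF that]])
      (auto intro!: derivative_eq_intros)
  show ?thesis
    unfolding C2_family_def split_beta
  proof (intro conjI allI)
    fix u
    show "continuous_on UNIV (\<lambda>x. dirderiv (Re u *\<^sub>R A (snd x) + Im u *\<^sub>R B (snd x)) f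
                    (P (snd x) + Re (fst x) *\<^sub>R A (snd x) + Im (fst x) *\<^sub>R B (snd x)))"
      unfolding dirderiv_def vector_add_component vector_scaleR_component real_scaleR_def
      by (intro continuous_intros cf comp smooth_partial_deriv f)
    fix v
    show "continuous_on UNIV (\<lambda>x. dirderiv (Re v *\<^sub>R A (snd x) + Im v *\<^sub>R B (snd x))
                      (dirderiv (Re u *\<^sub>R A (snd x) + Im u *\<^sub>R B (snd x)) f)
                      (P (snd x) + Re (fst x) *\<^sub>R A (snd x) + Im (fst x) *\<^sub>R B (snd x)))"
      unfolding dirderiv2_expand[OF f] vector_add_component vector_scaleR_component real_scaleR_def
      by (intro continuous_on_add continuous_on_mult continuous_on_const comp
          cf[OF smooth_partial_deriv[OF smooth_partial_deriv[OF f]]])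
  qed (auto intro!: der cf f smooth_dirderiv)
qed

lemma C2_family_sqrt:
  fixes y p q :: "'a::real_inner"
  assumes "\<eta> > 0"
  defines "L \<equiv> \<lambda>u. Re u *\<^sub>R p + Im u *\<^sub>R q"
  defines "N \<equiv> \<lambda>\<zeta>. sqrt ((norm (y + L \<zeta>))\<^sup>2 + \<eta>\<^sup>2)"
  shows "C2_family (\<lambda>\<zeta> t. N \<zeta>) (\<lambda>\<zeta> t u. ((y + L \<zeta>) \<bullet> L u) / N \<zeta>)
     (\<lambda>\<zeta> t u v. (L v \<bullet> L u) / N \<zeta> - ((y + L \<zeta>) \<bullet> L u) * ((y + L \<zeta>) \<bullet> L v) / N \<zeta> ^ 3)"
proof -
  have N2: "(norm (y + L \<zeta>))\<^sup>2 + \<eta>\<^sup>2 > 0" for \<zeta> using assms(1) by (simp add: add_nonneg_pos)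
  then have Np: "N \<zeta> > 0" for \<zeta> by (simp add: N_def)
  have Nn: "N \<zeta> \<noteq> 0" for \<zeta> using Np[of \<zeta>] by simp
  have L: "((\<lambda>\<zeta>. L \<zeta>) has_derivative L) (at \<zeta>)" for \<zeta>
    unfolding L_def by (auto intro!: derivative_eq_intros)
  have dN: "(N has_derivative (\<lambda>u. ((y + L \<zeta>) \<bullet> L u) / N \<zeta>)) (at \<zeta>)" for \<zeta>
  proof -
    have "((\<lambda>\<zeta>. sqrt ((y + L \<zeta>) \<bullet> (y + L \<zeta>) + \<eta>\<^sup>2)) has_derivative (\<lambda>u. ((y + L \<zeta>) \<bullet> L u) / N \<zeta>)) (at \<zeta>)"
      using N2[of \<zeta>]
      by (auto intro!: derivative_eq_intros L simp: N_def power2_norm_eq_inner inner_commute divide_simps)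
    then show ?thesis by (simp add: N_def[abs_def] power2_norm_eq_inner)
  qed
  have cL: "continuous_on UNIV L" unfolding L_def by (intro continuous_intros)
  have cL': "continuous_on UNIV (\<lambda>x::complex \<times> real. L (fst x))"
    by (rule continuous_on_compose2[OF cL]) (auto intro!: continuous_intros)
  have cN: "continuous_on UNIV (\<lambda>x::complex \<times> real. N (fst x))"
    unfolding N_def by (intro continuous_intros cL')
  show ?thesis
    unfolding C2_family_def split_beta
  proof (intro conjI allI)
    fix \<zeta> u
    show "((\<lambda>\<zeta>. ((y + L \<zeta>) \<bullet> L u) / N \<zeta>) has_derivative
       (\<lambda>v. (L v \<bullet> L u) / N \<zeta> - ((y + L \<zeta>) \<bullet> L u) * ((y + L \<zeta>) \<bullet> L v) / N \<zeta> ^ 3)) (at \<zeta>)"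
    proof (rule has_derivative_eq_rhs)
      show "((\<lambda>\<zeta>. ((y + L \<zeta>) \<bullet> L u) / N \<zeta>) has_derivative
        (\<lambda>v. ((L v \<bullet> L u) * N \<zeta> - ((y + L \<zeta>) \<bullet> L u) * (((y + L \<zeta>) \<bullet> L v) / N \<zeta>)) / (N \<zeta> * N \<zeta>))) (at \<zeta>)"
        by (rule has_derivative_divide'[OF _ dN Nn]) (auto intro!: derivative_eq_intros L)
      have "(a * n - s * (r / n)) / (n * n) = a / n - s * r / n ^ 3" if "n \<noteq> 0" for a n s r :: real
        using that by (simp add: field_simps power3_eq_cube)
      from this[OF Nn] show "(\<lambda>v. ((L v \<bullet> L u) * N \<zeta> - ((y + L \<zeta>) \<bullet> L u) * (((y + L \<zeta>) \<bullet> L v) / N \<zeta>)) / (N \<zeta> * N \<zeta>))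
         = (\<lambda>v. (L v \<bullet> L u) / N \<zeta> - ((y + L \<zeta>) \<bullet> L u) * ((y + L \<zeta>) \<bullet> L v) / N \<zeta> ^ 3)"
        by blast
    qed
  qed (auto intro!: dN continuous_intros cL' cN simp: Nn)
qed

lemma C2_family_log:
  fixes \<zeta>0 :: complex
  assumes "\<epsilon> > 0"
  defines "D \<equiv> \<lambda>\<zeta>. (norm (\<zeta> - \<zeta>0))\<^sup>2 + \<epsilon>\<^sup>2"
  shows "C2_family (\<lambda>\<zeta> t. ln (D \<zeta>)) (\<lambda>\<zeta> t u. 2 * ((\<zeta> - \<zeta>0) \<bullet> u) / D \<zeta>)
     (\<lambda>\<zeta> t u v. 2 * (v \<bullet> u) / D \<zeta> - 4 * ((\<zeta> - \<zeta>0) \<bullet> u) * ((\<zeta> - \<zeta>0) \<bullet> v) / (D \<zeta>)\<^sup>2)"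
proof -
  have Dp: "D \<zeta> > 0" for \<zeta> using assms(1) by (simp add: D_def add_nonneg_pos)
  have Dn: "D \<zeta> \<noteq> 0" for \<zeta> using Dp[of \<zeta>] by simp
  have dD: "(D has_derivative (\<lambda>u. 2 * ((\<zeta> - \<zeta>0) \<bullet> u))) (at \<zeta>)" for \<zeta>
    unfolding D_def power2_norm_eq_inner
    by (auto intro!: derivative_eq_intros simp: inner_commute)
  have dl: "((\<lambda>\<zeta>. ln (D \<zeta>)) has_derivative (\<lambda>u. 2 * ((\<zeta> - \<zeta>0) \<bullet> u) / D \<zeta>)) (at \<zeta>)" for \<zeta>
    using Dp[of \<zeta>] by (auto intro!: derivative_eq_intros dD simp: divide_simps)
  have cD: "continuous_on UNIV (\<lambda>x::complex \<times> real. D (fst x))"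
    unfolding D_def by (intro continuous_intros)
  show ?thesis
    unfolding C2_family_def split_beta
  proof (intro conjI allI)
    fix \<zeta> u
    show "((\<lambda>\<zeta>. 2 * ((\<zeta> - \<zeta>0) \<bullet> u) / D \<zeta>) has_derivative
       (\<lambda>v. 2 * (v \<bullet> u) / D \<zeta> - 4 * ((\<zeta> - \<zeta>0) \<bullet> u) * ((\<zeta> - \<zeta>0) \<bullet> v) / (D \<zeta>)\<^sup>2)) (at \<zeta>)"
    proof (rule has_derivative_eq_rhs)
      show "((\<lambda>\<zeta>. 2 * ((\<zeta> - \<zeta>0) \<bullet> u) / D \<zeta>) has_derivative
        (\<lambda>v. (2 * (v \<bullet> u) * D \<zeta> - 2 * ((\<zeta> - \<zeta>0) \<bullet> u) * (2 * ((\<zeta> - \<zeta>0) \<bullet> v))) / (D \<zeta> * D \<zeta>))) (at \<zeta>)"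
        by (rule has_derivative_divide'[OF _ dD Dn]) (auto intro!: derivative_eq_intros)
      have "(2 * a * n - 2 * s * (2 * r)) / (n * n) = 2 * a / n - 4 * s * r / n\<^sup>2" if "n \<noteq> 0" for a n s r :: real
        using that by (simp add: field_simps power2_eq_square)
      from this[OF Dn] show "(\<lambda>v. (2 * (v \<bullet> u) * D \<zeta> - 2 * ((\<zeta> - \<zeta>0) \<bullet> u) * (2 * ((\<zeta> - \<zeta>0) \<bullet> v))) / (D \<zeta> * D \<zeta>))
         = (\<lambda>v. 2 * (v \<bullet> u) / D \<zeta> - 4 * ((\<zeta> - \<zeta>0) \<bullet> u) * ((\<zeta> - \<zeta>0) \<bullet> v) / (D \<zeta>)\<^sup>2)"
        by blast
    qed
  qed (auto intro!: dl continuous_intros cD simp: Dn)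
qed

section \<open>Plurisubharmonicity of continuous real functions\<close>

lemma circle_integral_continuous:
  fixes h :: "real \<Rightarrow> real"
  assumes "continuous_on {0..2*pi} h"
  shows "circle_integral (\<lambda>\<theta>. ereal (h \<theta>)) = ereal (integral {0..2*pi} h)"
proof -
  have e: "e2ennreal (ereal x) = ennreal x" for x
    by transfer simp
  have nn: "(\<integral>\<^sup>+\<theta>\<in>{0..2 * pi}. ennreal (p \<theta>) \<partial>lborel) = ennreal (integral {0..2*pi} (\<lambda>\<theta>. max 0 (p \<theta>)))"
    if "continuous_on {0..2*pi} p" for p :: "real \<Rightarrow> real"
  proof -
    have "(\<integral>\<^sup>+\<theta>\<in>{0..2 * pi}. ennreal (max 0 (p \<theta>)) \<partial>lborel) = ennreal (integral {0..2*pi} (\<lambda>\<theta>. max 0 (p \<theta>)))"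
      by (rule nn_integral_has_integral_lebesgue')
        (use that in \<open>auto intro!: integrable_integral integrable_continuous_interval continuous_intros\<close>)
    moreover have "ennreal (max 0 x) = ennreal x" for x by (cases "0 \<le> x") (auto simp: max_def ennreal_neg)
    ultimately show ?thesis by simp
  qed
  have int: "(\<lambda>\<theta>. max 0 (p \<theta>)) integrable_on {0..2*pi}" if "continuous_on {0..2*pi} p" for p :: "real \<Rightarrow> real"
    using that by (intro integrable_continuous_interval continuous_intros)
  have m: "continuous_on {0..2*pi} (\<lambda>\<theta>. - h \<theta>)" using assms by (intro continuous_intros)
  have nonneg: "0 \<le> integral {0..2*pi} (\<lambda>\<theta>. max 0 (p \<theta>))" if "continuous_on {0..2*pi} p" for p :: "real \<Rightarrow> real"
    by (rule integral_nonneg[OF int[OF that]]) simp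
  have "circle_integral (\<lambda>\<theta>. ereal (h \<theta>)) =
     ereal (integral {0..2*pi} (\<lambda>\<theta>. max 0 (h \<theta>)) - integral {0..2*pi} (\<lambda>\<theta>. max 0 (- h \<theta>)))"
    unfolding circle_integral_def
    using nn[OF assms] nn[OF m] nonneg[OF assms] nonneg[OF m] by (simp add: e)
  also have "integral {0..2*pi} (\<lambda>\<theta>. max 0 (h \<theta>)) - integral {0..2*pi} (\<lambda>\<theta>. max 0 (- h \<theta>)) =
     integral {0..2*pi} (\<lambda>\<theta>. max 0 (h \<theta>) - max 0 (- h \<theta>))"
    by (rule integral_diff[OF int[OF assms] int[OF m], symmetric])
  also have "\<dots> = integral {0..2*pi} h" by (intro integral_cong) (auto simp: max_def)
  finally show ?thesis .
qed

lemma plurisubharmonicI: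
  fixes U :: "complex^2 \<Rightarrow> real"
  assumes c: "continuous_on UNIV U"
    and sub: "\<And>z v. 2 * pi * U z \<le> integral {0..2*pi} (\<lambda>\<theta>. U (z + cis \<theta> *s v))"
  shows "plurisubharmonic (\<lambda>z. ereal (U z))"
  unfolding plurisubharmonic_def upper_semicontinuous_def
proof (intro conjI allI)
  show "open {z. ereal (U z) < c}" for c
    by (rule open_Collect_less[OF continuous_on_ereal[OF c] continuous_on_const])
next
  fix z v
  have "continuous_on {0..2*pi} (\<lambda>\<theta>. U (z + cis \<theta> *s v))"
    unfolding vector_scalar_mult_def
    by (rule continuous_on_compose2[OF c]) (auto intro!: continuous_intros)
  then have "circle_integral (\<lambda>\<theta>. ereal (U (z + cis \<theta> *s v))) = ereal (integral {0..2*pi} (\<lambda>\<theta>. U (z + cis \<theta> *s v)))"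
    by (rule circle_integral_continuous)
  then show "ereal (U z) \<le> ereal (1 / (2 * pi)) * circle_integral (\<lambda>\<theta>. ereal (U (z + cis \<theta> *s v)))"
    using sub[of z v] by (simp add: field_simps)
qed auto

section \<open>The extension operator\<close>

text \<open>The extension operator with its integral restricted to \<open>|t| \<le> R\<close>; it approximates the extension uniformly.\<close>
definition truncated_extension :: "real \<Rightarrow> (real^2 \<Rightarrow> real) \<Rightarrow> complex^2 \<Rightarrow> real" where
  "truncated_extension R f z = 1 / pi * integral {-R..R} (\<lambda>t. f (re_vec z + t *\<^sub>R im_vec z) / (1 + t\<^sup>2))"

lemma has_bochner_integral_inverse_1_plus_square:
  "has_bochner_integral lborel (\<lambda>t::real. 1 / (1 + t\<^sup>2)) pi"
  using integrable_inverse_1_plus_square LBINT_inverse_1_plus_square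
  by (simp add: has_bochner_integral_iff set_integrable_def interval_lebesgue_integral_def
      set_lebesgue_integral_def inverse_eq_divide)

lemma continuous_on_re_vec: "continuous_on S re_vec"
  and continuous_on_im_vec: "continuous_on S im_vec"
  unfolding re_vec_def[abs_def] im_vec_def[abs_def] by (intro continuous_intros)+

lemma denominator_nonzero: "1 + t\<^sup>2 \<noteq> (0::real)"
  by (metis add_pos_nonneg less_irrefl zero_le_power2 zero_less_one)

lemma continuous_on_truncated_extension:
  assumes "smooth f"
  shows "continuous_on UNIV (truncated_extension R f)"
proof -
  have "continuous_on (UNIV \<times> cbox (-R) R) (\<lambda>(z, t). f (re_vec z + t *\<^sub>R im_vec z) / (1 + t\<^sup>2))"
    unfolding split_beta
    by (intro continuous_intros continuous_on_smooth_compose[OF assms] ballI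
        continuous_on_compose2[OF continuous_on_re_vec] continuous_on_compose2[OF continuous_on_im_vec])
      (auto intro!: continuous_intros simp: denominator_nonzero)
  from integral_continuous_on_param[OF this] show ?thesis
    unfolding truncated_extension_def[abs_def] by (auto intro!: continuous_intros)
qed

lemma truncated_extension_error:
  assumes f: "smooth f" and B: "\<And>x. \<bar>f x\<bar> \<le> B" and R: "R \<ge> 0"
  shows "\<bar>extension f z - truncated_extension R f z\<bar> \<le> B * (1 - 2 / pi * arctan R)"
proof -
  let ?k = "\<lambda>t::real. 1 / (1 + t\<^sup>2)"
  let ?h = "\<lambda>t. f (re_vec z + t *\<^sub>R im_vec z) / (1 + t\<^sup>2)"
  have k: "integrable lborel ?k" "(LINT t|lborel. ?k t) = pi"
    using has_bochner_integral_inverse_1_plus_square by (auto simp: has_bochner_integral_iff)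
  have pos: "0 < 1 + t\<^sup>2" for t :: real by (simp add: add_pos_nonneg)
  have ch: "continuous_on UNIV ?h"
    by (intro continuous_intros continuous_on_smooth_compose[OF f]) (simp add: denominator_nonzero)
  have bd: "\<bar>?h t\<bar> \<le> B * ?k t" for t
    using B pos[of t] by (simp add: divide_right_mono)
  have h: "integrable lborel ?h"
  proof (rule Bochner_Integration.integrable_bound[OF integrable_mult_right[OF k(1), of B]])
    show "AE t in lborel. norm (?h t) \<le> norm (B * ?k t)"
      unfolding real_norm_def using order_trans[OF bd abs_ge_self] by (intro AE_I2)
  qed (use ch in \<open>simp add: borel_measurable_continuous_onI\<close>)
  have ind: "integrable lborel (\<lambda>t. indicator {-R..R} t * g t)" "(LINT t|lborel. indicator {-R..R} t * g t) = integral {-R..R} g"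
    if "continuous_on UNIV g" for g :: "real \<Rightarrow> real"
  proof -
    have s: "set_integrable lborel {-R..R} g"
      unfolding set_integrable_def
      by (rule borel_integrable_compact) (auto intro: continuous_on_subset[OF that])
    then show "integrable lborel (\<lambda>t. indicator {-R..R} t * g t)" by (simp add: set_integrable_def)
    from set_borel_integral_eq_integral(2)[OF s]
    show "(LINT t|lborel. indicator {-R..R} t * g t) = integral {-R..R} g"
      by (simp add: set_lebesgue_integral_def)
  qed
  have ck: "continuous_on UNIV ?k" by (intro continuous_intros) (simp add: denominator_nonzero)
  have "integral {-R..R} ?k = arctan R - arctan (-R)"
    by (intro integral_unique fundamental_theorem_of_calculus)
      (use R in \<open>auto intro!: derivative_eq_intros simp: has_real_derivative_iff_has_vector_derivative[symmetric] inverse_eq_divide\<close>)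
  then have kR: "integral {-R..R} ?k = 2 * arctan R" by (simp add: arctan_minus)
  have "pi * \<bar>extension f z - truncated_extension R f z\<bar> = \<bar>(LINT t|lborel. ?h t) - integral {-R..R} ?h\<bar>"
  proof -
    have "extension f z - truncated_extension R f z = ((LINT t|lborel. ?h t) - integral {-R..R} ?h) / pi"
      by (simp add: extension_def truncated_extension_def diff_divide_distrib)
    then show ?thesis by simp
  qed
  also have "(LINT t|lborel. ?h t) - integral {-R..R} ?h = (LINT t|lborel. ?h t - indicator {-R..R} t * ?h t)"
    using h ind[OF ch] by simp
  also have "\<bar>\<dots>\<bar> \<le> (LINT t|lborel. B * (?k t - indicator {-R..R} t * ?k t))"
  proof -
    have "\<bar>LINT t|lborel. ?h t - indicator {-R..R} t * ?h t\<bar> \<le> (LINT t|lborel. \<bar>?h t - indicator {-R..R} t * ?h t\<bar>)"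
      by (rule integral_abs_bound)
    also have "\<dots> \<le> (LINT t|lborel. B * (?k t - indicator {-R..R} t * ?k t))"
      by (rule integral_mono)
        (use h ind(1)[OF ch] ind(1)[OF ck] k bd in \<open>auto simp: indicator_def\<close>)
    finally show ?thesis .
  qed
  also have "\<dots> = B * (pi - 2 * arctan R)"
    using k ind[OF ck] kR by simp
  finally show ?thesis by (simp add: field_simps)
qed

lemma truncated_extension_error_tendsto: "((\<lambda>R. B * (1 - 2 / pi * arctan R)) \<longlongrightarrow> 0) at_top"
proof -
  have "((\<lambda>R. B * (1 - 2 / pi * arctan R)) \<longlongrightarrow> B * (1 - 2 / pi * (pi / 2))) at_top"
    by (intro tendsto_intros tendsto_arctan_at_top)
  then show ?thesis by simp
qed

lemma continuous_on_extension:
  assumes f: "smooth f" and B: "\<And>x. \<bar>f x\<bar> \<le> B"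
  shows "continuous_on UNIV (extension f)"
proof (rule uniform_limit_theorem)
  show "uniform_limit UNIV (\<lambda>R. truncated_extension R f) (extension f) at_top"
  proof (rule uniform_limitI)
    fix e :: real assume "e > 0"
    with truncated_extension_error_tendsto[of B]
    have "eventually (\<lambda>R. B * (1 - 2 / pi * arctan R) < e) at_top"
      by (rule order_tendstoD(2))
    then show "\<forall>\<^sub>F R in at_top. \<forall>z\<in>UNIV. dist (truncated_extension R f z) (extension f z) < e"
      using eventually_ge_at_top[of "0::real"]
      by eventually_elim (use truncated_extension_error[OF f B] in \<open>auto simp: dist_real_def abs_minus_commute intro: le_less_trans\<close>)
  qed
qed (auto simp: continuous_on_truncated_extension[OF f])

section \<open>A criterion for plurisubharmonicity\<close>

lemma bounded_of_support:
  fixes f :: "real^2 \<Rightarrow> real"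
  assumes "continuous_on UNIV f" "\<And>x. \<rho> < norm x \<Longrightarrow> f x = 0"
  obtains B where "0 \<le> B" "\<And>x. \<bar>f x\<bar> \<le> B"
proof -
  have "bounded (f ` cball 0 \<rho>)"
    by (intro compact_imp_bounded compact_continuous_image continuous_on_subset[OF assms(1)]) auto
  then obtain B where "\<forall>y\<in>f ` cball 0 \<rho>. norm y \<le> B" unfolding bounded_iff by blast
  then have B: "\<bar>f x\<bar> \<le> B" if "x \<in> cball 0 \<rho>" for x using that by auto
  have "\<bar>f x\<bar> \<le> max 0 B" for x
    using B[of x] assms(2)[of x] by (cases "norm x \<le> \<rho>") auto
  then show ?thesis using that[of "max 0 B"] by simp
qed

lemma re_im_vec_line:
  "re_vec (z + \<zeta> *s v) = re_vec z + Re \<zeta> *\<^sub>R re_vec v - Im \<zeta> *\<^sub>R im_vec v"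
  "im_vec (z + \<zeta> *s v) = im_vec z + Re \<zeta> *\<^sub>R im_vec v + Im \<zeta> *\<^sub>R re_vec v"
  by (auto simp: re_vec_def im_vec_def vec_eq_iff)

text \<open>The submean inequality on a complex line \<open>z + \<zeta>v\<close> on which the real and imaginary parts of \<open>v\<close> are linearly
  independent.  Then the imaginary part of \<open>z + \<zeta>v\<close> is \<open>y + L \<zeta>\<close> with \<open>L\<close> a real-linear isomorphism, and vanishes
  only at one point \<open>\<zeta>0\<close>.\<close>
lemma submean_independent:
  fixes z v :: "complex^2"
  assumes f: "smooth f" and van: "\<And>x. \<rho> < norm x \<Longrightarrow> f x = 0"
    and line: "\<And>x d n. norm d = 1 \<Longrightarrow> norm n = 1 \<Longrightarrow> d \<bullet> n = 0 \<Longrightarrow>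
      - C \<le> (LINT t|lborel. dirderiv n (dirderiv n f) (x + t *\<^sub>R d))"
    and C: "0 \<le> C" "C \<le> \<sigma>"
    and det: "im_vec v $ 1 * re_vec v $ 2 - im_vec v $ 2 * re_vec v $ 1 \<noteq> 0"
  defines "U \<equiv> \<lambda>z. extension f z + \<sigma> * norm (im_vec z)"
  shows "2 * pi * U z \<le> integral {0..2*pi} (\<lambda>\<phi>. U (z + cis \<phi> *s v))"
proof -
  define a b x0 y where "a = re_vec v" and "b = im_vec v" and "x0 = re_vec z" and "y = im_vec z"
  define L where "L u = Re u *\<^sub>R b + Im u *\<^sub>R a" for u
  define X where "X u = x0 + Re u *\<^sub>R a - Im u *\<^sub>R b" for u
  define \<Delta> where "\<Delta> = b $ 1 * a $ 2 - b $ 2 * a $ 1"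
  have \<Delta>: "\<Delta> \<noteq> 0" using det by (simp add: \<Delta>_def a_def b_def)
  have linL: "linear L"
    by (rule linearI) (auto simp: L_def algebra_simps)
  have "u = 0" if "L u = 0" for u
  proof -
    have e: "Re u * b$1 + Im u * a$1 = 0" "Re u * b$2 + Im u * a$2 = 0"
      using that by (auto simp: L_def vec_eq_iff forall_2)
    have "Re u * \<Delta> = (Re u * b$1 + Im u * a$1) * a$2 - (Re u * b$2 + Im u * a$2) * a$1"
      "Im u * \<Delta> = (Re u * b$2 + Im u * a$2) * b$1 - (Re u * b$1 + Im u * a$1) * b$2"
      by (auto simp: \<Delta>_def algebra_simps)
    with e \<Delta> show ?thesis by (auto simp: complex_eq_iff)
  qed
  then have "inj L" by (simp add: linear_injective_0[OF linL])
  then obtain \<kappa> where \<kappa>: "\<kappa> > 0" "\<And>u. \<kappa> * norm u \<le> norm (L u)"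
    using linear_inj_bounded_below_pos[OF linL] by metis
  define \<zeta>0 where "\<zeta>0 = Complex (- (y$1 * a$2 - y$2 * a$1) / \<Delta>) (- (b$1 * y$2 - b$2 * y$1) / \<Delta>)"
  have "y + L \<zeta>0 = 0"
  proof -
    have "\<Delta> * (y + L \<zeta>0) $ i = 0" for i
    proof -
      have r: "\<Delta> * Re \<zeta>0 = - (y$1 * a$2 - y$2 * a$1)" "\<Delta> * Im \<zeta>0 = - (b$1 * y$2 - b$2 * y$1)"
        using \<Delta> by (simp_all add: \<zeta>0_def)
      have m: "\<Delta> * (y + L \<zeta>0) $ i = \<Delta> * y $ i + (\<Delta> * Re \<zeta>0) * b $ i + (\<Delta> * Im \<zeta>0) * a $ i"
        by (simp add: L_def algebra_simps)
      show ?thesis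
        unfolding m r using exhaust_2[of i] by (auto simp: \<Delta>_def algebra_simps)
    qed
    with \<Delta> show ?thesis by (simp add: vec_eq_iff)
  qed
  then have Y: "y + L \<zeta> = L (\<zeta> - \<zeta>0)" for \<zeta>
    by (simp add: linear_diff[OF linL] eq_neg_iff_add_eq_0[symmetric])
  note sm = smooth_dirderiv[OF f] 
  note sm2 = smooth_dirderiv[OF sm]
  note vn2 = dirderiv_vanish[OF dirderiv_vanish[OF van]]
  obtain B0 where B0: "\<And>x. \<bar>f x\<bar> \<le> B0"
    by (rule bounded_of_support[OF smooth_continuous[OF f] van]) auto
  obtain Ba where Ba: "0 \<le> Ba" "\<And>x. \<bar>dirderiv a (dirderiv a f) x\<bar> \<le> Ba"
    by (rule bounded_of_support[OF smooth_continuous[OF sm2] vn2]) auto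
  obtain Bb where Bb: "0 \<le> Bb" "\<And>x. \<bar>dirderiv b (dirderiv b f) x\<bar> \<le> Bb"
    by (rule bounded_of_support[OF smooth_continuous[OF sm2] vn2]) auto
  define B2 where "B2 = Ba + Bb"
  define H where "H \<zeta> t = dirderiv a (dirderiv a f) (X \<zeta> + t *\<^sub>R (y + L \<zeta>)) +
      dirderiv b (dirderiv b f) (X \<zeta> + t *\<^sub>R (y + L \<zeta>))" for \<zeta> t
  have H_bound: "\<bar>H \<zeta> t\<bar> \<le> B2" for \<zeta> t
    using Ba(2) Bb(2) by (auto simp: H_def B2_def intro!: order_trans[OF abs_triangle_ineq] add_mono)
  have H_cont: "continuous_on S (H \<zeta>)" for S \<zeta>
    unfolding H_def by (intro continuous_intros continuous_on_smooth_compose[OF sm2])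
  \<comment> \<open>For \<open>|\<zeta> - \<zeta>0| \<ge> A / R\<close> the line \<open>X \<zeta> + t (y + L \<zeta>)\<close> leaves the support of \<open>f\<close> before
     \<open>|t| = R\<close>, so the truncated integral is the whole line integral.\<close>
  define A where "A = (norm x0 + norm a + norm b + \<bar>\<rho>\<bar> + 1) / \<kappa>"
  have A: "A > 0" using \<kappa> by (auto simp: A_def intro!: divide_pos_pos add_nonneg_pos)
  define S where "S \<zeta> = ((norm a)\<^sup>2 * (norm (y + L \<zeta>))\<^sup>2 - (a \<bullet> (y + L \<zeta>))\<^sup>2) +
      ((norm b)\<^sup>2 * (norm (y + L \<zeta>))\<^sup>2 - (b \<bullet> (y + L \<zeta>))\<^sup>2)" for \<zeta>
  have S_nonneg: "0 \<le> S \<zeta>" for \<zeta>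
    using Cauchy_Schwarz_ineq[of a "y + L \<zeta>"] Cauchy_Schwarz_ineq[of b "y + L \<zeta>"]
    by (simp add: S_def power2_norm_eq_inner)
  have far: "- C * (S \<zeta> / norm (y + L \<zeta>) ^ 3) \<le> integral {-R..R} (H \<zeta>)"
    if "norm \<zeta> \<le> 1" "A / R \<le> norm (\<zeta> - \<zeta>0)" "R > 0" for \<zeta> R
  proof -
    have "A / R > 0" using A that by simp
    then have nz: "\<zeta> - \<zeta>0 \<noteq> 0" using that(2) by auto
    then have Ynz: "y + L \<zeta> \<noteq> 0" using \<kappa>(1) \<kappa>(2)[of "\<zeta> - \<zeta>0"] unfolding Y
      by (auto simp: zero_less_norm_iff mult_le_0_iff)
    have "norm (X \<zeta>) \<le> norm x0 + norm a + norm b"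
    proof -
      have "norm (X \<zeta>) \<le> norm x0 + norm (Re \<zeta> *\<^sub>R a) + norm (Im \<zeta> *\<^sub>R b)"
        unfolding X_def by (intro order_trans[OF norm_triangle_ineq4] add_mono norm_triangle_ineq order_refl)
      also have "\<dots> \<le> norm x0 + 1 * norm a + 1 * norm b"
        unfolding norm_scaleR
        by (intro add_mono mult_right_mono order_refl norm_ge_zero)
          (use that(1) abs_Re_le_cmod[of \<zeta>] abs_Im_le_cmod[of \<zeta>] in linarith)+
      finally show ?thesis by simp
    qed
    then have "norm (X \<zeta>) + \<rho> \<le> \<kappa> * A" using \<kappa>(1) by (simp add: A_def)
    also have "\<kappa> * A = R * (\<kappa> * (A / R))" using that(3) by simp
    also have "\<dots> \<le> R * (\<kappa> * norm (\<zeta> - \<zeta>0))"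
      by (intro mult_left_mono) (use that \<kappa> in auto)
    also have "\<dots> \<le> R * norm (y + L \<zeta>)" unfolding Y by (intro mult_left_mono \<kappa>(2)) (use that in auto)
    finally have out: "norm (X \<zeta>) + \<rho> \<le> R * norm (y + L \<zeta>)" .
    have lev: "- C * (((norm c)\<^sup>2 * (norm (y + L \<zeta>))\<^sup>2 - (c \<bullet> (y + L \<zeta>))\<^sup>2) / norm (y + L \<zeta>) ^ 3)
       \<le> integral {-R..R} (\<lambda>t. dirderiv c (dirderiv c f) (X \<zeta> + t *\<^sub>R (y + L \<zeta>)))" for c
    proof -
      have "(LINT t|lborel. dirderiv c (dirderiv c f) (X \<zeta> + t *\<^sub>R (y + L \<zeta>))) =
          integral {-R..R} (\<lambda>t. dirderiv c (dirderiv c f) (X \<zeta> + t *\<^sub>R (y + L \<zeta>)))"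
        by (rule LINT_line(2)[OF smooth_continuous[OF sm2] _ out Ynz]) (rule vn2)
      then show ?thesis using levi_lower_bound[OF f van line Ynz] by metis
    qed
    have "- C * (S \<zeta> / norm (y + L \<zeta>) ^ 3) \<le>
       integral {-R..R} (\<lambda>t. dirderiv a (dirderiv a f) (X \<zeta> + t *\<^sub>R (y + L \<zeta>))) +
       integral {-R..R} (\<lambda>t. dirderiv b (dirderiv b f) (X \<zeta> + t *\<^sub>R (y + L \<zeta>)))"
      unfolding S_def add_divide_distrib distrib_left by (rule add_mono[OF lev lev])
    also have "\<dots> = integral {-R..R} (H \<zeta>)"
      unfolding H_def
      by (rule integral_add[symmetric])
        (auto intro!: integrable_continuous_interval continuous_on_smooth_compose[OF sm2] continuous_intros)
    finally show ?thesis .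
  qed
  define W where "W \<eta> \<zeta> = sqrt ((norm (y + L \<zeta>))\<^sup>2 + \<eta>\<^sup>2)" for \<eta> \<zeta>
  define D where "D \<epsilon> \<zeta> = (norm (\<zeta> - \<zeta>0))\<^sup>2 + \<epsilon>\<^sup>2" for \<epsilon> \<zeta>
  define e where "e R = B0 * (1 - 2 / pi * arctan R)" for R
  define \<Lambda> where "\<Lambda> = ln ((1 + norm \<zeta>0)\<^sup>2 + 1)"
  have cU: "continuous_on UNIV U"
    unfolding U_def by (intro continuous_intros continuous_on_extension[OF f B0] continuous_on_im_vec)
  have cline: "continuous_on T (\<lambda>\<phi>. z + cis \<phi> *s v)" for T
    unfolding vector_scalar_mult_def by (intro continuous_intros)
  have cUc: "continuous_on {0..2*pi} (\<lambda>\<phi>. U (z + cis \<phi> *s v))"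
    by (rule continuous_on_compose2[OF cU cline]) auto
  \<comment> \<open>The error terms come from truncating the integral, from regularising \<open>|y|\<close>, and from the logarithm.\<close>
  have main: "2 * pi * U z \<le> integral {0..2*pi} (\<lambda>\<phi>. U (z + cis \<phi> *s v)) +
      2 * pi * (2 * e R + \<sigma> * (\<kappa> * (A / R)) + B2 * A\<^sup>2 / R * (\<Lambda> - 2 * ln (A / R)))" (is "_ \<le> _ + 2 * pi * ?err")
    if R: "R \<ge> A" for R
  proof -
    \<comment> \<open>The Laplacian of the logarithm is at least \<open>1/\<epsilon>\<^sup>2\<close> on the disc of radius \<open>\<epsilon>\<close> about \<open>\<zeta>0\<close>, so \<open>\<delta>\<close> times
       it is at least \<open>R B2\<close>, which exceeds the trivial bound for the truncated integral there.
       As \<open>R\<close> grows, \<open>\<delta>\<close> tends to \<open>0\<close> like \<open>1/R\<close>.\<close>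
    define \<epsilon> \<eta> \<delta> where "\<epsilon> = A / R" and "\<eta> = \<kappa> * \<epsilon>" and "\<delta> = R * B2 * \<epsilon>\<^sup>2"
    have R0: "R > 0" using A R by simp
    have \<epsilon>: "\<epsilon> > 0" "\<epsilon> \<le> 1" using A R R0 by (auto simp: \<epsilon>_def)
    have \<eta>: "\<eta> > 0" using \<epsilon> \<kappa> by (simp add: \<eta>_def)
    have B2: "B2 \<ge> 0" using Ba Bb by (simp add: B2_def)
    have \<delta>: "\<delta> \<ge> 0" using R0 B2 by (simp add: \<delta>_def)
    define g where "g \<zeta> t = 1 / (pi * (1 + t\<^sup>2)) * f ((x0 + t *\<^sub>R y) + Re \<zeta> *\<^sub>R (a + t *\<^sub>R b) + Im \<zeta> *\<^sub>R (t *\<^sub>R a - b))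
       + (\<sigma> / (2 * R) * W \<eta> \<zeta> + \<delta> / (2 * R) * ln (D \<epsilon> \<zeta>))" for \<zeta> t
    define g2 where "g2 \<zeta> t u w = 1 / (pi * (1 + t\<^sup>2)) *
         dirderiv (Re w *\<^sub>R (a + t *\<^sub>R b) + Im w *\<^sub>R (t *\<^sub>R a - b)) (dirderiv (Re u *\<^sub>R (a + t *\<^sub>R b) + Im u *\<^sub>R (t *\<^sub>R a - b)) f)
           ((x0 + t *\<^sub>R y) + Re \<zeta> *\<^sub>R (a + t *\<^sub>R b) + Im \<zeta> *\<^sub>R (t *\<^sub>R a - b))
       + (\<sigma> / (2 * R) * ((L w \<bullet> L u) / W \<eta> \<zeta> - ((y + L \<zeta>) \<bullet> L u) * ((y + L \<zeta>) \<bullet> L w) / W \<eta> \<zeta> ^ 3)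
          + \<delta> / (2 * R) * (2 * (w \<bullet> u) / D \<epsilon> \<zeta> - 4 * ((\<zeta> - \<zeta>0) \<bullet> u) * ((\<zeta> - \<zeta>0) \<bullet> w) / (D \<epsilon> \<zeta>)\<^sup>2))" for \<zeta> t u w
    obtain g1 where fam: "C2_family g g1 g2"
    proof -
      have "C2_family (\<lambda>\<zeta> t. f ((x0 + t *\<^sub>R y) + Re \<zeta> *\<^sub>R (a + t *\<^sub>R b) + Im \<zeta> *\<^sub>R (t *\<^sub>R a - b)))
        (\<lambda>\<zeta> t u. dirderiv (Re u *\<^sub>R (a + t *\<^sub>R b) + Im u *\<^sub>R (t *\<^sub>R a - b)) f ((x0 + t *\<^sub>R y) + Re \<zeta> *\<^sub>R (a + t *\<^sub>R b) + Im \<zeta> *\<^sub>R (t *\<^sub>R a - b)))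
        (\<lambda>\<zeta> t u w. dirderiv (Re w *\<^sub>R (a + t *\<^sub>R b) + Im w *\<^sub>R (t *\<^sub>R a - b)) (dirderiv (Re u *\<^sub>R (a + t *\<^sub>R b) + Im u *\<^sub>R (t *\<^sub>R a - b)) f)
           ((x0 + t *\<^sub>R y) + Re \<zeta> *\<^sub>R (a + t *\<^sub>R b) + Im \<zeta> *\<^sub>R (t *\<^sub>R a - b)))"
        by (rule C2_family_affine[OF f]) (intro continuous_intros)+
      moreover have "continuous_on UNIV (\<lambda>t. 1 / (pi * (1 + t\<^sup>2)))"
        by (intro continuous_intros) (simp add: denominator_nonzero)
      ultimately have fam1: "C2_family (\<lambda>\<zeta> t. 1 / (pi * (1 + t\<^sup>2)) * f ((x0 + t *\<^sub>R y) + Re \<zeta> *\<^sub>R (a + t *\<^sub>R b) + Im \<zeta> *\<^sub>R (t *\<^sub>R a - b)))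
        (\<lambda>\<zeta> t u. 1 / (pi * (1 + t\<^sup>2)) * dirderiv (Re u *\<^sub>R (a + t *\<^sub>R b) + Im u *\<^sub>R (t *\<^sub>R a - b)) f ((x0 + t *\<^sub>R y) + Re \<zeta> *\<^sub>R (a + t *\<^sub>R b) + Im \<zeta> *\<^sub>R (t *\<^sub>R a - b)))
        (\<lambda>\<zeta> t u w. 1 / (pi * (1 + t\<^sup>2)) * dirderiv (Re w *\<^sub>R (a + t *\<^sub>R b) + Im w *\<^sub>R (t *\<^sub>R a - b)) (dirderiv (Re u *\<^sub>R (a + t *\<^sub>R b) + Im u *\<^sub>R (t *\<^sub>R a - b)) f)
           ((x0 + t *\<^sub>R y) + Re \<zeta> *\<^sub>R (a + t *\<^sub>R b) + Im \<zeta> *\<^sub>R (t *\<^sub>R a - b)))"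
        by (rule C2_family_scale)
      have c: "continuous_on UNIV (\<lambda>t::real. c)" for c :: real by (rule continuous_on_const)
      note fam2 = C2_family_scale[OF C2_family_sqrt[OF \<eta>, of y b a, folded L_def, folded W_def] c]
      note fam3 = C2_family_scale[OF C2_family_log[OF \<epsilon>(1), of \<zeta>0, folded D_def] c]
      note fam23 = C2_family_add[OF fam2[of "\<sigma> / (2 * R)"] fam3[of "\<delta> / (2 * R)"]]
      show ?thesis
        by (rule that, unfold g_def[abs_def] g2_def[abs_def], rule C2_family_add[OF fam1 fam23])
    qed
    have pt: "(x0 + t *\<^sub>R y) + Re \<zeta> *\<^sub>R (a + t *\<^sub>R b) + Im \<zeta> *\<^sub>R (t *\<^sub>R a - b) = X \<zeta> + t *\<^sub>R (y + L \<zeta>)" for t \<zeta>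
      by (simp add: X_def L_def algebra_simps)
    have Dpos: "D \<epsilon> \<zeta> > 0" for \<zeta> using \<epsilon> by (simp add: D_def add_nonneg_pos)
    have W2: "(W \<eta> \<zeta>)\<^sup>2 = (norm (y + L \<zeta>))\<^sup>2 + \<eta>\<^sup>2" for \<zeta>
      by (simp add: W_def)
    have Wpos: "W \<eta> \<zeta> > 0" for \<zeta> using \<eta> by (simp add: W_def add_nonneg_pos)
    have lap_g2: "g2 \<zeta> t 1 1 + g2 \<zeta> t \<i> \<i> = 1 / pi * H \<zeta> t
       + (\<sigma> / (2 * R) * ((S \<zeta> + ((norm a)\<^sup>2 + (norm b)\<^sup>2) * \<eta>\<^sup>2) / W \<eta> \<zeta> ^ 3) + \<delta> / (2 * R) * (4 * \<epsilon>\<^sup>2 / (D \<epsilon> \<zeta>)\<^sup>2))" for \<zeta> t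
    proof -
      let ?p = "X \<zeta> + t *\<^sub>R (y + L \<zeta>)"
      have "dirderiv (a + t *\<^sub>R b) (dirderiv (a + t *\<^sub>R b) f) ?p + dirderiv (t *\<^sub>R a - b) (dirderiv (t *\<^sub>R a - b) f) ?p
         = (1 + t\<^sup>2) * H \<zeta> t"
        unfolding H_def dirderiv2_expand[OF f] by (simp add: algebra_simps power2_eq_square)
      then have "1 / (pi * (1 + t\<^sup>2)) * dirderiv (a + t *\<^sub>R b) (dirderiv (a + t *\<^sub>R b) f) ?p
          + 1 / (pi * (1 + t\<^sup>2)) * dirderiv (t *\<^sub>R a - b) (dirderiv (t *\<^sub>R a - b) f) ?p
          = 1 / (pi * (1 + t\<^sup>2)) * ((1 + t\<^sup>2) * H \<zeta> t)"
        by (simp only: distrib_left[symmetric])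
      also have "\<dots> = 1 / pi * H \<zeta> t" using denominator_nonzero[of t] by simp
      finally have 1: "1 / (pi * (1 + t\<^sup>2)) * dirderiv (a + t *\<^sub>R b) (dirderiv (a + t *\<^sub>R b) f) ?p
          + 1 / (pi * (1 + t\<^sup>2)) * dirderiv (t *\<^sub>R a - b) (dirderiv (t *\<^sub>R a - b) f) ?p = 1 / pi * H \<zeta> t" .
      have w: "p\<^sup>2 / n - q * q / n ^ 3 = (p\<^sup>2 * n\<^sup>2 - q\<^sup>2) / n ^ 3" if "n > 0" for p q n :: real
        using that by (simp add: field_simps power2_eq_square power3_eq_cube)
      have 2: "(b \<bullet> b) / W \<eta> \<zeta> - ((y + L \<zeta>) \<bullet> b) * ((y + L \<zeta>) \<bullet> b) / W \<eta> \<zeta> ^ 3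
        + ((a \<bullet> a) / W \<eta> \<zeta> - ((y + L \<zeta>) \<bullet> a) * ((y + L \<zeta>) \<bullet> a) / W \<eta> \<zeta> ^ 3)
        = (S \<zeta> + ((norm a)\<^sup>2 + (norm b)\<^sup>2) * \<eta>\<^sup>2) / W \<eta> \<zeta> ^ 3"
        unfolding power2_norm_eq_inner[symmetric] w[OF Wpos] W2 add_divide_distrib[symmetric] S_def
        by (simp add: inner_commute algebra_simps)
      have n: "(norm (\<zeta> - \<zeta>0))\<^sup>2 = (Re (\<zeta> - \<zeta>0))\<^sup>2 + (Im (\<zeta> - \<zeta>0))\<^sup>2" by (rule cmod_power2)
      have 3: "2 * (1 \<bullet> (1::complex)) / D \<epsilon> \<zeta> - 4 * ((\<zeta> - \<zeta>0) \<bullet> 1) * ((\<zeta> - \<zeta>0) \<bullet> 1) / (D \<epsilon> \<zeta>)\<^sup>2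
         + (2 * (\<i> \<bullet> \<i>) / D \<epsilon> \<zeta> - 4 * ((\<zeta> - \<zeta>0) \<bullet> \<i>) * ((\<zeta> - \<zeta>0) \<bullet> \<i>) / (D \<epsilon> \<zeta>)\<^sup>2) = 4 * \<epsilon>\<^sup>2 / (D \<epsilon> \<zeta>)\<^sup>2"
      proof -
        have "2 / d - 4 * r * r / d\<^sup>2 + (2 / d - 4 * s * s / d\<^sup>2) = 4 * (d - (r\<^sup>2 + s\<^sup>2)) / d\<^sup>2"
          if "d > 0" for d r s :: real using that by (simp add: field_simps power2_eq_square)
        from this[OF Dpos[of \<zeta>], of "Re (\<zeta> - \<zeta>0)" "Im (\<zeta> - \<zeta>0)"] show ?thesis
          by (simp add: inner_complex_def n[symmetric] D_def[of \<epsilon> \<zeta>, symmetric] del: minus_complex.sel)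
            (simp add: D_def)
      qed
      have [simp]: "L 1 = b" "L \<i> = a" by (simp_all add: L_def)
      have "g2 \<zeta> t 1 1 + g2 \<zeta> t \<i> \<i> =
        (1 / (pi * (1 + t\<^sup>2)) * dirderiv (a + t *\<^sub>R b) (dirderiv (a + t *\<^sub>R b) f) ?p
          + 1 / (pi * (1 + t\<^sup>2)) * dirderiv (t *\<^sub>R a - b) (dirderiv (t *\<^sub>R a - b) f) ?p)
        + (\<sigma> / (2 * R) * ((b \<bullet> b) / W \<eta> \<zeta> - ((y + L \<zeta>) \<bullet> b) * ((y + L \<zeta>) \<bullet> b) / W \<eta> \<zeta> ^ 3
        + ((a \<bullet> a) / W \<eta> \<zeta> - ((y + L \<zeta>) \<bullet> a) * ((y + L \<zeta>) \<bullet> a) / W \<eta> \<zeta> ^ 3))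
        + \<delta> / (2 * R) * (2 * (1 \<bullet> (1::complex)) / D \<epsilon> \<zeta> - 4 * ((\<zeta> - \<zeta>0) \<bullet> 1) * ((\<zeta> - \<zeta>0) \<bullet> 1) / (D \<epsilon> \<zeta>)\<^sup>2
         + (2 * (\<i> \<bullet> \<i>) / D \<epsilon> \<zeta> - 4 * ((\<zeta> - \<zeta>0) \<bullet> \<i>) * ((\<zeta> - \<zeta>0) \<bullet> \<i>) / (D \<epsilon> \<zeta>)\<^sup>2)))"
        unfolding g2_def pt by (simp only: complex.sel one_complex.sel imaginary_unit.sel \<open>L 1 = b\<close> \<open>L \<i> = a\<close>
            scaleR_zero_left scaleR_one add_0_left add_0_right distrib_left ac_simps)
      then show ?thesis unfolding 1 2 3 .
    qed
    have const: "integral {-R..R} (\<lambda>t. c / (2 * R)) = c" for c :: real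
      using R0 by simp
    have split: "integral {-R..R} (\<lambda>t. 1 / pi * F t + c / (2 * R)) = 1 / pi * integral {-R..R} F + c"
      if "continuous_on {-R..R} F" for F c
    proof -
      have "integral {-R..R} (\<lambda>t. 1 / pi * F t + c / (2 * R)) =
          integral {-R..R} (\<lambda>t. 1 / pi * F t) + integral {-R..R} (\<lambda>t. c / (2 * R))"
        by (intro integral_add integrable_continuous_interval continuous_on_mult continuous_on_const that)
      then show ?thesis unfolding const integral_mult_right .
    qed
    have lap: "0 \<le> integral {-R..R} (\<lambda>t. g2 \<zeta> t 1 1 + g2 \<zeta> t \<i> \<i>)" if \<zeta>: "norm \<zeta> \<le> 1" for \<zeta>
    proof -
      define p1 p2 where "p1 = (S \<zeta> + ((norm a)\<^sup>2 + (norm b)\<^sup>2) * \<eta>\<^sup>2) / W \<eta> \<zeta> ^ 3" and "p2 = 4 * \<epsilon>\<^sup>2 / (D \<epsilon> \<zeta>)\<^sup>2"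
      have p1: "p1 \<ge> S \<zeta> / W \<eta> \<zeta> ^ 3" "p1 \<ge> 0" and p2: "p2 \<ge> 0"
        using S_nonneg[of \<zeta>] Wpos[of \<zeta>] by (auto simp: p1_def p2_def intro!: divide_right_mono divide_nonneg_pos)
      have "integral {-R..R} (\<lambda>t. g2 \<zeta> t 1 1 + g2 \<zeta> t \<i> \<i>) =
          integral {-R..R} (\<lambda>t. 1 / pi * H \<zeta> t + (\<sigma> * p1 + \<delta> * p2) / (2 * R))"
        unfolding lap_g2 p1_def[symmetric] p2_def[symmetric] by (simp add: add_divide_distrib)
      also have "\<dots> = 1 / pi * integral {-R..R} (H \<zeta>) + (\<sigma> * p1 + \<delta> * p2)"
        by (rule split[OF H_cont])
      also have "\<dots> \<ge> 0"
      proof (cases "\<epsilon> \<le> norm (\<zeta> - \<zeta>0)")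
        case True
        \<comment> \<open>Regularising \<open>|y|\<close> costs a factor at most \<open>3\<close> in its Levi form, which is absorbed by \<open>1/\<pi> \<le> 1/3\<close>.\<close>
        let ?n = "norm (y + L \<zeta>)"
        have "\<eta> \<le> \<kappa> * norm (\<zeta> - \<zeta>0)" unfolding \<eta>_def using True \<kappa>(1) by (intro mult_left_mono) auto
        also have "\<dots> \<le> ?n" unfolding Y by (rule \<kappa>(2))
        finally have \<eta>n: "\<eta> \<le> ?n" .
        then have npos: "?n > 0" using \<eta> by linarith
        have "\<eta>\<^sup>2 \<le> ?n\<^sup>2" using \<eta>n \<eta> by (intro power_mono) auto
        then have w2: "(W \<eta> \<zeta>)\<^sup>2 \<le> 2 * ?n\<^sup>2" by (simp add: W2)
        have "(3/2 * ?n)\<^sup>2 = 9/4 * ?n\<^sup>2" by (simp add: power_mult_distrib power2_eq_square)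
        with w2 have "(W \<eta> \<zeta>)\<^sup>2 \<le> (3/2 * ?n)\<^sup>2" using zero_le_power2[of ?n] by linarith
        then have w1: "W \<eta> \<zeta> \<le> 3/2 * ?n" by (rule power2_le_imp_le) simp
        have "W \<eta> \<zeta> ^ 3 = (W \<eta> \<zeta>)\<^sup>2 * W \<eta> \<zeta>" by (simp add: power2_eq_square power3_eq_cube)
        also have "\<dots> \<le> (2 * ?n\<^sup>2) * (3/2 * ?n)"
          using w1 w2 Wpos[of \<zeta>] by (intro mult_mono) auto
        also have "\<dots> = 3 * ?n ^ 3" by (simp add: power2_eq_square power3_eq_cube)
        finally have w3: "W \<eta> \<zeta> ^ 3 \<le> 3 * ?n ^ 3" .
        have "S \<zeta> / (3 * ?n ^ 3) \<le> S \<zeta> / W \<eta> \<zeta> ^ 3"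
          using w3 Wpos[of \<zeta>] npos S_nonneg[of \<zeta>] by (intro divide_left_mono) auto
        then have "C * (S \<zeta> / (3 * ?n ^ 3)) \<le> \<sigma> * p1"
          using C p1 S_nonneg[of \<zeta>] npos by (intro mult_mono) auto
        moreover have "- C * (S \<zeta> / ?n ^ 3) \<le> integral {-R..R} (H \<zeta>)"
          using far[OF \<zeta> _ R0] True by (simp add: \<epsilon>_def)
        then have "1 / pi * (- C * (S \<zeta> / ?n ^ 3)) \<le> 1 / pi * integral {-R..R} (H \<zeta>)"
          by (intro mult_left_mono) auto
        moreover have "1 / pi * (C * (S \<zeta> / ?n ^ 3)) \<le> 1 / 3 * (C * (S \<zeta> / ?n ^ 3))"
          using pi_gt3 C S_nonneg[of \<zeta>] npos by (intro mult_right_mono) (auto simp: field_simps)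
        moreover have "0 \<le> \<delta> * p2" using \<delta> p2 by simp
        ultimately show ?thesis by simp
      next
        case False
        then have "D \<epsilon> \<zeta> \<le> 2 * \<epsilon>\<^sup>2" by (simp add: D_def power_mono)
        then have "(D \<epsilon> \<zeta>)\<^sup>2 \<le> (2 * \<epsilon>\<^sup>2)\<^sup>2" using Dpos[of \<zeta>] by (intro power_mono) auto
        then have "4 * \<epsilon>\<^sup>2 / (2 * \<epsilon>\<^sup>2)\<^sup>2 \<le> p2"
          unfolding p2_def using Dpos[of \<zeta>] \<epsilon> by (intro divide_left_mono) auto
        then have "1 / \<epsilon>\<^sup>2 \<le> p2" using \<epsilon> by (simp add: power_mult_distrib power2_eq_square)
        then have "\<delta> * (1 / \<epsilon>\<^sup>2) \<le> \<delta> * p2" using \<delta> by (intro mult_left_mono)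
        then have d: "R * B2 \<le> \<delta> * p2" using \<epsilon> by (simp add: \<delta>_def)
        have "\<bar>integral {-R..R} (H \<zeta>)\<bar> \<le> B2 * (R - (-R))"
          by (rule integral_bound[of "-R" R "H \<zeta>" B2, unfolded real_norm_def])
            (use R0 H_bound H_cont in auto)
        then have "1 / pi * \<bar>integral {-R..R} (H \<zeta>)\<bar> \<le> 1 / pi * (2 * R * B2)"
          by (intro mult_left_mono) (auto simp: mult.commute)
        also have "\<dots> \<le> 1 / 2 * (2 * R * B2)"
          using pi_gt3 R0 B2 by (intro mult_right_mono) (auto simp: field_simps)
        finally have "1 / pi * \<bar>integral {-R..R} (H \<zeta>)\<bar> \<le> R * B2" by simp
        moreover have "- (1 / pi * \<bar>integral {-R..R} (H \<zeta>)\<bar>) \<le> 1 / pi * integral {-R..R} (H \<zeta>)"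
          by (simp add: field_simps)
        moreover have "0 \<le> \<sigma> * p1" using C p1 by simp
        ultimately show ?thesis using d by linarith
      qed
      finally show ?thesis .
    qed
    have gint: "integral {-R..R} (g \<zeta>) = truncated_extension R f (z + \<zeta> *s v) + (\<sigma> * W \<eta> \<zeta> + \<delta> * ln (D \<epsilon> \<zeta>))" for \<zeta>
    proof -
      have "integral {-R..R} (g \<zeta>) = integral {-R..R} (\<lambda>t. 1 / pi * (f (X \<zeta> + t *\<^sub>R (y + L \<zeta>)) / (1 + t\<^sup>2))
          + (\<sigma> * W \<eta> \<zeta> + \<delta> * ln (D \<epsilon> \<zeta>)) / (2 * R))"
        unfolding g_def pt by (simp add: add_divide_distrib)
      also have "\<dots> = 1 / pi * integral {-R..R} (\<lambda>t. f (X \<zeta> + t *\<^sub>R (y + L \<zeta>)) / (1 + t\<^sup>2)) + (\<sigma> * W \<eta> \<zeta> + \<delta> * ln (D \<epsilon> \<zeta>))"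
        by (rule split, intro continuous_intros continuous_on_smooth_compose[OF f]) (simp add: denominator_nonzero)
      finally show ?thesis
        unfolding truncated_extension_def re_im_vec_line X_def L_def a_def b_def x0_def y_def
        by (simp add: add.assoc)
    qed
    have sub: "2 * pi * integral {-R..R} (g 0) \<le> integral {0..2*pi} (\<lambda>\<phi>. integral {-R..R} (g (cis \<phi>)))"
      by (rule C2_family_submean[OF fam lap])
    have err: "\<bar>extension f w - truncated_extension R f w\<bar> \<le> e R" for w
      unfolding e_def by (rule truncated_extension_error[OF f B0]) (use R0 in simp)
    have W_im: "W \<eta> \<zeta> \<ge> norm (im_vec (z + \<zeta> *s v))" "W \<eta> \<zeta> \<le> norm (im_vec (z + \<zeta> *s v)) + \<eta>" for \<zeta>
    proof -
      have "im_vec (z + \<zeta> *s v) = y + L \<zeta>" by (simp add: re_im_vec_line y_def L_def a_def b_def)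
      then show "W \<eta> \<zeta> \<ge> norm (im_vec (z + \<zeta> *s v))" "W \<eta> \<zeta> \<le> norm (im_vec (z + \<zeta> *s v)) + \<eta>"
        using \<eta> sqrt_sum_squares_le_sum[of "norm (y + L \<zeta>)" \<eta>] by (auto simp: W_def real_le_rsqrt)
    qed
    have \<sigma>0: "\<sigma> \<ge> 0" using C by simp
    have low: "U z - (e R - \<delta> * (2 * ln \<epsilon>)) \<le> integral {-R..R} (g 0)"
    proof -
      have "2 * ln \<epsilon> = ln (\<epsilon>\<^sup>2)" using \<epsilon> by (simp add: ln_realpow)
      also have "\<dots> \<le> ln (D \<epsilon> 0)" using \<epsilon> Dpos[of 0] by (subst ln_le_cancel_iff) (auto simp: D_def)
      finally have "\<delta> * (2 * ln \<epsilon>) \<le> \<delta> * ln (D \<epsilon> 0)" using \<delta> by (rule mult_left_mono)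
      moreover have "\<sigma> * norm (im_vec z) \<le> \<sigma> * W \<eta> 0"
        using W_im(1)[of 0] \<sigma>0 by (intro mult_left_mono) auto
      ultimately show ?thesis using err[of z] unfolding gint U_def by simp
    qed
    have up: "integral {-R..R} (g (cis \<phi>)) \<le> U (z + cis \<phi> *s v) + (e R + \<sigma> * \<eta> + \<delta> * \<Lambda>)" for \<phi>
    proof -
      have "norm (cis \<phi> - \<zeta>0) \<le> 1 + norm \<zeta>0" using norm_triangle_ineq4[of "cis \<phi>" \<zeta>0] by simp
      then have "D \<epsilon> (cis \<phi>) \<le> (1 + norm \<zeta>0)\<^sup>2 + 1"
        using \<epsilon> unfolding D_def by (intro add_mono power_mono power_le_one) auto
      then have "ln (D \<epsilon> (cis \<phi>)) \<le> \<Lambda>" unfolding \<Lambda>_def using Dpos[of "cis \<phi>"]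
        by (subst ln_le_cancel_iff) (auto simp: add_nonneg_pos)
      then have "\<delta> * ln (D \<epsilon> (cis \<phi>)) \<le> \<delta> * \<Lambda>" using \<delta> by (rule mult_left_mono)
      moreover have "\<sigma> * W \<eta> (cis \<phi>) \<le> \<sigma> * (norm (im_vec (z + cis \<phi> *s v)) + \<eta>)"
        using W_im(2) \<sigma>0 by (intro mult_left_mono) auto
      ultimately show ?thesis using err[of "z + cis \<phi> *s v"] unfolding gint U_def by (simp add: algebra_simps)
    qed
    have cgi: "(\<lambda>\<phi>. integral {-R..R} (g (cis \<phi>))) integrable_on {0..2*pi}"
    proof -
      have cL: "continuous_on {0..2*pi} (\<lambda>\<phi>. L (cis \<phi>))"
        unfolding L_def cis.sel by (intro continuous_intros)
      have "continuous_on {0..2*pi} (\<lambda>\<phi>. truncated_extension R f (z + cis \<phi> *s v))"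
        by (rule continuous_on_compose2[OF continuous_on_truncated_extension[OF f] cline]) auto
      moreover have "D \<epsilon> (cis \<phi>) \<noteq> 0" for \<phi> using Dpos[of "cis \<phi>"] by simp
      then have "continuous_on {0..2*pi} (\<lambda>\<phi>. ln (D \<epsilon> (cis \<phi>)))"
        by (intro continuous_on_ln) (auto simp: D_def intro!: continuous_intros)
      moreover have "continuous_on {0..2*pi} (\<lambda>\<phi>. W \<eta> (cis \<phi>))"
        unfolding W_def by (intro continuous_intros cL)
      ultimately show ?thesis unfolding gint
        by (intro integrable_continuous_interval continuous_on_add continuous_on_mult continuous_on_const)
    qed
    have "integral {0..2*pi} (\<lambda>\<phi>. integral {-R..R} (g (cis \<phi>))) \<le>
       integral {0..2*pi} (\<lambda>\<phi>. U (z + cis \<phi> *s v) + (e R + \<sigma> * \<eta> + \<delta> * \<Lambda>))"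
      by (intro integral_le cgi up integrable_continuous_interval continuous_intros cUc)
    also have "\<dots> = integral {0..2*pi} (\<lambda>\<phi>. U (z + cis \<phi> *s v)) + 2 * pi * (e R + \<sigma> * \<eta> + \<delta> * \<Lambda>)"
      by (subst integral_add) (auto intro!: integrable_continuous_interval cUc)
    finally have "2 * pi * (U z - (e R - \<delta> * (2 * ln \<epsilon>))) \<le> integral {0..2*pi} (\<lambda>\<phi>. U (z + cis \<phi> *s v)) + 2 * pi * (e R + \<sigma> * \<eta> + \<delta> * \<Lambda>)"
      using order_trans[OF mult_left_mono[OF low] sub] by (simp add: mult_ac)
    moreover have "\<delta> = B2 * A\<^sup>2 / R" using R0 by (simp add: \<delta>_def \<epsilon>_def power2_eq_square)
    ultimately show ?thesis
      unfolding \<eta>_def \<epsilon>_def by (simp add: algebra_simps)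
  qed
  have lim: "((\<lambda>R. integral {0..2*pi} (\<lambda>\<phi>. U (z + cis \<phi> *s v)) +
      2 * pi * (2 * e R + \<sigma> * (\<kappa> * (A / R)) + B2 * A\<^sup>2 / R * (\<Lambda> - 2 * ln (A / R)))) \<longlongrightarrow>
      integral {0..2*pi} (\<lambda>\<phi>. U (z + cis \<phi> *s v)) + 2 * pi * (2 * 0 + \<sigma> * (\<kappa> * 0) + 0)) at_top"
  proof (intro tendsto_intros)
    show "(e \<longlongrightarrow> 0) at_top" unfolding e_def by (rule truncated_extension_error_tendsto)
    show "((\<lambda>R. A / R) \<longlongrightarrow> 0) at_top" by (rule tendsto_divide_0[OF tendsto_const]) (simp add: filterlim_at_top_imp_at_infinity filterlim_ident)
    have inv: "((\<lambda>R. c / R) \<longlongrightarrow> 0) at_top" for c :: real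
      by (rule tendsto_divide_0[OF tendsto_const]) (simp add: filterlim_at_top_imp_at_infinity filterlim_ident)
    have "((\<lambda>R. B2 * A\<^sup>2 * (\<Lambda> - 2 * ln A) / R + 2 * B2 * A\<^sup>2 * (ln R / R)) \<longlongrightarrow> 0 + 2 * B2 * A\<^sup>2 * 0) at_top"
      by (intro tendsto_intros inv ln_x_over_x_tendsto_0)
    then have "((\<lambda>R. B2 * A\<^sup>2 * (\<Lambda> - 2 * ln A) / R + 2 * B2 * A\<^sup>2 * (ln R / R)) \<longlongrightarrow> 0) at_top" by simp
    moreover have "eventually (\<lambda>R. B2 * A\<^sup>2 * (\<Lambda> - 2 * ln A) / R + 2 * B2 * A\<^sup>2 * (ln R / R) =
        B2 * A\<^sup>2 / R * (\<Lambda> - 2 * ln (A / R))) at_top"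
      using eventually_gt_at_top[of 0]
      by eventually_elim (use A in \<open>simp add: ln_div field_simps\<close>)
    ultimately show "((\<lambda>R. B2 * A\<^sup>2 / R * (\<Lambda> - 2 * ln (A / R))) \<longlongrightarrow> 0) at_top"
      by (rule Lim_transform_eventually)
  qed
  have "2 * pi * U z \<le> integral {0..2*pi} (\<lambda>\<phi>. U (z + cis \<phi> *s v)) + 2 * pi * (2 * 0 + \<sigma> * (\<kappa> * 0) + 0)"
    by (rule tendsto_lowerbound[OF lim eventually_mono[OF eventually_ge_at_top[of A] main]]) auto
  then show ?thesis by simp
qed

text \<open>The criterion for plurisubharmonicity.  Both sides of the submean inequality are continuous in \<open>v\<close>, and every \<open>v\<close> is a
  limit of vectors with independent real and imaginary parts.\<close>
lemma extension_plurisubharmonic: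
  assumes f: "smooth f" and van: "\<And>x. \<rho> < norm x \<Longrightarrow> f x = 0"
    and line: "\<And>x d n. norm d = 1 \<Longrightarrow> norm n = 1 \<Longrightarrow> d \<bullet> n = 0 \<Longrightarrow>
      - C \<le> (LINT t|lborel. dirderiv n (dirderiv n f) (x + t *\<^sub>R d))"
    and C: "0 \<le> C" "C \<le> \<sigma>"
  shows "plurisubharmonic (\<lambda>z. ereal (extension f z + \<sigma> * norm (im_vec z)))"
proof -
  define U where "U z = extension f z + \<sigma> * norm (im_vec z)" for z
  obtain B where B: "\<And>x. \<bar>f x\<bar> \<le> B"
    by (rule bounded_of_support[OF smooth_continuous[OF f] van]) auto
  have cU: "continuous_on UNIV U"
    unfolding U_def by (intro continuous_intros continuous_on_extension[OF f B] continuous_on_im_vec)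
  have "2 * pi * U z \<le> integral {0..2*pi} (\<lambda>\<phi>. U (z + cis \<phi> *s v))" for z v
  proof -
    define w where "w s = (\<chi> i. v $ i + complex_of_real s * (if i = 1 then 1 else \<i>))" for s
    define \<Phi> where "\<Phi> s = integral {0..2*pi} (\<lambda>\<phi>. U (z + cis \<phi> *s w s))" for s
    have "continuous_on (UNIV \<times> cbox 0 (2*pi)) (\<lambda>(s, \<phi>). U (z + cis \<phi> *s w s))"
      unfolding split_beta vector_scalar_mult_def w_def
      by (rule continuous_on_compose2[OF cU]) (auto intro!: continuous_intros)
    from integral_continuous_on_param[OF this] have "continuous_on UNIV \<Phi>"
      unfolding \<Phi>_def by simp
    then have lim: "(\<Phi> \<longlongrightarrow> \<Phi> 0) (at 0)"
      by (metis UNIV_I continuous_on_def)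
    define \<Delta> c where "\<Delta> = im_vec v $ 1 * re_vec v $ 2 - im_vec v $ 2 * re_vec v $ 1"
      and "c = re_vec v $ 1 + im_vec v $ 2"
    \<comment> \<open>The perturbation adds \<open>s e\<^sub>1\<close> to the real part and \<open>s e\<^sub>2\<close> to the imaginary part, so the determinant is a
       quadratic polynomial in \<open>s\<close> with leading coefficient \<open>-1\<close>.\<close>
    have det: "im_vec (w s) $ 1 * re_vec (w s) $ 2 - im_vec (w s) $ 2 * re_vec (w s) $ 1 = \<Delta> - s * (s + c)" for s
      by (simp add: w_def re_vec_def im_vec_def \<Delta>_def c_def algebra_simps)
    have "eventually (\<lambda>s. \<Delta> - s * (s + c) \<noteq> 0) (at 0)"
    proof (cases "\<Delta> = 0")
      case True
      have "eventually (\<lambda>s. s + c \<noteq> 0) (at 0)"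
      proof (cases "c = 0")
        case True
        then show ?thesis by (simp add: eventually_at_filter)
      next
        case False
        have "((\<lambda>s. s + c) \<longlongrightarrow> 0 + c) (at 0)" by (intro tendsto_intros)
        then show ?thesis using False tendsto_imp_eventually_ne[of "\<lambda>s. s + c" "0 + c" "at 0" 0] by simp
      qed
      moreover have "eventually (\<lambda>s::real. s \<noteq> 0) (at 0)" by (simp add: eventually_at_filter)
      ultimately show ?thesis by eventually_elim (simp add: True)
    next
      case False
      have "((\<lambda>s. \<Delta> - s * (s + c)) \<longlongrightarrow> \<Delta> - 0 * (0 + c)) (at 0)" by (intro tendsto_intros)
      then show ?thesis using False tendsto_imp_eventually_ne[of "\<lambda>s. \<Delta> - s * (s + c)" "\<Delta> - 0 * (0 + c)" "at 0" 0] by simp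
    qed
    then have "eventually (\<lambda>s. 2 * pi * U z \<le> \<Phi> s) (at 0)"
    proof eventually_elim
      case (elim s)
      show ?case
        unfolding \<Phi>_def U_def
        by (rule submean_independent[OF f van line C]) (use elim det in auto)
    qed
    then have "2 * pi * U z \<le> \<Phi> 0"
      by (rule tendsto_lowerbound[OF lim]) simp
    then show ?thesis by (simp add: \<Phi>_def w_def)
  qed
  from plurisubharmonicI[OF cU this] show ?thesis by (simp add: U_def)
qed

section \<open>Averages over dilations\<close>

text \<open>The weighted average \<open>\<integral>_1^2 t^(m-1) f(tx) dt\<close> of dilates of \<open>f\<close>.  The average that is subtracted has \<open>m = 0\<close>;
  each derivative raises \<open>m\<close> by one.\<close>
definition dilation_mean :: "nat \<Rightarrow> (real^2 \<Rightarrow> real) \<Rightarrow> real^2 \<Rightarrow> real" where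
  "dilation_mean m f x = integral {1..2} (\<lambda>t. t ^ m / t * f (t *\<^sub>R x))"

lemma dilation_mean_has_derivative:
  assumes f: "smooth f"
  shows "(dilation_mean m f has_derivative (\<lambda>h. dilation_mean (Suc m) (dirderiv h f) x)) (at x)"
proof -
  define c where "c i x t = t ^ Suc m / t * partial_deriv i f (t *\<^sub>R x)" for i x and t :: real
  define D where "D x t = c 1 x t *\<^sub>R blinfun_inner_left (axis 1 1) + c 2 x t *\<^sub>R blinfun_inner_left (axis 2 1 :: real^2)" for x t
  have D: "blinfun_apply (D x t) h = t ^ Suc m / t * dirderiv h f (t *\<^sub>R x)" for x t h
    by (simp add: D_def c_def blinfun.add_left blinfun.scaleR_left dirderiv_def inner_axis inner_axis' algebra_simps)
  have cont_c: "continuous_on (UNIV \<times> {1..2}) (\<lambda>(x, t). c i x t)" for i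
    unfolding c_def split_beta
    by (intro continuous_intros continuous_on_smooth_compose[OF smooth_partial_deriv[OF f]]) auto
  then have cont_D: "continuous_on (UNIV \<times> cbox 1 2) (\<lambda>(x, t). D x t)"
    unfolding D_def split_beta by (auto intro!: continuous_intros)
  have cont_f: "continuous_on {1..2} (\<lambda>t. t ^ m / t * f (t *\<^sub>R x))" for x
    by (intro continuous_intros continuous_on_smooth_compose[OF f]) auto
  have cont_D': "continuous_on {1..2} (D x)" for x
  proof -
    have "continuous_on {1..2} (\<lambda>t. (x, t))" by (intro continuous_intros)
    from continuous_on_compose2[OF cont_D this] show ?thesis by auto
  qed
  have "((\<lambda>x. integral (cbox 1 2) (\<lambda>t. t ^ m / t * f (t *\<^sub>R x))) has_derivative
      blinfun_apply (integral (cbox 1 2) (D x))) (at x within UNIV)"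
  proof (rule leibniz_rule[OF _ _ cont_D])
    fix x t assume t: "t \<in> cbox (1::real) 2"
    have "((\<lambda>x. f (t *\<^sub>R x)) has_derivative (\<lambda>h. dirderiv (t *\<^sub>R h) f (t *\<^sub>R x))) (at x)"
      by (rule has_derivative_compose[OF _ smooth_has_derivative[OF f]]) (auto intro!: derivative_eq_intros)
    then have "((\<lambda>x. t ^ m / t * f (t *\<^sub>R x)) has_derivative (\<lambda>h. t ^ m / t * dirderiv (t *\<^sub>R h) f (t *\<^sub>R x))) (at x)"
      by (rule has_derivative_mult_right)
    moreover have "(\<lambda>h. t ^ m / t * dirderiv (t *\<^sub>R h) f (t *\<^sub>R x)) = blinfun_apply (D x t)"
      by (auto simp: D dirderiv_vec_scale)
    ultimately show "((\<lambda>x. t ^ m / t * f (t *\<^sub>R x)) has_derivative blinfun_apply (D x t)) (at x within UNIV)"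
      by simp
  qed (use cont_f in \<open>auto intro!: integrable_continuous_interval\<close>)
  moreover have "blinfun_apply (integral (cbox 1 2) (D x)) = (\<lambda>h. dilation_mean (Suc m) (dirderiv h f) x)"
  proof (rule ext)
    fix h
    have "((\<lambda>t. blinfun_apply (D x t) h) has_integral blinfun_apply (integral (cbox 1 2) (D x)) h) {1..2}"
      using has_integral_linear[OF integrable_integral[OF integrable_continuous_interval[OF cont_D']] blinfun.bounded_linear_left]
      by (simp add: o_def)
    from integral_unique[OF this]
    show "blinfun_apply (integral (cbox 1 2) (D x)) h = dilation_mean (Suc m) (dirderiv h f) x"
      by (simp only: D dilation_mean_def)
  qed
  moreover have "dilation_mean m f = (\<lambda>x. integral (cbox 1 2) (\<lambda>t. t ^ m / t * f (t *\<^sub>R x)))"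
    by (simp add: fun_eq_iff dilation_mean_def)
  ultimately show ?thesis by simp
qed

lemma smooth_dilation_mean:
  assumes "smooth f" shows "smooth (dilation_mean m f)"
proof (rule smooth_coinduct[where P="\<lambda>h. \<exists>g m. smooth g \<and> h = dilation_mean m g"])
  fix h assume "\<exists>g m. smooth g \<and> h = dilation_mean m g"
  then obtain g m where g: "smooth g" "h = dilation_mean m g" by auto
  note d = dilation_mean_has_derivative[OF g(1), of m]
  have "partial_deriv i h = dilation_mean (Suc m) (partial_deriv i g)" for i
  proof -
    have "dirderiv (axis i 1) g = partial_deriv i g"
      using exhaust_2[of i] by (auto simp: fun_eq_iff dirderiv_def axis_def)
    then show ?thesis using partial_deriv_eq[OF d] by (auto simp: g(2))
  qed
  then show "(\<forall>x. h differentiable at x) \<and> (\<forall>i. \<exists>g m. smooth g \<and> partial_deriv i h = dilation_mean m g)"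
    using d g smooth_partial_deriv by (metis differentiable_def)
qed (use assms in auto)

lemma dirderiv_dilation_mean:
  "smooth f \<Longrightarrow> dirderiv a (dilation_mean m f) = dilation_mean (Suc m) (dirderiv a f)"
  using dirderiv_eq[OF dilation_mean_has_derivative] by blast

section \<open>A smooth bump function\<close>

text \<open>The function \<open>p(1/t) exp(-1/t)\<close>, extended by \<open>0\<close> to \<open>t \<le> 0\<close>.  The class of these functions, with \<open>p\<close> ranging over
  polynomials, is closed under differentiation.\<close>
definition flat :: "real poly \<Rightarrow> real \<Rightarrow> real" where
  "flat p t = (if 0 < t then poly p (1 / t) * exp (- (1 / t)) else 0)"

lemma poly_exp_tendsto_0: "((\<lambda>u::real. poly p u * exp (- u)) \<longlongrightarrow> 0) at_top"
proof -
  have "((\<lambda>u. \<Sum>i\<le>degree p. coeff p i * (u ^ i / exp u)) \<longlongrightarrow> (\<Sum>i\<le>degree p. coeff p i * 0)) at_top"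
    by (intro tendsto_intros tendsto_power_div_exp_0)
  moreover have "(\<Sum>i\<le>degree p. coeff p i * (u ^ i / exp u)) = poly p u * exp (- u)" for u
    by (simp add: poly_altdef sum_distrib_right exp_minus divide_inverse mult.assoc)
  ultimately show ?thesis by simp
qed

lemma flat_has_derivative:
  "(flat p has_real_derivative flat ([:0, 0, 1:] * (p - pderiv p)) t) (at t)"
proof (cases t "0::real" rule: linorder_cases)
  case less
  have "(flat p has_real_derivative 0) (at t)"
    by (rule has_field_derivative_transform_within_open[OF DERIV_const[of 0], of "{..<0}"])
      (use less in \<open>auto simp: flat_def\<close>)
  then show ?thesis using less by (simp add: flat_def)
next
  case greater
  have "((\<lambda>t. poly p (1 / t) * exp (- (1 / t))) has_real_derivative
      flat ([:0, 0, 1:] * (p - pderiv p)) t) (at t)"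
    using greater
    by (auto intro!: derivative_eq_intros DERIV_chain2[OF poly_DERIV] simp: flat_def field_simps power2_eq_square)
  then show ?thesis
    by (rule has_field_derivative_transform_within_open[of _ _ _ "{0<..}"]) (use greater in \<open>auto simp: flat_def\<close>)
next
  case equal
  have "((\<lambda>h. flat p h / h) \<longlongrightarrow> 0) (at_right 0)"
  proof -
    have "((\<lambda>u. poly (pCons 0 p) u * exp (- u)) \<longlongrightarrow> 0) at_top" by (rule poly_exp_tendsto_0)
    then have "((\<lambda>h. poly (pCons 0 p) (inverse h) * exp (- inverse h)) \<longlongrightarrow> 0) (at_right 0)"
      by (rule filterlim_compose[OF _ filterlim_inverse_at_top_right])
    moreover have "eventually (\<lambda>h. poly (pCons 0 p) (inverse h) * exp (- inverse h) = flat p h / h) (at_right (0::real))"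
      by (auto simp: eventually_at_filter flat_def field_simps)
    ultimately show ?thesis by (rule Lim_transform_eventually)
  qed
  moreover have "((\<lambda>h. flat p h / h) \<longlongrightarrow> 0) (at_left 0)"
    by (rule Lim_transform_eventually[OF tendsto_const]) (auto simp: eventually_at_filter flat_def)
  ultimately have "((\<lambda>h. flat p h / h) \<longlongrightarrow> 0) (at 0)"
    by (rule filterlim_split_at_real[rotated])
  then show ?thesis by (simp add: equal DERIV_def flat_def)
qed

lemma smooth_flat_radial: "smooth (\<lambda>x. flat p (5 - (norm x)\<^sup>2))"
proof -
  have d: "((\<lambda>x::real^2. flat p (5 - (norm x)\<^sup>2)) has_derivative
      (\<lambda>h. - 2 * (x \<bullet> h) * flat ([:0, 0, 1:] * (p - pderiv p)) (5 - (norm x)\<^sup>2))) (at x)" for p x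
  proof -
    have "((\<lambda>x::real^2. 5 - x \<bullet> x) has_derivative (\<lambda>h. - 2 * (x \<bullet> h))) (at x)"
      by (auto intro!: derivative_eq_intros simp: inner_commute)
    from has_derivative_compose[OF this flat_has_derivative[unfolded has_field_derivative_def]]
    show ?thesis by (simp add: power2_norm_eq_inner mult.commute mult.left_commute)
  qed
  have "C_k k (\<lambda>x. flat p (5 - (norm x)\<^sup>2))" for k
  proof (induction k arbitrary: p)
    case 0
    then show ?case using d by (auto intro!: continuous_at_imp_continuous_on has_derivative_continuous)
  next
    case (Suc k)
    have pd: "partial_deriv i (\<lambda>x. flat p (5 - (norm x)\<^sup>2)) =
       (\<lambda>x. (- 2 * x $ i) * flat ([:0, 0, 1:] * (p - pderiv p)) (5 - (norm x)\<^sup>2))" for i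
      using partial_deriv_eq[OF d] by (auto simp: inner_axis)
    have lin: "C_k k (\<lambda>x. - 2 * x $ i)" for i
      using smooth_cmult[OF smooth_component[of i], of "-2"] unfolding smooth_def by blast
    have "(\<lambda>x::real^2. flat p (5 - (norm x)\<^sup>2)) differentiable (at x)" for x
      using d unfolding differentiable_def by blast
    moreover have "C_k k (partial_deriv i (\<lambda>x. flat p (5 - (norm x)\<^sup>2)))" for i
      unfolding pd by (rule C_k_mult[OF lin Suc.IH])
    ultimately show ?case by (simp add: differentiable_on_def)
  qed
  then show ?thesis by (simp add: smooth_def)
qed

lemma bump_exists:
  obtains b where "smooth b" "\<And>x. 0 \<le> b x" "\<And>x. norm x \<le> 2 \<Longrightarrow> 1 \<le> b x" "\<And>x. 3 < norm x \<Longrightarrow> b x = 0"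
proof (rule that)
  \<comment> \<open>On \<open>|x| \<le> 2\<close> the argument is at least \<open>1\<close>, where \<open>exp(-1/t) \<ge> exp(-1)\<close>; it is negative for \<open>|x| > 3\<close>.\<close>
  let ?b = "\<lambda>x::real^2. exp 1 * flat 1 (5 - (norm x)\<^sup>2)"
  show "smooth ?b" by (intro smooth_cmult smooth_flat_radial)
  show "0 \<le> ?b x" for x by (simp add: flat_def)
  show "1 \<le> ?b x" if "norm x \<le> 2" for x
  proof -
    have "(norm x)\<^sup>2 \<le> 2\<^sup>2" using that by (intro power_mono) auto
    then have s: "1 \<le> 5 - (norm x)\<^sup>2" by simp
    then have "exp 0 \<le> exp (1 - 1 / (5 - (norm x)\<^sup>2))" by (subst exp_le_cancel_iff) (simp add: field_simps)
    then show ?thesis using s by (simp add: flat_def exp_diff exp_minus divide_inverse)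
  qed
  show "?b x = 0" if "3 < norm x" for x
  proof -
    have "3\<^sup>2 \<le> (norm x)\<^sup>2" using that by (intro power_mono) auto
    then show ?thesis by (simp add: flat_def)
  qed
qed

section \<open>Line integrals as functions of the offset\<close>

text \<open>The integral of \<open>f\<close> along the line with direction \<open>d\<close> at offset \<open>s\<close> from the origin in the direction \<open>n\<close>.\<close>
definition slice :: "real^2 \<Rightarrow> real^2 \<Rightarrow> (real^2 \<Rightarrow> real) \<Rightarrow> real \<Rightarrow> real" where
  "slice d n f s = (LINT t|lborel. f (s *\<^sub>R n + t *\<^sub>R d))"

text \<open>An orthonormal basis of the plane, of either orientation.\<close>
definition orthonormal :: "real^2 \<Rightarrow> real^2 \<Rightarrow> bool" where
  "orthonormal d n \<longleftrightarrow> norm d = 1 \<and> norm n = 1 \<and> d \<bullet> n = 0"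

lemma orthonormal_decomp:
  assumes "orthonormal d n"
  shows "x = (x \<bullet> n) *\<^sub>R n + (x \<bullet> d) *\<^sub>R d"
proof -
  have e: "d$1 * d$1 + d$2 * d$2 = 1" "n$1 * n$1 + n$2 * n$2 = 1" "d$1 * n$1 + d$2 * n$2 = 0"
    using assms by (simp_all add: orthonormal_def norm_eq_1 inner_vec_def sum_2)
  define c where "c = d$1 * n$2 - d$2 * n$1"
  have c: "c * c = 1"
  proof -
    have "c * c + (d$1 * n$1 + d$2 * n$2) * (d$1 * n$1 + d$2 * n$2)
       = (d$1 * d$1 + d$2 * d$2) * (n$1 * n$1 + n$2 * n$2)" by (simp add: c_def algebra_simps)
    then show ?thesis by (simp add: e)
  qed
  have n: "n$1 = - c * d$2" "n$2 = c * d$1"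
    using e unfolding c_def by algebra+
  have "n$1 * n$1 + d$1 * d$1 = 1" "n$1 * n$2 + d$1 * d$2 = 0" "n$2 * n$2 + d$2 * d$2 = 1"
    using e c unfolding n by algebra+
  then have "x$1 = (x$1 * n$1 + x$2 * n$2) * n$1 + (x$1 * d$1 + x$2 * d$2) * d$1"
    "x$2 = (x$1 * n$1 + x$2 * n$2) * n$2 + (x$1 * d$1 + x$2 * d$2) * d$2" by algebra+
  then show ?thesis by (simp add: vec_eq_iff forall_2 inner_vec_def sum_2)
qed

lemma norm_orthonormal:
  assumes "orthonormal d n"
  shows "\<bar>s\<bar> \<le> norm (s *\<^sub>R n + t *\<^sub>R d)" "\<bar>t\<bar> \<le> norm (s *\<^sub>R n + t *\<^sub>R d)"
proof -
  have "(s *\<^sub>R n + t *\<^sub>R d) \<bullet> n = s" "(s *\<^sub>R n + t *\<^sub>R d) \<bullet> d = t"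
  proof -
    have "n \<bullet> n = 1" "d \<bullet> d = 1" "d \<bullet> n = 0" "n \<bullet> d = 0"
      using assms inner_commute[of n d] by (simp_all add: orthonormal_def norm_eq_1)
    then show "(s *\<^sub>R n + t *\<^sub>R d) \<bullet> n = s" "(s *\<^sub>R n + t *\<^sub>R d) \<bullet> d = t"
      by (simp_all add: inner_add_left)
  qed
  with Cauchy_Schwarz_ineq2[of "s *\<^sub>R n + t *\<^sub>R d" n] Cauchy_Schwarz_ineq2[of "s *\<^sub>R n + t *\<^sub>R d" d] assms
  show "\<bar>s\<bar> \<le> norm (s *\<^sub>R n + t *\<^sub>R d)" "\<bar>t\<bar> \<le> norm (s *\<^sub>R n + t *\<^sub>R d)"
    by (auto simp: orthonormal_def)
qed

lemma LINT_line_slice: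
  assumes "orthonormal d n"
  shows "(LINT t|lborel. f (x + t *\<^sub>R d)) = slice d n f (x \<bullet> n)"
proof -
  have "x + t *\<^sub>R d = (x \<bullet> n) *\<^sub>R n + ((x \<bullet> d) + 1 * t) *\<^sub>R d" for t
    by (subst orthonormal_decomp[OF assms, of x]) (simp add: algebra_simps)
  then show ?thesis
    unfolding slice_def
    by (subst lborel_integral_real_affine[of 1 "\<lambda>t. f ((x \<bullet> n) *\<^sub>R n + t *\<^sub>R d)" "x \<bullet> d"]) simp_all
qed

lemma slice_eq_integral:
  assumes "orthonormal d n" "continuous_on UNIV f" "\<And>x. \<rho> < norm x \<Longrightarrow> f x = 0" "\<rho> \<le> R"
  shows "integrable lborel (\<lambda>t. f (s *\<^sub>R n + t *\<^sub>R d))"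
    "slice d n f s = integral {-R..R} (\<lambda>t. f (s *\<^sub>R n + t *\<^sub>R d))"
proof -
  have c: "continuous_on UNIV (\<lambda>t. f (s *\<^sub>R n + t *\<^sub>R d))"
    by (rule continuous_on_compose2[OF assms(2)]) (auto intro!: continuous_intros)
  have v: "f (s *\<^sub>R n + t *\<^sub>R d) = 0" if "R < \<bar>t\<bar>" for t
    using norm_orthonormal(2)[OF assms(1), of t s] that assms(4) by (intro assms(3)) linarith
  show "integrable lborel (\<lambda>t. f (s *\<^sub>R n + t *\<^sub>R d))"
    by (rule LINT_compact_support(1)[OF c v])
  show "slice d n f s = integral {-R..R} (\<lambda>t. f (s *\<^sub>R n + t *\<^sub>R d))"
    unfolding slice_def by (rule LINT_compact_support(2)[OF c v])
qed

lemma slice_outside: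
  assumes "orthonormal d n" "\<And>x. \<rho> < norm x \<Longrightarrow> f x = 0" "\<rho> < \<bar>s\<bar>"
  shows "slice d n f s = 0"
proof -
  have "f (s *\<^sub>R n + t *\<^sub>R d) = 0" for t
    using norm_orthonormal(1)[OF assms(1), of s t] assms(3) by (intro assms(2)) linarith
  then show ?thesis by (simp add: slice_def)
qed

lemma slice_bound:
  assumes "orthonormal d n" "continuous_on UNIV f" "\<And>x. \<rho> < norm x \<Longrightarrow> f x = 0" "0 \<le> \<rho>"
    "\<And>x. \<bar>f x\<bar> \<le> B"
  shows "\<bar>slice d n f s\<bar> \<le> B * (2 * \<rho>)"
proof -
  have "norm (integral {-\<rho>..\<rho>} (\<lambda>t. f (s *\<^sub>R n + t *\<^sub>R d))) \<le> B * (\<rho> - (-\<rho>))"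
    by (rule integral_bound)
      (use assms(4,5) in \<open>auto intro!: continuous_intros continuous_on_compose2[OF assms(2)]\<close>)
  moreover have "slice d n f s = integral {-\<rho>..\<rho>} (\<lambda>t. f (s *\<^sub>R n + t *\<^sub>R d))"
    by (rule slice_eq_integral(2)[OF assms(1,2,3) order_refl])
  ultimately show ?thesis by simp
qed

lemma slice_lipschitz:
  assumes on: "orthonormal d n" and f: "smooth f" and van: "\<And>x. \<rho> < norm x \<Longrightarrow> f x = 0"
    and \<rho>: "0 \<le> \<rho>" and M: "\<And>x. \<bar>dirderiv n f x\<bar> \<le> M"
  shows "\<bar>slice d n f s - slice d n f s'\<bar> \<le> M * \<bar>s - s'\<bar> * (2 * \<rho>)"
proof -
  have pt: "\<bar>f (s *\<^sub>R n + t *\<^sub>R d) - f (s' *\<^sub>R n + t *\<^sub>R d)\<bar> \<le> M * \<bar>s - s'\<bar>" for t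
  proof -
    have "norm (f (t *\<^sub>R d + s *\<^sub>R n) - f (t *\<^sub>R d + s' *\<^sub>R n)) \<le> M * norm (s - s')"
      by (rule field_differentiable_bound[of UNIV "\<lambda>s. f (t *\<^sub>R d + s *\<^sub>R n)" "\<lambda>s. dirderiv n f (t *\<^sub>R d + s *\<^sub>R n)"])
        (use M has_derivative_affine_line[OF f] in auto)
    then show ?thesis by (simp add: add.commute)
  qed
  have c: "continuous_on {-\<rho>..\<rho>} (\<lambda>t. f (s *\<^sub>R n + t *\<^sub>R d))" for s
    by (intro continuous_on_smooth_compose[OF f] continuous_intros)
  have eq: "slice d n f s = integral {-\<rho>..\<rho>} (\<lambda>t. f (s *\<^sub>R n + t *\<^sub>R d))" for s
    by (rule slice_eq_integral(2)[OF on smooth_continuous[OF f] van order_refl])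
  have "slice d n f s - slice d n f s' =
      integral {-\<rho>..\<rho>} (\<lambda>t. f (s *\<^sub>R n + t *\<^sub>R d) - f (s' *\<^sub>R n + t *\<^sub>R d))"
    unfolding eq
    by (rule integral_diff[symmetric]) (intro integrable_continuous_interval c)+
  also have "norm \<dots> \<le> (M * \<bar>s - s'\<bar>) * (\<rho> - (-\<rho>))"
    by (rule integral_bound) (use \<rho> pt in \<open>auto intro!: continuous_intros c\<close>)
  finally show ?thesis by simp
qed

lemma continuous_on_slice:
  assumes on: "orthonormal d n" and f: "continuous_on UNIV f" and van: "\<And>x. \<rho> < norm x \<Longrightarrow> f x = 0"
  shows "continuous_on UNIV (slice d n f)"
proof -
  have "continuous_on (UNIV \<times> cbox (-\<rho>) \<rho>) (\<lambda>(s, t). f (s *\<^sub>R n + t *\<^sub>R d))"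
    unfolding split_beta by (rule continuous_on_compose2[OF f]) (auto intro!: continuous_intros)
  from integral_continuous_on_param[OF this]
  have "continuous_on UNIV (\<lambda>s. integral {-\<rho>..\<rho>} (\<lambda>t. f (s *\<^sub>R n + t *\<^sub>R d)))" by simp
  moreover have "slice d n f = (\<lambda>s. integral {-\<rho>..\<rho>} (\<lambda>t. f (s *\<^sub>R n + t *\<^sub>R d)))"
    by (rule ext, rule slice_eq_integral(2)[OF on f van order_refl])
  ultimately show ?thesis by simp
qed

lemma dilation_mean_vanish:
  assumes "\<And>x. \<rho> < norm x \<Longrightarrow> f x = 0" "\<rho> < norm x"
  shows "dilation_mean m f x = 0"
proof -
  have "f (t *\<^sub>R x) = 0" if "t \<in> {1..2}" for t
  proof (rule assms(1))
    have "1 * norm x \<le> \<bar>t\<bar> * norm x" using that by (intro mult_right_mono) auto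
    then show "\<rho> < norm (t *\<^sub>R x)" using assms(2) by simp
  qed
  then have "dilation_mean m f x = integral {1..2} (\<lambda>t::real. 0)"
    unfolding dilation_mean_def by (intro integral_cong) simp
  then show ?thesis by simp
qed

text \<open>For \<open>f = \<partial>\<^sub>n\<^sup>2 g\<close> the function \<open>dilation_mean 2 f\<close> is \<open>\<partial>\<^sub>n\<^sup>2\<close> of \<open>dilation_mean 0 g\<close>.  Its weight \<open>\<tau>\<close> is exactly
  the Jacobian of the dilation along the line, so no weight is left on the right.\<close>
lemma slice_dilation_mean:
  assumes on: "orthonormal d n" and f: "smooth f" and van: "\<And>x. \<rho> < norm x \<Longrightarrow> f x = 0" and \<rho>: "0 \<le> \<rho>"
  shows "slice d n (dilation_mean 2 f) s = integral {1..2} (\<lambda>\<tau>. slice d n f (\<tau> * s))"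
proof -
  have in1: "slice d n f (\<tau> * s) = integral {-\<rho>..\<rho>} (\<lambda>t. \<tau> * f (\<tau> *\<^sub>R (s *\<^sub>R n + t *\<^sub>R d)))"
    if "\<tau> \<in> {1..2}" for \<tau>
  proof -
    have "slice d n f (\<tau> * s) = \<tau> * (LINT t|lborel. f (\<tau> *\<^sub>R (s *\<^sub>R n + t *\<^sub>R d)))"
      unfolding slice_def using that
      by (subst lborel_integral_real_affine[of \<tau> _ 0]) (auto simp: algebra_simps)
    also have "(LINT t|lborel. f (\<tau> *\<^sub>R (s *\<^sub>R n + t *\<^sub>R d))) = slice d n (\<lambda>x. f (\<tau> *\<^sub>R x)) s"
      by (simp add: slice_def)
    also have "\<dots> = integral {-\<rho>..\<rho>} (\<lambda>t. f (\<tau> *\<^sub>R (s *\<^sub>R n + t *\<^sub>R d)))"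
    proof (rule slice_eq_integral(2)[OF on smooth_continuous[OF smooth_scale[OF f]] _ order_refl])
      fix x :: "real^2" assume x: "\<rho> < norm x"
      have "1 * norm x \<le> \<bar>\<tau>\<bar> * norm x" using that by (intro mult_right_mono) auto
      then show "f (\<tau> *\<^sub>R x) = 0" using x by (intro van) simp
    qed
    finally show ?thesis by simp
  qed
  have c: "continuous_on (cbox (-\<rho>, 1) (\<rho>, 2)) (\<lambda>(t, \<tau>). \<tau> * f (\<tau> *\<^sub>R (s *\<^sub>R n + t *\<^sub>R d)))"
    unfolding split_beta by (intro continuous_intros continuous_on_smooth_compose[OF f])
  have "slice d n (dilation_mean 2 f) s =
      integral {-\<rho>..\<rho>} (\<lambda>t. dilation_mean 2 f (s *\<^sub>R n + t *\<^sub>R d))"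
    by (rule slice_eq_integral(2)[OF on smooth_continuous[OF smooth_dilation_mean[OF f]] dilation_mean_vanish[OF van] order_refl])
  also have "\<dots> = integral {-\<rho>..\<rho>} (\<lambda>t. integral {1..2} (\<lambda>\<tau>. \<tau> * f (\<tau> *\<^sub>R (s *\<^sub>R n + t *\<^sub>R d))))"
    unfolding dilation_mean_def by (intro integral_cong) (simp add: power2_eq_square)
  also have "\<dots> = integral {1..2} (\<lambda>\<tau>. integral {-\<rho>..\<rho>} (\<lambda>t. \<tau> * f (\<tau> *\<^sub>R (s *\<^sub>R n + t *\<^sub>R d))))"
    using integral_swap_continuous[OF c] by simp
  also have "\<dots> = integral {1..2} (\<lambda>\<tau>. slice d n f (\<tau> * s))"
    by (intro integral_cong) (simp only: in1)
  finally show ?thesis .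
qed

text \<open>Subtracting the average cancels the slice through the origin; off the origin the Lipschitz bound is used with
  \<open>|s - \<tau>s| \<le> |s|\<close>.\<close>
lemma slice_dilation_defect:
  assumes on: "orthonormal d n" and f: "smooth f" and van: "\<And>x. \<rho> < norm x \<Longrightarrow> f x = 0"
    and \<rho>: "0 \<le> \<rho>" and M: "\<And>x. \<bar>dirderiv n f x\<bar> \<le> M" "0 \<le> M"
  shows "\<bar>slice d n f s - slice d n (dilation_mean 2 f) s\<bar> \<le> (if \<bar>s\<bar> \<le> \<rho> then M * \<bar>s\<bar> * (2 * \<rho>) else 0)"
proof (cases "\<bar>s\<bar> \<le> \<rho>")
  case True
  have c: "continuous_on {1..2} (\<lambda>\<tau>. slice d n f (\<tau> * s))"
    by (rule continuous_on_compose2[OF continuous_on_slice[OF on smooth_continuous[OF f] van]])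
      (auto intro!: continuous_intros)
  have "integral {1..2} (\<lambda>\<tau>. slice d n f s - slice d n f (\<tau> * s)) =
      integral {1..2} (\<lambda>\<tau>::real. slice d n f s) - integral {1..2} (\<lambda>\<tau>. slice d n f (\<tau> * s))"
    by (rule integral_diff) (auto intro!: integrable_continuous_interval c)
  then have "slice d n f s - slice d n (dilation_mean 2 f) s =
      integral {1..2} (\<lambda>\<tau>. slice d n f s - slice d n f (\<tau> * s))"
    by (simp add: slice_dilation_mean[OF on f van \<rho>])
  also have "norm \<dots> \<le> (M * \<bar>s\<bar> * (2 * \<rho>)) * (2 - 1)"
  proof (rule integral_bound, unfold real_norm_def)
    fix \<tau> :: real assume \<tau>: "\<tau> \<in> {1..2}"
    have "s - \<tau> * s = (1 - \<tau>) * s" by (simp add: algebra_simps)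
    then have "\<bar>s - \<tau> * s\<bar> = \<bar>1 - \<tau>\<bar> * \<bar>s\<bar>" by (simp add: abs_mult)
    also have "\<dots> \<le> 1 * \<bar>s\<bar>" using \<tau> by (intro mult_right_mono) auto
    finally have "M * \<bar>s - \<tau> * s\<bar> * (2 * \<rho>) \<le> M * \<bar>s\<bar> * (2 * \<rho>)"
      using M(2) \<rho> by (intro mult_right_mono[OF mult_left_mono]) auto
    then show "\<bar>slice d n f s - slice d n f (\<tau> * s)\<bar> \<le> M * \<bar>s\<bar> * (2 * \<rho>)"
      using slice_lipschitz[OF on f van \<rho> M(1), of s "\<tau> * s"] by linarith
  qed (auto intro!: continuous_intros c)
  finally show ?thesis using True by simp
next
  case False
  then have s: "\<rho> < \<bar>s\<bar>" by simp
  have "slice d n f s = 0" by (rule slice_outside[OF on van s])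
  moreover have "slice d n (dilation_mean 2 f) s = 0"
    by (rule slice_outside[OF on dilation_mean_vanish[OF van] s])
  ultimately show ?thesis using False by simp
qed

text \<open>Only the scales with \<open>2^(k+1) \<ge> |s|\<close> contribute.\<close>
lemma geometric_sum_bound:
  "(\<Sum>k\<in>{1..K}. if \<bar>s\<bar> \<le> 2 ^ (k + 1) then \<bar>s\<bar> / 2 ^ k else 0) \<le> (4::real)"
proof -
  have "(\<Sum>k\<in>{1..K}. if \<bar>s\<bar> \<le> 2 ^ (k + 1) then \<bar>s\<bar> / 2 ^ k else 0)
     \<le> (if \<bar>s\<bar> \<le> 2 ^ (K + 1) then 4 - \<bar>s\<bar> / 2 ^ K else 0)"
  \<comment> \<open>The strengthened bound keeps the missing tail \<open>|s| / 2\<^sup>K\<close> of the geometric series.\<close>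
  proof (induction K)
    case 0
    then show ?case by auto
  next
    case (Suc K)
    let ?g = "\<lambda>k. if \<bar>s\<bar> \<le> 2 ^ (k + 1) then \<bar>s\<bar> / 2 ^ k else 0"
    have sum: "(\<Sum>k\<in>{1..Suc K}. ?g k) = (\<Sum>k\<in>{1..K}. ?g k) + ?g (Suc K)" by simp
    have mono: "(2::real) ^ (K + 1) \<le> 2 ^ (Suc K + 1)" by simp
    have half: "\<bar>s\<bar> / 2 ^ K = 2 * (\<bar>s\<bar> / 2 ^ Suc K)" by simp
    consider "\<bar>s\<bar> \<le> 2 ^ (K + 1)" | "2 ^ (K + 1) < \<bar>s\<bar>" "\<bar>s\<bar> \<le> 2 ^ (Suc K + 1)" | "2 ^ (Suc K + 1) < \<bar>s\<bar>"
      by linarith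
    then show ?case
    proof cases
      case 1
      then have 2: "\<bar>s\<bar> \<le> 2 ^ (Suc K + 1)" using mono by linarith
      show ?thesis using Suc unfolding sum if_P[OF 1] if_P[OF 2] half by linarith
    next
      case 2
      then have "\<bar>s\<bar> / 2 ^ Suc K \<le> 2" by (simp add: field_simps)
      moreover have "\<not> \<bar>s\<bar> \<le> 2 ^ (K + 1)" using 2 by linarith
      ultimately show ?thesis using Suc unfolding sum if_P[OF 2(2)] by simp
    next
      case 3
      then have "\<not> \<bar>s\<bar> \<le> 2 ^ (K + 1)" "\<not> \<bar>s\<bar> \<le> 2 ^ (Suc K + 1)" using mono by linarith+
      then show ?thesis using Suc unfolding sum by simp
    qed
  qed
  also have "\<dots> \<le> 4" by simp
  finally show ?thesis .
qed

section \<open>Derivative bounds from the Kohn-Nirenberg norm\<close>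

lemma Cc_smoothD: "f \<in> Cc_smooth \<Longrightarrow> smooth f" "f \<in> Cc_smooth \<Longrightarrow> compact (supp f)"
  by (auto simp: Cc_smooth_def smooth_def)

lemma notin_supp: "x \<notin> supp f \<Longrightarrow> f x = 0"
  using closure_subset[of "{x. f x \<noteq> 0}"] by (auto simp: supp_def)

lemma Cc_smoothI:
  assumes "smooth f" "\<And>x. \<rho> < norm x \<Longrightarrow> f x = 0"
  shows "f \<in> Cc_smooth"
proof -
  have "supp f \<subseteq> cball 0 \<rho>"
    unfolding supp_def
  proof (rule closure_minimal)
    show "{x. f x \<noteq> 0} \<subseteq> cball 0 \<rho>" using assms(2) by (force simp: not_le)
  qed simp
  then have "bounded (supp f)" using bounded_cball bounded_subset by blast
  then have "compact (supp f)" by (simp add: compact_eq_bounded_closed supp_def)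
  then show ?thesis using assms(1) by (simp add: Cc_smooth_def smooth_def)
qed

lemma Cc_smooth_vanish:
  assumes "f \<in> Cc_smooth"
  obtains \<rho> where "0 \<le> \<rho>" "\<And>x. \<rho> < norm x \<Longrightarrow> f x = 0"
proof -
  have "bounded (supp f)" using Cc_smoothD(2)[OF assms] by (rule compact_imp_bounded)
  then obtain \<rho> where \<rho>: "\<forall>x\<in>supp f. norm x \<le> \<rho>" unfolding bounded_iff by blast
  show ?thesis
  proof (rule that[of "max 0 \<rho>"])
    fix x :: "real^2" assume "max 0 \<rho> < norm x"
    then show "f x = 0" using \<rho> by (intro notin_supp) force
  qed simp
qed

lemma partial_deriv_dirderiv: "partial_deriv i f = dirderiv (axis i 1) f"
  using exhaust_2[of i] by (auto simp: fun_eq_iff dirderiv_def axis_def)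

lemma partial_deriv_commute:
  "smooth f \<Longrightarrow> partial_deriv i (partial_deriv j f) = partial_deriv j (partial_deriv i f)"
  by (simp add: fun_eq_iff partial_deriv_dirderiv dirderiv_commute)

text \<open>The multiindex derivatives apply all second-coordinate derivatives first, whereas directional derivatives
  produce third partial derivatives in every order.\<close>
lemma third_partial_multi_deriv:
  assumes "smooth f"
  obtains \<gamma> where "multi_order \<gamma> = 3"
    "partial_deriv l (partial_deriv i (partial_deriv j f)) = multi_deriv \<gamma> f"
proof -
  note c = partial_deriv_commute[OF assms, of 2 1]
    partial_deriv_commute[OF smooth_partial_deriv[OF assms], of 2 1]
  have cases: "l = 1 \<or> l = 2" "i = 1 \<or> i = 2" "j = 1 \<or> j = 2" using exhaust_2 by auto
  have "\<exists>\<gamma>\<in>{(3,0),(2,1),(1,2),(0,3)}.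
      partial_deriv l (partial_deriv i (partial_deriv j f)) = multi_deriv \<gamma> f"
    using cases by (elim disjE) (simp_all add: multi_deriv_def c numeral_3_eq_3 numeral_2_eq_2)
  then obtain \<gamma> where \<gamma>: "\<gamma> \<in> {(3,0),(2,1),(1,2),(0,3)}"
    and eq: "partial_deriv l (partial_deriv i (partial_deriv j f)) = multi_deriv \<gamma> f" by blast
  show ?thesis by (rule that[OF _ eq]) (use \<gamma> in \<open>auto simp: multi_order_def\<close>)
qed

lemma smooth_multi_deriv:
  assumes "smooth f" "\<And>x. \<rho> < norm x \<Longrightarrow> f x = 0"
  shows "smooth (multi_deriv \<gamma> f)" "\<rho> < norm x \<Longrightarrow> multi_deriv \<gamma> f x = 0"
proof -
  have *: "smooth ((partial_deriv i ^^ m) g) \<and> (\<forall>x. \<rho> < norm x \<longrightarrow> (partial_deriv i ^^ m) g x = 0)"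
    if "smooth g" "\<forall>x. \<rho> < norm x \<longrightarrow> g x = 0" for i m g
  proof (induction m)
    case 0
    then show ?case using that by simp
  next
    case (Suc m)
    then have IH: "smooth ((partial_deriv i ^^ m) g)" "\<And>x. \<rho> < norm x \<Longrightarrow> (partial_deriv i ^^ m) g x = 0"
      by auto
    have "partial_deriv i ((partial_deriv i ^^ m) g) x = 0" if "\<rho> < norm x" for x
      by (subst partial_deriv_dirderiv) (rule dirderiv_vanish[OF IH(2) that])
    then show ?case using smooth_partial_deriv[OF IH(1)] by simp
  qed
  have "smooth (multi_deriv \<gamma> f) \<and> (\<forall>x. \<rho> < norm x \<longrightarrow> multi_deriv \<gamma> f x = 0)"
    unfolding multi_deriv_def using assms by (intro * conjunct1[OF *] conjunct2[OF *]) auto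
  then show "smooth (multi_deriv \<gamma> f)" "\<rho> < norm x \<Longrightarrow> multi_deriv \<gamma> f x = 0" by auto
qed

lemma S13_norm_multi_deriv_bound:
  assumes f: "f \<in> Cc_smooth" and C: "S13_norm f \<le> C" and \<gamma>: "multi_order \<gamma> = 3"
  shows "(1 + (norm x)\<^sup>2) * \<bar>multi_deriv \<gamma> f x\<bar> \<le> C"
proof -
  define F where "F \<gamma> x = \<bar>japanese_bracket x powi (int (multi_order \<gamma>) - 1) * multi_deriv \<gamma> f x\<bar>" for \<gamma> x
  obtain \<rho> where \<rho>: "\<And>x. \<rho> < norm x \<Longrightarrow> f x = 0" using Cc_smooth_vanish[OF f] by blast
  note md = smooth_multi_deriv[OF Cc_smoothD(1)[OF f] \<rho>]
  have F: "F \<gamma> x = (1 + (norm x)\<^sup>2) * \<bar>multi_deriv \<gamma> f x\<bar>" for x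
    by (simp add: F_def \<gamma> japanese_bracket_def abs_mult)
  have cont: "continuous_on UNIV (F \<gamma>)"
    unfolding F by (intro continuous_intros smooth_continuous md)
  have van: "F \<gamma> x = 0" if "\<rho> < norm x" for x unfolding F using md(2)[OF _ that] by simp
  obtain B where "\<And>x. \<bar>F \<gamma> x\<bar> \<le> B" using bounded_of_support[OF cont van] by blast
  then have "bdd_above (range (F \<gamma>))" by (intro bdd_aboveI2[of _ _ B]) (simp add: abs_le_iff)
  then have "F \<gamma> x \<le> (SUP x. F \<gamma> x)" by (intro cSUP_upper) auto
  also have "\<dots> \<le> (MAX \<gamma>\<in>{\<gamma>. multi_order \<gamma> \<le> 3}. SUP x. F \<gamma> x)"
  proof (rule Max_ge)
    have "{\<gamma>. multi_order \<gamma> \<le> 3} \<subseteq> {..3} \<times> {..3}" by (auto simp: multi_order_def)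
    then have "finite {\<gamma>. multi_order \<gamma> \<le> 3}" by (rule finite_subset) auto
    then show "finite ((\<lambda>\<gamma>. SUP x. F \<gamma> x) ` {\<gamma>. multi_order \<gamma> \<le> 3})" by simp
  qed (use \<gamma> in auto)
  also have "\<dots> \<le> C" using C by (simp add: S13_norm_def F_def)
  finally show ?thesis by (simp add: F)
qed

lemma dirderiv_bound:
  assumes "norm n = 1" "\<And>i. \<bar>partial_deriv i f x\<bar> \<le> M"
  shows "\<bar>dirderiv n f x\<bar> \<le> 2 * M"
proof -
  have "\<bar>n $ i * partial_deriv i f x\<bar> \<le> 1 * M" for i
    unfolding abs_mult using component_le_norm_cart[of n i] assms by (intro mult_mono) auto
  from this[of 1] this[of 2] show ?thesis by (auto simp: dirderiv_def intro: order_trans[OF abs_triangle_ineq])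
qed

lemma partial_dirderiv_commute:
  "smooth f \<Longrightarrow> partial_deriv i (dirderiv n f) x = dirderiv n (partial_deriv i f) x"
  by (simp add: partial_deriv_dirderiv dirderiv_commute)

lemma dirderiv2_bound:
  assumes f: "smooth f" and n: "norm n = 1"
    and M: "\<And>i j. \<bar>partial_deriv i (partial_deriv j f) x\<bar> \<le> M"
  shows "\<bar>dirderiv n (dirderiv n f) x\<bar> \<le> 4 * M"
proof -
  have "\<bar>dirderiv n (dirderiv n f) x\<bar> \<le> 2 * (2 * M)"
    by (rule dirderiv_bound[OF n], unfold partial_dirderiv_commute[OF f], rule dirderiv_bound[OF n M])
  then show ?thesis by simp
qed

lemma dirderiv3_bound:
  assumes f: "smooth f" and n: "norm n = 1"
    and M: "\<And>l i j. \<bar>partial_deriv l (partial_deriv i (partial_deriv j f)) x\<bar> \<le> M"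
  shows "\<bar>dirderiv n (dirderiv n (dirderiv n f)) x\<bar> \<le> 8 * M"
proof -
  have "partial_deriv i (dirderiv n f) = dirderiv n (partial_deriv i f)" for i
    using partial_dirderiv_commute[OF f] by blast
  then have "\<bar>partial_deriv i (dirderiv n (dirderiv n f)) x\<bar> \<le> 4 * M" for i
    using dirderiv2_bound[OF smooth_partial_deriv[OF f] n M, of i]
    by (simp add: partial_dirderiv_commute[OF smooth_dirderiv[OF f]])
  then have "\<bar>dirderiv n (dirderiv n (dirderiv n f)) x\<bar> \<le> 2 * (4 * M)"
    by (rule dirderiv_bound[OF n])
  then show ?thesis by simp
qed

section \<open>The growth condition\<close>

text \<open>The restriction of \<open>f / |x|\<^sup>2\<close> to the line through the origin in the unit direction \<open>d\<close>.  Replacing \<open>|t|\<close> by \<open>max 1 |t|\<close>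
  changes nothing when \<open>f\<close> vanishes on the unit disc, and makes continuity evident.\<close>
definition radial_profile :: "(real^2 \<Rightarrow> real) \<Rightarrow> real^2 \<Rightarrow> real \<Rightarrow> real" where
  "radial_profile f d t = f (t *\<^sub>R d) / (max 1 \<bar>t\<bar>)\<^sup>2"

lemma radial_profile_props:
  assumes f: "smooth f" and van: "\<And>x. b < norm x \<Longrightarrow> f x = 0" and d: "norm d = 1"
  shows "continuous_on UNIV (radial_profile f d)" "b < \<bar>t\<bar> \<Longrightarrow> radial_profile f d t = 0"
    "integrable lborel (radial_profile f d)"
proof -
  show c: "continuous_on UNIV (radial_profile f d)"
    unfolding radial_profile_def
    by (intro continuous_intros continuous_on_smooth_compose[OF f]) auto
  show v: "b < \<bar>t\<bar> \<Longrightarrow> radial_profile f d t = 0" for t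
    using van[of "t *\<^sub>R d"] d by (simp add: radial_profile_def)
  show "integrable lborel (radial_profile f d)"
    by (rule LINT_compact_support(1)[OF c v])
qed

lemma xray_INF_bound:
  assumes f: "smooth f" and neg: "\<And>x. f x \<le> 0"
    and out: "\<And>x. b < norm x \<Longrightarrow> f x = 0" and ins: "\<And>x. norm x < 1 \<Longrightarrow> f x = 0" and b: "0 \<le> b"
  defines "q \<equiv> - (INF \<theta>. xray (\<lambda>x. f x / (norm x)\<^sup>2) 0 \<theta>)"
  shows "norm d = 1 \<Longrightarrow> - q \<le> (LINT t|lborel. radial_profile f d t)" and "0 \<le> q"
proof -
  define e :: "real \<Rightarrow> real^2" where "e \<theta> = vector [cos \<theta>, sin \<theta>]" for \<theta>
  have ne: "norm (e \<theta>) = 1" for \<theta>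
    by (simp add: e_def norm_eq_1 inner_vec_def sum_2 power2_eq_square[symmetric])
  have prof: "f x / (norm x)\<^sup>2 = f x / (max 1 (norm x))\<^sup>2" for x
    using ins[of x] by (cases "norm x < 1") (auto simp: max_def)
  have x: "xray (\<lambda>x. f x / (norm x)\<^sup>2) 0 \<theta> = (LINT t|lborel. radial_profile f (e \<theta>) t)" for \<theta>
  proof -
    have "vector [t * cos \<theta> - 0 * sin \<theta>, t * sin \<theta> + 0 * cos \<theta>] = t *\<^sub>R e \<theta>" for t
      by (simp add: e_def vec_eq_iff forall_2)
    then show ?thesis by (simp add: xray_def prof radial_profile_def ne)
  qed
  obtain B where B: "0 \<le> B" "\<And>x. \<bar>f x\<bar> \<le> B"
    by (rule bounded_of_support[OF smooth_continuous[OF f] out]) auto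
  have lb: "- (B * (b - (-b))) \<le> (LINT t|lborel. radial_profile f (e \<theta>) t)" for \<theta>
  proof -
    have p1: "continuous_on UNIV (radial_profile f (e \<theta>))"
      by (rule radial_profile_props(1)[OF f out ne])
    have p2: "radial_profile f (e \<theta>) t = 0" if "b < \<bar>t\<bar>" for t
      by (rule radial_profile_props(2)[OF f out ne that])
    have "norm (integral {-b..b} (radial_profile f (e \<theta>))) \<le> B * (b - (-b))"
    proof (rule integral_bound)
      fix t
      have "\<bar>f (t *\<^sub>R e \<theta>)\<bar> / (max 1 \<bar>t\<bar>)\<^sup>2 \<le> B / 1"
        using B by (intro frac_le) auto
      then show "norm (radial_profile f (e \<theta>) t) \<le> B" by (simp add: radial_profile_def)
    qed (use b continuous_on_subset[OF p1] in auto)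
    moreover have "(LINT t|lborel. radial_profile f (e \<theta>) t) = integral {-b..b} (radial_profile f (e \<theta>))"
      by (rule LINT_compact_support(2)[OF p1 p2])
    ultimately show ?thesis by simp
  qed
  have bdd: "bdd_below (range (\<lambda>\<theta>. xray (\<lambda>x. f x / (norm x)\<^sup>2) 0 \<theta>))"
    unfolding x using lb by (intro bdd_belowI2)
  have q: "- q \<le> (LINT t|lborel. radial_profile f (e \<theta>) t)" for \<theta>
    unfolding q_def x[symmetric] using cINF_lower[OF bdd, of \<theta>] by simp
  show "- q \<le> (LINT t|lborel. radial_profile f d t)" if "norm d = 1"
  proof -
    have "(d$1)\<^sup>2 + (d$2)\<^sup>2 = 1" using that by (simp add: norm_eq_1 inner_vec_def sum_2 power2_eq_square)
    then obtain \<theta> where "d$1 = cos \<theta>" "d$2 = sin \<theta>" using sincos_total_2pi by metis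
    then have "d = e \<theta>" by (simp add: e_def vec_eq_iff forall_2)
    then show ?thesis using q by simp
  qed
  have "0 \<le> (LINT t|lborel. - radial_profile f (e 0) t)"
    by (rule Bochner_Integration.integral_nonneg)
      (use neg in \<open>auto simp: radial_profile_def divide_nonpos_nonneg\<close>)
  then show "0 \<le> q" using q[of 0] by simp
qed

text \<open>A pointwise bound from integrals over lines through the origin.  On the ray through \<open>x\<close> the dilation average is a radial integral of \<open>f\<close> over
  radii comparable to \<open>|x|\<close>, so \<open>|t|\<^sup>-\<^sup>2\<close> may be inserted at the cost of \<open>(4a)\<^sup>2\<close>.\<close>
lemma dilation_mean_lower_bound:
  assumes f: "smooth f" and neg: "\<And>x. f x \<le> 0"
    and out: "\<And>x. 4 * a < norm x \<Longrightarrow> f x = 0" and ins: "\<And>x. norm x < a \<Longrightarrow> f x = 0" and a: "1 \<le> a"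
    and q: "\<And>d. norm d = 1 \<Longrightarrow> - q \<le> (LINT t|lborel. radial_profile f d t)" "0 \<le> q"
  shows "- (32 * a * q) \<le> dilation_mean 0 f x"
proof (cases "norm x < a / 2")
  case True
  have "dilation_mean 0 f x = integral {1..2} (\<lambda>t::real. 0)"
    unfolding dilation_mean_def
  proof (intro integral_cong)
    fix t :: real assume t: "t \<in> {1..2}"
    have "\<bar>t\<bar> * norm x \<le> 2 * norm x" using t by (intro mult_right_mono) auto
    then show "t ^ 0 / t * f (t *\<^sub>R x) = 0" using True ins[of "t *\<^sub>R x"] by simp
  qed
  then show ?thesis using a q by simp
next
  case False
  define r d where "r = norm x" and "d = x /\<^sub>R norm x"
  have r: "r > 0" "a / 2 \<le> r" using False a by (auto simp: r_def)
  then have d: "norm d = 1" "x = r *\<^sub>R d" by (auto simp: d_def r_def)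
  note p = radial_profile_props[OF f out d(1)]
  define R where "R = max 2 (4 * a / r)"
  have c: "continuous_on UNIV (\<lambda>t. - radial_profile f d (r * t))"
    by (intro continuous_intros continuous_on_compose2[OF p(1)]) auto
  have v: "- radial_profile f d (r * t) = 0" if "R < \<bar>t\<bar>" for t
  proof -
    have "4 * a / r < \<bar>t\<bar>" using that by (simp add: R_def)
    then have "4 * a < \<bar>r * t\<bar>" using r(1) by (simp add: abs_mult field_simps)
    then show ?thesis using p(2) by simp
  qed
  have nonneg: "0 \<le> - radial_profile f d t" for t
    using neg by (simp add: radial_profile_def divide_nonpos_nonneg)
  have "- dilation_mean 0 f x = integral {1..2} (\<lambda>t. - (t ^ 0 / t * f (t *\<^sub>R x)))"
    unfolding dilation_mean_def by simp
  also have "\<dots> \<le> integral {1..2} (\<lambda>t. (4 * a)\<^sup>2 * (- radial_profile f d (r * t)))"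
  proof (rule integral_le)
    show "(\<lambda>t. - (t ^ 0 / t * f (t *\<^sub>R x))) integrable_on {1..2}"
      by (intro integrable_continuous_interval continuous_intros continuous_on_smooth_compose[OF f]) auto
    show "(\<lambda>t. (4 * a)\<^sup>2 * - radial_profile f d (r * t)) integrable_on {1..2}"
      by (intro integrable_continuous_interval continuous_on_mult continuous_on_const continuous_on_subset[OF c]) auto
    fix t :: real assume t: "t \<in> {1..2}"
    define y where "y = t *\<^sub>R x"
    have y: "y = (r * t) *\<^sub>R d" by (simp add: y_def d(2))
    have "- f y / t \<le> - f y / 1" using t neg[of y] by (intro divide_left_mono) auto
    also have "\<dots> \<le> (4 * a)\<^sup>2 * (- f y / (max 1 \<bar>r * t\<bar>)\<^sup>2)"
    proof (cases "f y = 0")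
      case False
      then have "norm y \<le> 4 * a" using out[of y] by force
      then have "max 1 \<bar>r * t\<bar> \<le> 4 * a" using a d(1) by (simp add: y)
      then have "(max 1 \<bar>r * t\<bar>)\<^sup>2 \<le> (4 * a)\<^sup>2" by (intro power_mono) auto
      then have "- f y * (max 1 \<bar>r * t\<bar>)\<^sup>2 \<le> - f y * (4 * a)\<^sup>2" using neg[of y] by (intro mult_left_mono) auto
      moreover have "0 < (max 1 \<bar>r * t\<bar>)\<^sup>2" by (rule zero_less_power) (simp add: less_max_iff_disj)
      ultimately have "- f y \<le> (- f y * (4 * a)\<^sup>2) / (max 1 \<bar>r * t\<bar>)\<^sup>2" by (simp only: pos_le_divide_eq)
      also have "\<dots> = (4 * a)\<^sup>2 * (- f y / (max 1 \<bar>r * t\<bar>)\<^sup>2)"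
        by (simp only: times_divide_eq_right mult.commute)
      finally show ?thesis by simp
    qed simp
    finally show "- (t ^ 0 / t * f (t *\<^sub>R x)) \<le> (4 * a)\<^sup>2 * (- radial_profile f d (r * t))"
      by (simp add: radial_profile_def y[symmetric] y_def)
  qed
  also have "\<dots> = (4 * a)\<^sup>2 * integral {1..2} (\<lambda>t. - radial_profile f d (r * t))" by simp
  also have "\<dots> \<le> (4 * a)\<^sup>2 * integral {-R..R} (\<lambda>t. - radial_profile f d (r * t))"
    by (intro mult_left_mono integral_subset_le integrable_continuous_interval continuous_on_subset[OF c])
      (use nonneg in \<open>auto simp: R_def\<close>)
  also have "\<dots> \<le> (4 * a)\<^sup>2 * (q / (a / 2))"
  proof (intro mult_left_mono)
    have "integral {-R..R} (\<lambda>t. - radial_profile f d (r * t)) = (LINT t|lborel. - radial_profile f d (r * t))"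
      by (rule LINT_compact_support(2)[OF c v, symmetric])
    also have "\<dots> = (LINT t|lborel. - radial_profile f d t) / r"
      using r(1) by (subst lborel_integral_real_affine[of r "\<lambda>t. - radial_profile f d t" 0]) auto
    also have "\<dots> \<le> q / (a / 2)"
      using q(1)[OF d(1)] q(2) r a by (intro frac_le) auto
    finally show "integral {-R..R} (\<lambda>t. - radial_profile f d (r * t)) \<le> q / (a / 2)" .
  qed simp
  also have "\<dots> = 32 * a * q" using a by (simp add: power2_eq_square)
  finally show ?thesis by simp
qed

section \<open>Construction of the minorant\<close>

text \<open>One summand of the minorant, with \<open>\<beta>\<close> the bump function: its line integrals of second normal derivatives are bounded
  below by a term summable over the scales and a term controlled by \<open>q\<close>.\<close>
lemma modified_piece_slice_bound:
  fixes f \<beta> :: "real^2 \<Rightarrow> real" and k :: nat and q :: real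
  assumes on: "orthonormal d n" and f: "f \<in> Cc_smooth"
    and supp: "supp f \<subseteq> {x. 2 ^ (k - 1) \<le> norm x \<and> norm x \<le> 2 ^ (k + 1)}" and k: "k \<ge> 1"
    and C: "S13_norm f \<le> C"
    and b: "smooth \<beta>" "\<And>x. 3 < norm x \<Longrightarrow> \<beta> x = 0" "\<And>n x. norm n = 1 \<Longrightarrow> \<bar>dirderiv n (dirderiv n \<beta>) x\<bar> \<le> B" "0 \<le> B"
    and q: "0 \<le> q"
  defines "p \<equiv> \<lambda>x. f x - dilation_mean 0 f x - 16 * 2 ^ k * q * \<beta> ((1 / 2 ^ k) *\<^sub>R x)"
  shows "smooth p" "\<And>x. 4 * 2 ^ k < norm x \<Longrightarrow> p x = 0"
    "- (128 * C * (if \<bar>s\<bar> \<le> 2 ^ (k + 1) then \<bar>s\<bar> / 2 ^ k else 0) + 96 * B * q)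
       \<le> slice d n (dirderiv n (dirderiv n p)) s"
proof -
  note sf = Cc_smoothD(1)[OF f]
  have n1: "norm n = 1" using on by (simp add: orthonormal_def)
  have van: "f x = 0" if "2 ^ (k + 1) < norm x" for x
    using supp that by (intro notin_supp) auto
  have ins: "f x = 0" if "norm x < 2 ^ (k - 1)" for x
    using supp that by (intro notin_supp) auto
  define c :: real where "c = 1 / 2 ^ k"
  define h where "h = dirderiv n (dirderiv n f)"
  define w where "w x = 16 * 2 ^ k * q * \<beta> (c *\<^sub>R x)" for x
  have sw: "smooth w" unfolding w_def by (intro smooth_cmult smooth_scale b)
  have p: "p = (\<lambda>x. (f x - dilation_mean 0 f x) - w x)" by (simp add: p_def w_def c_def)
  have wvan: "w x = 0" if "3 * 2 ^ k < norm x" for x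
  proof -
    have "3 < norm (c *\<^sub>R x)" using that by (simp add: c_def field_simps)
    then show ?thesis by (simp add: w_def b)
  qed
  show "smooth p" unfolding p by (intro smooth_diff smooth_dilation_mean sf sw)
  show "p x = 0" if "4 * 2 ^ k < norm x" for x
  proof -
    have "(0::real) < 2 ^ k" by simp
    then have 1: "2 ^ (k + 1) < norm x" "3 * 2 ^ k < norm x" using that by (simp_all, linarith+)
    show ?thesis
    proof -
      have "dilation_mean 0 f x = 0" by (rule dilation_mean_vanish[OF van 1(1)])
      then show ?thesis using van[OF 1(1)] wvan[OF 1(2)] by (simp add: p)
    qed
  qed
  have h: "smooth h" unfolding h_def by (intro smooth_dirderiv sf)
  have hvan: "h x = 0" if "2 ^ (k + 1) < norm x" for x
    unfolding h_def by (rule dirderiv_vanish[OF dirderiv_vanish[OF van] that])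
  have D2p: "dirderiv n (dirderiv n p) = (\<lambda>x. (h x - dilation_mean 2 h x) - dirderiv n (dirderiv n w) x)"
    unfolding p h_def
    by (simp add: dirderiv_diff dirderiv_dilation_mean smooth_diff smooth_dilation_mean smooth_dirderiv sf sw numeral_2_eq_2)
  have D2w: "dirderiv n (dirderiv n w) x = 16 * 2 ^ k * q * (c * (c * dirderiv n (dirderiv n \<beta>) (c *\<^sub>R x)))" for x
    unfolding w_def
    by (simp add: dirderiv_cmult dirderiv_scale smooth_cmult smooth_scale smooth_dirderiv b)
  have dhvan: "dilation_mean 2 h x = 0" if "2 ^ (k + 1) < norm x" for x
    by (rule dilation_mean_vanish[OF hvan that])
  have int1: "integrable lborel (\<lambda>t. h (s *\<^sub>R n + t *\<^sub>R d))"
    by (rule slice_eq_integral(1)[OF on smooth_continuous[OF h] hvan order_refl])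
  have int2: "integrable lborel (\<lambda>t. dilation_mean 2 h (s *\<^sub>R n + t *\<^sub>R d))"
    by (rule slice_eq_integral(1)[OF on smooth_continuous[OF smooth_dilation_mean[OF h]] dhvan order_refl])
  note sw2 = smooth_dirderiv[OF smooth_dirderiv[OF sw]]
  have w2van: "dirderiv n (dirderiv n w) x = 0" if "3 * 2 ^ k < norm x" for x
    by (rule dirderiv_vanish[OF dirderiv_vanish[OF wvan] that])
  have int3: "integrable lborel (\<lambda>t. dirderiv n (dirderiv n w) (s *\<^sub>R n + t *\<^sub>R d))"
    by (rule slice_eq_integral(1)[OF on smooth_continuous[OF sw2] w2van order_refl])
  have split: "slice d n (dirderiv n (dirderiv n p)) s =
      (slice d n h s - slice d n (dilation_mean 2 h) s) - slice d n (dirderiv n (dirderiv n w)) s"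
    unfolding D2p using int1 int2 int3 by (simp add: slice_def)
  \<comment> \<open>On the support \<open>|x| \<ge> 2^(k-1)\<close>, so the weight \<open>1 + |x|\<^sup>2\<close> of the norm is at least \<open>4\<^sup>k / 4\<close>.\<close>
  have third: "\<bar>partial_deriv l (partial_deriv i (partial_deriv j f)) x\<bar> \<le> 4 * C / 4 ^ k" for l i j x
  proof (cases "norm x < 2 ^ (k - 1)")
    case True
    have 1: "dirderiv a g x = 0" if "\<And>x. norm x < 2 ^ (k - 1) \<Longrightarrow> g x = 0" "norm x < 2 ^ (k - 1)" for g a x
      by (rule dirderiv_eq_0_open[where S="{x. norm x < 2 ^ (k - 1)}"])
        (use that in \<open>auto intro!: open_Collect_less continuous_intros\<close>)
    have "partial_deriv l (partial_deriv i (partial_deriv j f)) x = 0"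
      unfolding partial_deriv_dirderiv by (rule 1[OF 1[OF 1[OF ins]] True])
    moreover have "0 \<le> C"
      using S13_norm_multi_deriv_bound[OF f C, of "(3,0)" 0] by (auto simp: multi_order_def intro: order_trans[rotated])
    ultimately show ?thesis by simp
  next
    case False
    obtain \<gamma> where \<gamma>: "multi_order \<gamma> = 3"
      "partial_deriv l (partial_deriv i (partial_deriv j f)) = multi_deriv \<gamma> f"
      using third_partial_multi_deriv[OF sf] .
    have "(4::real) ^ k / 4 = (2 ^ (k - 1))\<^sup>2"
    proof -
      obtain m where "k = Suc m" using k by (cases k) auto
      then show ?thesis by (simp add: power_mult[symmetric] power2_eq_square power_mult_distrib[symmetric])
    qed
    also have "\<dots> \<le> (norm x)\<^sup>2" using False by (intro power_mono) auto
    finally have "4 ^ k / 4 \<le> 1 + (norm x)\<^sup>2" by simp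
    then have "4 ^ k / 4 * \<bar>multi_deriv \<gamma> f x\<bar> \<le> (1 + (norm x)\<^sup>2) * \<bar>multi_deriv \<gamma> f x\<bar>"
      by (intro mult_right_mono) auto
    also have "\<dots> \<le> C" by (rule S13_norm_multi_deriv_bound[OF f C \<gamma>(1)])
    finally show ?thesis by (simp add: \<gamma>(2) field_simps)
  qed
  have M: "\<bar>dirderiv n h x\<bar> \<le> 8 * (4 * C / 4 ^ k)" for x
    unfolding h_def by (rule dirderiv3_bound[OF sf n1 third])
  have M0: "0 \<le> 8 * (4 * C / 4 ^ k)" using order_trans[OF abs_ge_zero M] .
  have "\<bar>slice d n h s - slice d n (dilation_mean 2 h) s\<bar> \<le>
      (if \<bar>s\<bar> \<le> 2 ^ (k + 1) then 8 * (4 * C / 4 ^ k) * \<bar>s\<bar> * (2 * 2 ^ (k + 1)) else 0)"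
    by (rule slice_dilation_defect[OF on h hvan _ M M0]) simp_all
  also have "8 * (4 * C / 4 ^ k) * \<bar>s\<bar> * (2 * 2 ^ (k + 1)) = 128 * C * (\<bar>s\<bar> / 2 ^ k)"
  proof -
    have "(4::real) ^ k = 2 ^ k * 2 ^ k" by (simp add: power_mult_distrib[symmetric])
    then show ?thesis by simp
  qed
  finally have A: "\<bar>slice d n h s - slice d n (dilation_mean 2 h) s\<bar> \<le>
     128 * C * (if \<bar>s\<bar> \<le> 2 ^ (k + 1) then \<bar>s\<bar> / 2 ^ k else 0)" by (simp split: if_splits)
  have "\<bar>slice d n (dirderiv n (dirderiv n w)) s\<bar> \<le> (16 * q * B / 2 ^ k) * (2 * (3 * 2 ^ k))"
  proof (rule slice_bound[OF on smooth_continuous[OF sw2] w2van])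
    fix x
    have "\<bar>dirderiv n (dirderiv n w) x\<bar> = 16 * q / 2 ^ k * \<bar>dirderiv n (dirderiv n \<beta>) (c *\<^sub>R x)\<bar>"
      using q by (simp add: D2w abs_mult c_def)
    also have "\<dots> \<le> 16 * q / 2 ^ k * B" using q by (intro mult_left_mono b n1) auto
    finally show "\<bar>dirderiv n (dirderiv n w) x\<bar> \<le> 16 * q * B / 2 ^ k" by simp
  qed simp_all
  then have "\<bar>slice d n (dirderiv n (dirderiv n w)) s\<bar> \<le> 96 * B * q" by (simp add: mult_ac)
  with A show "- (128 * C * (if \<bar>s\<bar> \<le> 2 ^ (k + 1) then \<bar>s\<bar> / 2 ^ k else 0) + 96 * B * q)
       \<le> slice d n (dirderiv n (dirderiv n p)) s" unfolding split by linarith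
qed

lemma modified_piece_le:
  fixes f \<beta> :: "real^2 \<Rightarrow> real" and k :: nat
  assumes f: "f \<in> Cc_smooth" and neg: "\<And>x. f x \<le> 0"
    and supp: "supp f \<subseteq> {x. 2 ^ (k - 1) \<le> norm x \<and> norm x \<le> 2 ^ (k + 1)}" and k: "k \<ge> 1"
    and b: "\<And>x. 0 \<le> \<beta> x" "\<And>x. norm x \<le> 2 \<Longrightarrow> 1 \<le> \<beta> x"
  defines "q \<equiv> - (INF \<theta>. xray (\<lambda>x. f x / (norm x)\<^sup>2) 0 \<theta>)"
  shows "0 \<le> q" "f x - dilation_mean 0 f x - 16 * 2 ^ k * q * \<beta> ((1 / 2 ^ k) *\<^sub>R x) \<le> f x"
proof -
  note sf = Cc_smoothD(1)[OF f]
  define a :: real where "a = 2 ^ (k - 1)"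
  have a1: "1 \<le> a" by (simp add: a_def)
  have ak: "2 * a = 2 ^ k" using k by (cases k) (auto simp: a_def)
  have out: "f x = 0" if "4 * a < norm x" for x
    using supp that ak by (intro notin_supp) auto
  have ins: "f x = 0" if "norm x < a" for x
    using supp that by (intro notin_supp) (auto simp: a_def)
  have ins1: "f x = 0" if "norm x < 1" for x using ins a1 that by simp
  have a4: "0 \<le> 4 * a" using a1 by simp
  note x = xray_INF_bound[OF sf neg out ins1 a4, folded q_def]
  show q: "0 \<le> q" by (rule x(2))
  have low: "- (32 * a * q) \<le> dilation_mean 0 f x"
    by (rule dilation_mean_lower_bound[OF sf neg out ins a1 x(1) q])
  show "f x - dilation_mean 0 f x - 16 * 2 ^ k * q * \<beta> ((1 / 2 ^ k) *\<^sub>R x) \<le> f x"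
  proof (cases "4 * a < norm x")
    case True
    have "dilation_mean 0 f x = 0" by (rule dilation_mean_vanish[OF out True])
    then show ?thesis using b(1) q by simp
  next
    case False
    have "1 \<le> \<beta> ((1 / 2 ^ k) *\<^sub>R x)"
    proof (rule b(2))
      have "norm x \<le> 2 * 2 ^ k" using False ak by simp
      then show "norm ((1 / 2 ^ k) *\<^sub>R x) \<le> 2" by (simp add: field_simps)
    qed
    then have "16 * 2 ^ k * q * 1 \<le> 16 * 2 ^ k * q * \<beta> ((1 / 2 ^ k) *\<^sub>R x)"
      using q by (intro mult_left_mono) auto
    moreover have "32 * a * q = 16 * 2 ^ k * q" by (simp add: ak[symmetric])
    ultimately show ?thesis using low by linarith
  qed
qed

theorem theorem5:
  fixes C_reg C_gr :: real
  assumes "C_reg \<ge> 0" and "C_gr \<ge> 0"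
  shows "\<exists>\<sigma>\<^sub>0\<ge>0. \<forall>\<omega> :: nat \<Rightarrow> real^2 \<Rightarrow> real.
    (\<forall>k\<ge>1. \<omega> k \<in> Cc_smooth \<and> (\<forall>x. \<omega> k x \<le> 0)) \<longrightarrow>
    (\<exists>K. \<forall>k\<ge>K. \<forall>x. \<omega> k x = 0) \<longrightarrow>
    (\<forall>k\<ge>1. supp (\<omega> k) \<subseteq> {x. 2 ^ (k - 1) \<le> norm x \<and> norm x \<le> 2 ^ (k + 1)}) \<longrightarrow>
    (\<forall>k\<ge>1. S13_norm (\<omega> k) \<le> C_reg) \<longrightarrow>
    (\<Sum>\<^sub>\<infinity>k\<in>{1..}. - (INF \<theta>. xray (\<lambda>x. \<omega> k x / (norm x)\<^sup>2) 0 \<theta>)) \<le> C_gr \<longrightarrow>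
    (\<exists>\<omega>'\<in>Cc_smooth.
      (\<forall>x. \<omega>' x \<le> (\<Sum>\<^sub>\<infinity>k\<in>{1..}. \<omega> k x)) \<and>
      (\<forall>\<sigma>\<ge>\<sigma>\<^sub>0. plurisubharmonic (\<lambda>z. ereal (extension \<omega>' z + \<sigma> * norm (im_vec z)))))"
proof -
  obtain b where b: "smooth b" "\<And>x. 0 \<le> b x" "\<And>x. norm x \<le> 2 \<Longrightarrow> 1 \<le> b x" "\<And>x. 3 < norm x \<Longrightarrow> b x = 0"
    using bump_exists by blast
  have "\<exists>B\<ge>0. \<forall>x. \<bar>partial_deriv i (partial_deriv j b) x\<bar> \<le> B" for i j
  proof -
    have v: "partial_deriv i (partial_deriv j b) x = 0" if "3 < norm x" for x
      unfolding partial_deriv_dirderiv by (rule dirderiv_vanish[OF dirderiv_vanish[OF b(4)] that])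
    show ?thesis
      by (rule bounded_of_support[OF smooth_continuous[OF smooth_partial_deriv[OF smooth_partial_deriv[OF b(1)]]] v]) auto
  qed
  then obtain Bij where Bij: "\<And>i j. 0 \<le> Bij i j" "\<And>i j x. \<bar>partial_deriv i (partial_deriv j b) x\<bar> \<le> Bij i j"
    by metis
  define B where "B = 4 * (Bij 1 1 + Bij 1 2 + Bij 2 1 + Bij 2 2)"
  have B0: "0 \<le> B" using Bij(1) by (simp add: B_def add_nonneg_nonneg)
  have B: "\<bar>dirderiv n (dirderiv n b) x\<bar> \<le> B" if "norm n = 1" for n x
    unfolding B_def
  proof (rule dirderiv2_bound[OF b(1) that])
    fix i j
    show "\<bar>partial_deriv i (partial_deriv j b) x\<bar> \<le> Bij 1 1 + Bij 1 2 + Bij 2 1 + Bij 2 2"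
      using exhaust_2[of i] exhaust_2[of j] Bij(1)[of 1 1] Bij(1)[of 1 2] Bij(1)[of 2 1] Bij(1)[of 2 2]
        Bij(2)[of i j x] by auto
  qed
  define \<sigma>0 where "\<sigma>0 = 512 * C_reg + 96 * B * C_gr"
  have \<sigma>0: "0 \<le> \<sigma>0" using assms B0 by (simp add: \<sigma>0_def)
  show ?thesis
  proof (intro exI[of _ \<sigma>0] conjI allI impI \<sigma>0)
    fix \<omega> :: "nat \<Rightarrow> real^2 \<Rightarrow> real"
    assume sm: "\<forall>k\<ge>1. \<omega> k \<in> Cc_smooth \<and> (\<forall>x. \<omega> k x \<le> 0)"
      and fin: "\<exists>K. \<forall>k\<ge>K. \<forall>x. \<omega> k x = 0"
      and supp: "\<forall>k\<ge>1. supp (\<omega> k) \<subseteq> {x. 2 ^ (k - 1) \<le> norm x \<and> norm x \<le> 2 ^ (k + 1)}"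
      and reg: "\<forall>k\<ge>1. S13_norm (\<omega> k) \<le> C_reg"
      and gr: "(\<Sum>\<^sub>\<infinity>k\<in>{1..}. - (INF \<theta>. xray (\<lambda>x. \<omega> k x / (norm x)\<^sup>2) 0 \<theta>)) \<le> C_gr"
    obtain K where K: "\<And>k x. k \<ge> K \<Longrightarrow> \<omega> k x = 0" using fin by blast
    define q where "q k = - (INF \<theta>. xray (\<lambda>x. \<omega> k x / (norm x)\<^sup>2) 0 \<theta>)" for k
    define p where "p k x = \<omega> k x - dilation_mean 0 (\<omega> k) x - 16 * 2 ^ k * q k * b ((1 / 2 ^ k) *\<^sub>R x)" for k x
    define \<omega>' where "\<omega>' x = (\<Sum>k\<in>{1..K}. p k x)" for x
    have sumq: "(\<Sum>\<^sub>\<infinity>k\<in>{1..}. q k) = (\<Sum>k\<in>{1..K}. q k)"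
    proof -
      have "q k = 0" if "k \<ge> K" for k
        using K[OF that] by (simp add: q_def xray_def)
      then have "(\<Sum>\<^sub>\<infinity>k\<in>{1..}. q k) = (\<Sum>\<^sub>\<infinity>k\<in>{1..K}. q k)"
        by (intro infsum_cong_neutral) auto
      then show ?thesis by simp
    qed
    have sum\<omega>: "(\<Sum>\<^sub>\<infinity>k\<in>{1..}. \<omega> k x) = (\<Sum>k\<in>{1..K}. \<omega> k x)" for x
    proof -
      have "(\<Sum>\<^sub>\<infinity>k\<in>{1..}. \<omega> k x) = (\<Sum>\<^sub>\<infinity>k\<in>{1..K}. \<omega> k x)"
        using K by (intro infsum_cong_neutral) auto
      then show ?thesis by simp
    qed
    have q0: "0 \<le> q k" and ple: "p k x \<le> \<omega> k x" if "k \<ge> 1" for k x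
    proof -
      have f: "\<omega> k \<in> Cc_smooth" "\<And>x. \<omega> k x \<le> 0" "supp (\<omega> k) \<subseteq> {x. 2 ^ (k - 1) \<le> norm x \<and> norm x \<le> 2 ^ (k + 1)}"
        using that sm supp by blast+
      show "0 \<le> q k" unfolding q_def by (rule modified_piece_le(1)[OF f that b(2,3)])
      show "p k x \<le> \<omega> k x" unfolding q_def p_def by (rule modified_piece_le(2)[OF f that b(2,3)])
    qed
    have piece: "smooth (p k)" "\<And>x. 4 * 2 ^ k < norm x \<Longrightarrow> p k x = 0"
      "orthonormal d n \<Longrightarrow> - (128 * C_reg * (if \<bar>s\<bar> \<le> 2 ^ (k + 1) then \<bar>s\<bar> / 2 ^ k else 0) + 96 * B * q k)
         \<le> slice d n (dirderiv n (dirderiv n (p k))) s" if "k \<ge> 1" for k d n s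
    proof -
      have f: "\<omega> k \<in> Cc_smooth" "supp (\<omega> k) \<subseteq> {x. 2 ^ (k - 1) \<le> norm x \<and> norm x \<le> 2 ^ (k + 1)}" "S13_norm (\<omega> k) \<le> C_reg"
        using that sm supp reg by blast+
      have *: "smooth (p k) \<and> (\<forall>x. 4 * 2 ^ k < norm x \<longrightarrow> p k x = 0) \<and>
        - (128 * C_reg * (if \<bar>s\<bar> \<le> 2 ^ (k + 1) then \<bar>s\<bar> / 2 ^ k else 0) + 96 * B * q k)
         \<le> slice d n (dirderiv n (dirderiv n (p k))) s" if "orthonormal d n" for d n s
        unfolding p_def
        using modified_piece_slice_bound[OF that f(1,2) \<open>k \<ge> 1\<close> f(3) b(1,4) B B0 q0[OF \<open>k \<ge> 1\<close>]] by blast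
      have "orthonormal (axis 1 1) (axis 2 1)" by (simp add: orthonormal_def inner_axis_axis)
      from *[OF this] * show "smooth (p k)" "\<And>x. 4 * 2 ^ k < norm x \<Longrightarrow> p k x = 0"
        "orthonormal d n \<Longrightarrow> - (128 * C_reg * (if \<bar>s\<bar> \<le> 2 ^ (k + 1) then \<bar>s\<bar> / 2 ^ k else 0) + 96 * B * q k)
         \<le> slice d n (dirderiv n (dirderiv n (p k))) s" by blast+
    qed
    have s\<omega>: "smooth \<omega>'" unfolding \<omega>'_def by (intro smooth_sum piece) auto
    have pvan: "p k x = 0" if "k \<in> {1..K}" "4 * 2 ^ K < norm x" for k x
    proof -
      have "(2::real) ^ k \<le> 2 ^ K" using that by (intro power_increasing) auto
      then have "4 * 2 ^ k < norm x" using that(2) by linarith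
      then show ?thesis using that(1) by (intro piece(2)) auto
    qed
    have van: "\<omega>' x = 0" if "4 * 2 ^ K < norm x" for x
      unfolding \<omega>'_def using pvan that by (intro sum.neutral) auto
    have line: "- \<sigma>0 \<le> (LINT t|lborel. dirderiv n (dirderiv n \<omega>') (x + t *\<^sub>R d))"
      if "norm d = 1" "norm n = 1" "d \<bullet> n = 0" for x d n
    proof -
      have on: "orthonormal d n" using that by (simp add: orthonormal_def)
      define s where "s = x \<bullet> n"
      have D2: "dirderiv n (dirderiv n \<omega>') = (\<lambda>x. \<Sum>k\<in>{1..K}. dirderiv n (dirderiv n (p k)) x)"
      proof -
        have sp: "smooth (p k)" if "k \<in> {1..K}" for k using that piece(1) by auto
        have "dirderiv n \<omega>' = (\<lambda>x. \<Sum>k\<in>{1..K}. dirderiv n (p k) x)"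
          unfolding \<omega>'_def by (rule dirderiv_sum[OF sp])
        then show ?thesis by (simp only:) (rule dirderiv_sum[OF smooth_dirderiv[OF sp]])
      qed
      have int: "integrable lborel (\<lambda>t. dirderiv n (dirderiv n (p k)) (s *\<^sub>R n + t *\<^sub>R d))" if "k \<in> {1..K}" for k
      proof (rule slice_eq_integral(1)[OF on _ _ order_refl])
        show "continuous_on UNIV (dirderiv n (dirderiv n (p k)))"
          using that by (intro smooth_continuous smooth_dirderiv piece) auto
        show "dirderiv n (dirderiv n (p k)) x = 0" if "4 * 2 ^ K < norm x" for x
          by (rule dirderiv_vanish[OF dirderiv_vanish[OF pvan[OF \<open>k \<in> {1..K}\<close>]] that])
      qed
      have "(\<Sum>k\<in>{1..K}. q k) \<le> C_gr" using gr sumq by (simp add: q_def)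
      then have "96 * B * (\<Sum>k\<in>{1..K}. q k) \<le> 96 * B * C_gr" using B0 by (intro mult_left_mono) auto
      moreover have "128 * C_reg * (\<Sum>k\<in>{1..K}. if \<bar>s\<bar> \<le> 2 ^ (k + 1) then \<bar>s\<bar> / 2 ^ k else 0) \<le> 128 * C_reg * 4"
        using assms by (intro mult_left_mono geometric_sum_bound) auto
      ultimately have "- \<sigma>0 \<le> - (128 * C_reg * (\<Sum>k\<in>{1..K}. if \<bar>s\<bar> \<le> 2 ^ (k + 1) then \<bar>s\<bar> / 2 ^ k else 0)
          + 96 * B * (\<Sum>k\<in>{1..K}. q k))"
        unfolding \<sigma>0_def by linarith
      also have "\<dots> = (\<Sum>k\<in>{1..K}. - (128 * C_reg * (if \<bar>s\<bar> \<le> 2 ^ (k + 1) then \<bar>s\<bar> / 2 ^ k else 0) + 96 * B * q k))"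
        unfolding sum_negf sum.distrib sum_distrib_left[symmetric] ..
      also have "\<dots> \<le> (\<Sum>k\<in>{1..K}. slice d n (dirderiv n (dirderiv n (p k))) s)"
        using on by (intro sum_mono piece) auto
      also have "\<dots> = slice d n (dirderiv n (dirderiv n \<omega>')) s"
        unfolding D2 slice_def using int by (subst Bochner_Integration.integral_sum) auto
      also have "\<dots> = (LINT t|lborel. dirderiv n (dirderiv n \<omega>') (x + t *\<^sub>R d))"
        unfolding LINT_line_slice[OF on] s_def ..
      finally show ?thesis .
    qed
    show "\<exists>\<omega>'\<in>Cc_smooth.
      (\<forall>x. \<omega>' x \<le> (\<Sum>\<^sub>\<infinity>k\<in>{1..}. \<omega> k x)) \<and>
      (\<forall>\<sigma>\<ge>\<sigma>0. plurisubharmonic (\<lambda>z. ereal (extension \<omega>' z + \<sigma> * norm (im_vec z))))"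
    proof (intro bexI[of _ \<omega>'] conjI allI impI)
      show "\<omega>' \<in> Cc_smooth" by (rule Cc_smoothI[OF s\<omega> van])
      show "\<omega>' x \<le> (\<Sum>\<^sub>\<infinity>k\<in>{1..}. \<omega> k x)" for x
        unfolding sum\<omega> \<omega>'_def by (intro sum_mono ple) auto
      show "plurisubharmonic (\<lambda>z. ereal (extension \<omega>' z + \<sigma> * norm (im_vec z)))" if "\<sigma> \<ge> \<sigma>0" for \<sigma>
        by (rule extension_plurisubharmonic[OF s\<omega> van line \<sigma>0 that])
    qed
  qed
qed

end
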